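(* Let $N\ge 1$, let $\Omega\subset\mathbb{R}^N$ be a bounded star-shaped domain whose boundary $\partial\Omega$ is a $C^1$-manifold, and let $\lambda>0$. (1) If $(\alpha,\beta)\in\mathcal{C}(N)$, then any flat ground state $u$ of $SP(\alpha,\beta,\lambda)$ satisfies $\Phi_u''(r)|_{r=1}=0$. (2) If $(\alpha,\beta)\in\mathcal{E}_u(N)$, then any flat ground state $u$ of $SP(\alpha,\beta,\lambda)$ satisfies $\Phi_u''(r)|_{r=1}<0$. (3) If $(\alpha,\beta)\in\mathcal{E}_s(N)$, then any ground state $u$ of $SP(\alpha,\beta,\lambda)$ satisfies $\Phi_u''(r)|_{r=1}>0$.
   Context: Exponent sets: $\mathcal{E}=\{(\alpha,\beta):0<\alpha<\beta\le 1\}$, and with $D_N(\alpha,\beta)=2(1+\alpha)(1+\beta)-N(1-\alpha)(1-\beta)$, $\mathcal{C}(N)=\{(\alpha,\beta)\in\mathcal{E}: D_N=0\}$, $\mathcal{E}_s(N)=\{(\alpha,\beta)\in\mathcal{E}: D_N<0\}$, $\mathcal{E}_u(N)=\{(\alpha,\beta)\in\mathcal{E}: D_N>0\}$. $SP(\alpha,\beta,\lambda)$ is the stationary problem $-\Delta u+|u|^{\alpha-1}u=\lambda|u|^{\beta-1}u$ in $\Omega$, $u=0$ on $\partial\Omega$; weak solutions are sought in $H_0^1(\Omega)$. Its energy is $E_\lambda(u)=\frac12\int_\Omega|\nabla u|^2\,dx+\frac1{\alpha+1}\int_\Omega|u|^{\alpha+1}\,dx-\frac{\lambda}{\beta+1}\int_\Omega|u|^{\beta+1}\,dx$.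 A ground state is a nonzero weak solution $u$ with $E_\lambda(u)\le E_\lambda(w)$ for every nonzero weak solution $w$. A flat solution is a weak solution $u$ with $\frac{\partial u}{\partial\nu}=0$ on $\partial\Omega$ ($\nu$ the unit outward normal); a flat ground state is a ground state that is flat. The fibering map is $\Phi_u(r)=E_\lambda(ru)$, $r>0$, so $\Phi_u''(1)=\int_\Omega|\nabla u|^2+\alpha\int_\Omega|u|^{\alpha+1}-\lambda\beta\int_\Omega|u|^{\beta+1}$. *)

theory Defs
  imports "HOL-Analysis.Analysis"
begin

section \<open>Exponents\<close>

definition exps :: "(real \<times> real) set" where
  "exps = {(\<alpha>, \<beta>). 0 < \<alpha> \<and> \<alpha> < \<beta> \<and> \<beta> \<le> 1}"

definition discr :: "nat \<Rightarrow> real \<Rightarrow> real \<Rightarrow> real" where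
  "discr N \<alpha> \<beta> = 2 * (1 + \<alpha>) * (1 + \<beta>) - real N * (1 - \<alpha>) * (1 - \<beta>)"

definition exps_crit :: "nat \<Rightarrow> (real \<times> real) set" where
  "exps_crit N = {(\<alpha>, \<beta>) \<in> exps. discr N \<alpha> \<beta> = 0}"

definition exps_stable :: "nat \<Rightarrow> (real \<times> real) set" where
  "exps_stable N = {(\<alpha>, \<beta>) \<in> exps. discr N \<alpha> \<beta> < 0}"

definition exps_unstable :: "nat \<Rightarrow> (real \<times> real) set" where
  "exps_unstable N = {(\<alpha>, \<beta>) \<in> exps. discr N \<alpha> \<beta> > 0}"

section \<open>Domains with C1 boundary\<close>

definition grad :: "('a::euclidean_space \<Rightarrow> real) \<Rightarrow> 'a \<Rightarrow> 'a" where
  "grad f x = (THE D. GDERIV f x :> D)"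

text \<open>Intended for open sets only: the derivatives are two-sided.\<close>

definition C1_on :: "'a::euclidean_space set \<Rightarrow> ('a \<Rightarrow> real) \<Rightarrow> bool" where
  "C1_on U f \<longleftrightarrow> (\<forall>x\<in>U. \<exists>D. GDERIV f x :> D) \<and> continuous_on U (grad f)"

text \<open>Near a boundary point, \<open>\<Omega>\<close> is the sublevel set of a C1 function without critical points.
  This makes the boundary a C1 hypersurface with \<open>\<Omega>\<close> locally on one side of it, and
  \<open>grad \<rho>\<close> points out of \<open>\<Omega>\<close>.\<close>

definition local_defining_function ::
    "'a::euclidean_space set \<Rightarrow> 'a \<Rightarrow> 'a set \<Rightarrow> ('a \<Rightarrow> real) \<Rightarrow> bool" where
  "local_defining_function \<Omega> x U \<rho> \<longleftrightarrow>
     open U \<and> x \<in> U \<and> C1_on U \<rho> \<and> (\<forall>y\<in>U. grad \<rho> y \<noteq> 0) \<and> \<Omega> \<inter> U = {y\<in>U. \<rho> y < 0}"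

definition C1_boundary :: "'a::euclidean_space set \<Rightarrow> bool" where
  "C1_boundary \<Omega> \<longleftrightarrow> (\<forall>x\<in>frontier \<Omega>. \<exists>U \<rho>. local_defining_function \<Omega> x U \<rho>)"

definition outward_unit_normal :: "'a::euclidean_space set \<Rightarrow> 'a \<Rightarrow> 'a \<Rightarrow> bool" where
  "outward_unit_normal \<Omega> x \<nu> \<longleftrightarrow> x \<in> frontier \<Omega> \<and>
     (\<exists>U \<rho>. local_defining_function \<Omega> x U \<rho> \<and> \<nu> = grad \<rho> x /\<^sub>R norm (grad \<rho> x))"

section \<open>The Sobolev space of functions with zero trace\<close>

text \<open>Functions are defined on the whole space, but only their restriction to \<open>\<Omega>\<close>, up to
  null sets, is relevant.\<close>

definition L2_on :: "'a::euclidean_space set \<Rightarrow> ('a \<Rightarrow> 'b::euclidean_space) \<Rightarrow> bool" where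
  "L2_on \<Omega> f \<longleftrightarrow> set_borel_measurable lebesgue \<Omega> f \<and>
     set_integrable lebesgue \<Omega> (\<lambda>x. (norm (f x))\<^sup>2)"

definition C1c :: "'a::euclidean_space set \<Rightarrow> ('a \<Rightarrow> real) set" where
  "C1c \<Omega> = {\<phi>. C1_on UNIV \<phi> \<and> compact (closure {x. \<phi> x \<noteq> 0}) \<and> closure {x. \<phi> x \<noteq> 0} \<subseteq> \<Omega>}"

definition is_weak_gradient ::
    "'a::euclidean_space set \<Rightarrow> ('a \<Rightarrow> real) \<Rightarrow> ('a \<Rightarrow> 'a) \<Rightarrow> bool" where
  "is_weak_gradient \<Omega> u G \<longleftrightarrow>
     (\<forall>\<phi>\<in>C1c \<Omega>. (LINT x:\<Omega>|lebesgue. u x *\<^sub>R grad \<phi> x) = - (LINT x:\<Omega>|lebesgue. \<phi> x *\<^sub>R G x))"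

definition H1 :: "'a::euclidean_space set \<Rightarrow> ('a \<Rightarrow> real) set" where
  "H1 \<Omega> = {u. L2_on \<Omega> u \<and> (\<exists>G. L2_on \<Omega> G \<and> is_weak_gradient \<Omega> u G)}"

text \<open>The weak gradient is determined up to null sets only; this picks a representative.\<close>

definition wgrad :: "'a::euclidean_space set \<Rightarrow> ('a \<Rightarrow> real) \<Rightarrow> 'a \<Rightarrow> 'a" where
  "wgrad \<Omega> u = (SOME G. L2_on \<Omega> G \<and> is_weak_gradient \<Omega> u G)"

text \<open>Closure of the compactly supported C1 functions in the norm of \<open>H1\<close>. Starting from
  smooth functions gives the same space.\<close>

definition H1_0 :: "'a::euclidean_space set \<Rightarrow> ('a \<Rightarrow> real) set" where
  "H1_0 \<Omega> = {u \<in> H1 \<Omega>. \<exists>\<phi> :: nat \<Rightarrow> 'a \<Rightarrow> real. (\<forall>n. \<phi> n \<in> C1c \<Omega>) \<and>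
     (\<lambda>n. (LINT x:\<Omega>|lebesgue. (u x - \<phi> n x)\<^sup>2)
        + (LINT x:\<Omega>|lebesgue. (norm (wgrad \<Omega> u x - grad (\<phi> n) x))\<^sup>2)) \<longlonglongrightarrow> 0}"

section \<open>The stationary problem\<close>

text \<open>Since \<open>0 powr a = 0\<close>, the term \<open>\<bar>u x\<bar> powr (\<alpha> - 1) * u x\<close> vanishes where \<open>u\<close> does, as it should.\<close>

definition weak_solution ::
    "'a::euclidean_space set \<Rightarrow> real \<Rightarrow> real \<Rightarrow> real \<Rightarrow> ('a \<Rightarrow> real) \<Rightarrow> bool" where
  "weak_solution \<Omega> \<alpha> \<beta> lam u \<longleftrightarrow> u \<in> H1_0 \<Omega> \<and>
     (\<forall>\<phi>\<in>H1_0 \<Omega>.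
        (LINT x:\<Omega>|lebesgue. wgrad \<Omega> u x \<bullet> wgrad \<Omega> \<phi> x)
        + (LINT x:\<Omega>|lebesgue. (\<bar>u x\<bar> powr (\<alpha> - 1) * u x) * \<phi> x)
        = lam * (LINT x:\<Omega>|lebesgue. (\<bar>u x\<bar> powr (\<beta> - 1) * u x) * \<phi> x))"

definition nonzero_on :: "'a::euclidean_space set \<Rightarrow> ('a \<Rightarrow> real) \<Rightarrow> bool" where
  "nonzero_on \<Omega> u \<longleftrightarrow> \<not> (AE x in lebesgue. x \<in> \<Omega> \<longrightarrow> u x = 0)"

definition energy ::
    "'a::euclidean_space set \<Rightarrow> real \<Rightarrow> real \<Rightarrow> real \<Rightarrow> ('a \<Rightarrow> real) \<Rightarrow> real" where
  "energy \<Omega> \<alpha> \<beta> lam u =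
     1 / 2 * (LINT x:\<Omega>|lebesgue. (norm (wgrad \<Omega> u x))\<^sup>2)
     + 1 / (\<alpha> + 1) * (LINT x:\<Omega>|lebesgue. \<bar>u x\<bar> powr (\<alpha> + 1))
     - lam / (\<beta> + 1) * (LINT x:\<Omega>|lebesgue. \<bar>u x\<bar> powr (\<beta> + 1))"

definition fibering ::
    "'a::euclidean_space set \<Rightarrow> real \<Rightarrow> real \<Rightarrow> real \<Rightarrow> ('a \<Rightarrow> real) \<Rightarrow> real \<Rightarrow> real" where
  "fibering \<Omega> \<alpha> \<beta> lam u r = energy \<Omega> \<alpha> \<beta> lam (\<lambda>x. r * u x)"

definition ground_state ::
    "'a::euclidean_space set \<Rightarrow> real \<Rightarrow> real \<Rightarrow> real \<Rightarrow> ('a \<Rightarrow> real) \<Rightarrow> bool" where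
  "ground_state \<Omega> \<alpha> \<beta> lam u \<longleftrightarrow> weak_solution \<Omega> \<alpha> \<beta> lam u \<and> nonzero_on \<Omega> u \<and>
     (\<forall>w. weak_solution \<Omega> \<alpha> \<beta> lam w \<and> nonzero_on \<Omega> w \<longrightarrow>
        energy \<Omega> \<alpha> \<beta> lam u \<le> energy \<Omega> \<alpha> \<beta> lam w)"

text \<open>A representative that is C1 up to the boundary; \<open>V\<close> is the continuous extension of its
  gradient to the closure.\<close>

definition C1_closure_rep ::
    "'a::euclidean_space set \<Rightarrow> ('a \<Rightarrow> real) \<Rightarrow> ('a \<Rightarrow> real) \<Rightarrow> ('a \<Rightarrow> 'a) \<Rightarrow> bool" where
  "C1_closure_rep \<Omega> u v V \<longleftrightarrow> (AE x in lebesgue. x \<in> \<Omega> \<longrightarrow> u x = v x) \<and>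
     continuous_on (closure \<Omega>) v \<and> continuous_on (closure \<Omega>) V \<and> (\<forall>x\<in>\<Omega>. GDERIV v x :> V x)"

text \<open>The normal derivative is the classical one, \<open>V \<bullet> \<nu>\<close>, which needs \<open>u\<close> to be C1 up to the
  boundary. On a domain with C1 boundary, \<open>v\<close>, \<open>V\<close> and the normal are unique there.\<close>

definition normal_derivative_zero :: "'a::euclidean_space set \<Rightarrow> ('a \<Rightarrow> real) \<Rightarrow> bool" where
  "normal_derivative_zero \<Omega> u \<longleftrightarrow>
     (\<exists>v V. C1_closure_rep \<Omega> u v V \<and>
        (\<forall>x\<in>frontier \<Omega>. \<forall>\<nu>. outward_unit_normal \<Omega> x \<nu> \<longrightarrow> V x \<bullet> \<nu> = 0))"

definition flat_solution ::
    "'a::euclidean_space set \<Rightarrow> real \<Rightarrow> real \<Rightarrow> real \<Rightarrow> ('a \<Rightarrow> real) \<Rightarrow> bool" where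
  "flat_solution \<Omega> \<alpha> \<beta> lam u \<longleftrightarrow> weak_solution \<Omega> \<alpha> \<beta> lam u \<and> normal_derivative_zero \<Omega> u"

definition flat_ground_state ::
    "'a::euclidean_space set \<Rightarrow> real \<Rightarrow> real \<Rightarrow> real \<Rightarrow> ('a \<Rightarrow> real) \<Rightarrow> bool" where
  "flat_ground_state \<Omega> \<alpha> \<beta> lam u \<longleftrightarrow> ground_state \<Omega> \<alpha> \<beta> lam u \<and> flat_solution \<Omega> \<alpha> \<beta> lam u"

end

theory Submission
  imports Defs
begin

text \<open>
  Write \<open>A\<close>, \<open>B\<close>, \<open>C\<close> for the integrals of \<open>|\<nabla>u|\<^sup>2\<close>, \<open>|u|\<^sup>\<alpha>\<^sup>+\<^sup>1\<close> and \<open>\<lambda> |u|\<^sup>\<beta>\<^sup>+\<^sup>1\<close>, let \<open>a\<close> be a star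
  centre of \<open>\<Omega>\<close>, and test the equation with the rescaled solution \<open>u\<^sub>t x = u (a + t (x - a))\<close>, where
  \<open>u\<close> is extended by zero. For \<open>t = 1\<close> this gives \<open>A + B = C\<close>. For \<open>t > 1\<close> the function \<open>u\<^sub>t\<close> is
  admissible because \<open>\<Omega>\<close> is star-shaped. Estimating the first two terms by convexity and the third up
  to \<open>O(|t - 1|\<^sup>1\<^sup>+\<^sup>\<beta>)\<close>, which needs no more than \<open>\<parallel>u\<^sub>t - u\<parallel> = O(|t - 1|)\<close> in \<open>L\<^sup>2\<close>, and letting \<open>t\<close> tend
  to 1 gives the Pohozaev inequality \<open>P = (N - 2)/(2N) A + B/(\<alpha> + 1) - C/(\<beta> + 1) \<le> 0\<close>. No regularity
  of \<open>u\<close> beyond \<open>H\<^sup>1\<close> enters. A flat solution satisfies the equation against all test functions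
  on the whole space, so \<open>t < 1\<close> is admissible too and \<open>P = 0\<close>. Eliminating \<open>B\<close> and \<open>C\<close>,
  \<open>\<Phi>''(1) = A + \<alpha> B - \<beta> C = - A D\<^sub>N / (2N) - (1 + \<alpha>) (1 + \<beta>) P\<close>. Finally \<open>A > 0\<close>, since \<open>A = 0\<close> would give
  \<open>B = C\<close> and then \<open>P \<le> 0\<close> would force \<open>B = 0\<close>.
\<close>

section \<open>C1 functions and cut-offs\<close>

text \<open>The classical proof multiplies the equation by (x - a) . grad u, which for a mere
  \<open>H1\<close> function is no admissible test function; the finite rescaling takes its place,
  so everything is estimated instead of differentiated. The estimates become equalities at t = 1,
  where A + B = C cancels the zeroth order. Dividing by |t - 1| then leaves a one-sided derivative,
  and each side of 1 yields one sign of P. Young's inequality bounds the gradient pairing and the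
  \<alpha>-term in the right direction. The \<beta>-term has the opposite sign: there Young is
  applied with u and u_t exchanged, at the price of a Hoelder error |u_t - u|^(1+\<beta>), whose
  integral is o(|t - 1|) because \<beta> > 0. Only the C1 functions approximating u are rescaled;
  the limit is taken afterwards, for fixed t. A flat solution is carried across the boundary by a
  cut-off. Its gradient has size 1/\<epsilon> on a layer of thickness \<epsilon> and is normal to
  the boundary to leading order, while the normal component of grad u tends to 0 in that
  layer.\<close>

lemma GDERIV_unique: "GDERIV f x :> D \<Longrightarrow> GDERIV f x :> E \<Longrightarrow> D = E"
  unfolding gderiv_def
  using has_derivative_unique by (metis inner_commute vector_eq_rdot)

lemma grad_eqI: "GDERIV f x :> D \<Longrightarrow> grad f x = D"
  unfolding grad_def using GDERIV_unique by blast

lemma C1_onD: "C1_on U f \<Longrightarrow> x \<in> U \<Longrightarrow> GDERIV f x :> grad f x"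
  unfolding C1_on_def using grad_eqI by metis

lemma C1_onI:
  assumes "\<And>x. x \<in> U \<Longrightarrow> GDERIV f x :> g x" and "continuous_on U g"
  shows "C1_on U f"
proof -
  have "continuous_on U (grad f)"
    by (subst continuous_on_cong[OF refl, where g = g]) (auto intro!: grad_eqI assms)
  then show ?thesis
    using assms(1) by (auto simp: C1_on_def)
qed

lemma C1_on_subset: "C1_on U f \<Longrightarrow> W \<subseteq> U \<Longrightarrow> C1_on W f"
  unfolding C1_on_def using continuous_on_subset by blast

lemma GDERIV_transform_open:
  assumes "GDERIV f x :> D" and "open W" and "x \<in> W" and "\<And>y. y \<in> W \<Longrightarrow> f y = g y"
  shows "GDERIV g x :> D"
  using assms unfolding gderiv_def by (blast intro: has_derivative_transform_within_open)

lemma GDERIV_eq_0_off_support: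
  assumes "x \<notin> closure {x. f x \<noteq> 0}"
  shows "GDERIV f x :> 0"
proof (rule GDERIV_transform_open[OF GDERIV_const])
  show "open (- closure {x. f x \<noteq> 0})" and "x \<in> - closure {x. f x \<noteq> 0}"
    using assms by auto
  show "0 = f y" if "y \<in> - closure {x. f x \<noteq> 0}" for y
    using that closure_subset[of "{x. f x \<noteq> 0}"] by auto
qed

lemma grad_eq_0_off_support: "x \<notin> closure {x. f x \<noteq> 0} \<Longrightarrow> grad f x = 0"
  by (rule grad_eqI[OF GDERIV_eq_0_off_support])

lemma C1_on_imp_continuous_on:
  assumes "C1_on U f"
  shows "continuous_on U f"
  unfolding continuous_on_eq_continuous_within
proof
  fix x assume "x \<in> U"
  then have "FDERIV f x :> (\<lambda>h. h \<bullet> grad f x)"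
    using C1_onD[OF assms] gderiv_def by blast
  then show "continuous (at x within U) f"
    using has_derivative_continuous continuous_at_imp_continuous_at_within by blast
qed

lemma C1_on_const: "C1_on U (\<lambda>x. k)"
  by (rule C1_onI[where g = "\<lambda>x. 0"]) (auto simp: GDERIV_const)

lemma
  assumes "C1_on U f" and "C1_on U g"
  shows C1_on_add: "C1_on U (\<lambda>x. f x + g x)"
    and C1_on_diff: "C1_on U (\<lambda>x. f x - g x)"
    and C1_on_mult: "C1_on U (\<lambda>x. f x * g x)"
proof -
  note c [continuous_intros] = C1_on_imp_continuous_on[OF assms(1)] C1_on_imp_continuous_on[OF assms(2)]
    and d [continuous_intros] = conjunct2[OF assms(1)[unfolded C1_on_def]] conjunct2[OF assms(2)[unfolded C1_on_def]]
  show "C1_on U (\<lambda>x. f x + g x)"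
    by (rule C1_onI[OF GDERIV_add[OF assms[THEN C1_onD]]]) (auto intro!: continuous_intros)
  show "C1_on U (\<lambda>x. f x - g x)"
    by (rule C1_onI[OF GDERIV_diff[OF assms[THEN C1_onD]]]) (auto intro!: continuous_intros)
  show "C1_on U (\<lambda>x. f x * g x)"
    by (rule C1_onI[OF GDERIV_mult[OF assms[THEN C1_onD]]]) (auto intro!: continuous_intros)
qed

lemma grad_mult:
  assumes "C1_on U f" and "C1_on U g" and "x \<in> U"
  shows "grad (\<lambda>x. f x * g x) x = f x *\<^sub>R grad g x + g x *\<^sub>R grad f x"
  using assms by (intro grad_eqI GDERIV_mult C1_onD)

lemma C1_on_compose:
  assumes "C1_on U f" and "\<And>t. DERIV h t :> h' t" and "continuous_on UNIV h'"
  shows "C1_on U (\<lambda>x. h (f x))"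
proof (rule C1_onI[OF GDERIV_DERIV_compose[OF C1_onD[OF assms(1)] assms(2)]])
  have "continuous_on U (\<lambda>x. h' (f x))"
    using continuous_on_compose2[OF assms(3) C1_on_imp_continuous_on[OF assms(1)]] by auto
  then show "continuous_on U (\<lambda>x. h' (f x) *\<^sub>R grad f x)"
    using assms(1) by (auto simp: C1_on_def intro!: continuous_intros)
qed

lemma C1_on_inner_left: "C1_on U (\<lambda>x. (x - a) \<bullet> e)"
  by (rule C1_onI[where g = "\<lambda>x. e"]) (auto simp: gderiv_def intro!: derivative_eq_intros)

lemma C1_on_norm_sq: "C1_on U (\<lambda>x. (norm (x - a))\<^sup>2)"
  unfolding power2_norm_eq_inner
  by (rule C1_onI[where g = "\<lambda>x. 2 *\<^sub>R (x - a)"])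
    (auto simp: gderiv_def inner_commute algebra_simps intro!: derivative_eq_intros continuous_intros)

lemma GDERIV_affine:
  assumes "GDERIV f (a + t *\<^sub>R (x - a)) :> D"
  shows "GDERIV (\<lambda>x. f (a + t *\<^sub>R (x - a))) x :> t *\<^sub>R D"
  unfolding gderiv_def
proof (rule has_derivative_eq_rhs)
  show "FDERIV (\<lambda>x. f (a + t *\<^sub>R (x - a))) x :> (\<lambda>h. (t *\<^sub>R h) \<bullet> D)"
    by (rule has_derivative_compose[where f = "\<lambda>x. a + t *\<^sub>R (x - a)", OF _ assms[unfolded gderiv_def]])
      (auto intro!: derivative_eq_intros)
qed simp

lemma
  assumes "C1_on UNIV f"
  shows C1_on_affine: "C1_on UNIV (\<lambda>x. f (a + t *\<^sub>R (x - a)))"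
    and grad_affine: "grad (\<lambda>x. f (a + t *\<^sub>R (x - a))) x = t *\<^sub>R grad f (a + t *\<^sub>R (x - a))"
proof -
  have c: "continuous_on UNIV (grad f)"
    using assms by (simp add: C1_on_def)
  show "C1_on UNIV (\<lambda>x. f (a + t *\<^sub>R (x - a)))"
    by (rule C1_onI[OF GDERIV_affine[OF C1_onD[OF assms]]])
      (auto intro!: continuous_intros continuous_on_compose2[OF c])
  show "grad (\<lambda>x. f (a + t *\<^sub>R (x - a))) x = t *\<^sub>R grad f (a + t *\<^sub>R (x - a))"
    by (rule grad_eqI[OF GDERIV_affine[OF C1_onD[OF assms]]]) simp
qed

section \<open>A C1 transition function on the real line\<close>

definition pos_sq :: "real \<Rightarrow> real" where
  "pos_sq t = (max 0 t)\<^sup>2"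

lemma pos_sq_eq_0_iff: "pos_sq t = 0 \<longleftrightarrow> t \<le> 0"
  by (simp add: pos_sq_def max_def)

lemma pos_sq_nonneg: "0 \<le> pos_sq t"
  by (simp add: pos_sq_def)

lemma DERIV_pos_sq: "DERIV pos_sq t :> 2 * max 0 t"
proof (cases "t = 0")
  case True
  have "\<bar>(pos_sq (0 + h) - pos_sq 0) / h\<bar> \<le> \<bar>h\<bar>" for h
    by (auto simp: pos_sq_def max_def power2_eq_square)
  then have "((\<lambda>h. (pos_sq (0 + h) - pos_sq 0) / h) \<longlongrightarrow> 0) (at 0)"
    by (intro Lim_null_comparison[OF always_eventually tendsto_rabs_zero[OF tendsto_ident_at]]) auto
  then show ?thesis
    using True by (simp add: DERIV_def)
next
  case False
  show ?thesis
  proof (cases "t > 0")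
    case True
    have "DERIV (\<lambda>t. t\<^sup>2) t :> 2 * max 0 t"
      using True by (auto intro!: derivative_eq_intros)
    then show ?thesis
      by (rule has_field_derivative_transform_within_open[where S = "{0<..}"])
        (use True in \<open>auto simp: pos_sq_def\<close>)
  next
    case False
    have "DERIV (\<lambda>t. 0) t :> 2 * max 0 t"
      using False \<open>t \<noteq> 0\<close> by (auto intro!: derivative_eq_intros)
    then show ?thesis
      by (rule has_field_derivative_transform_within_open[where S = "{..<0}"])
        (use False \<open>t \<noteq> 0\<close> in \<open>auto simp: pos_sq_def\<close>)
  qed
qed

text \<open>t and 1 - t are never both nonpositive, so the denominator is positive, and squaring the
  positive parts makes the quotient C1. It passes from 0 for t \<le> 0 to 1 for t \<ge> 1; all
  cut-offs below are composed from it.\<close>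

definition step :: "real \<Rightarrow> real" where
  "step t = pos_sq t / (pos_sq t + pos_sq (1 - t))"

definition step_deriv :: "real \<Rightarrow> real" where
  "step_deriv t = (2 * max 0 t * pos_sq (1 - t) + pos_sq t * (2 * max 0 (1 - t))) / (pos_sq t + pos_sq (1 - t))\<^sup>2"

lemma step_denominator_pos: "0 < pos_sq t + pos_sq (1 - t)"
proof -
  have "pos_sq t \<noteq> 0 \<or> pos_sq (1 - t) \<noteq> 0"
    by (auto simp: pos_sq_eq_0_iff)
  then show ?thesis
    using pos_sq_nonneg[of t] pos_sq_nonneg[of "1 - t"] by linarith
qed

lemma step_eq_0: "t \<le> 0 \<Longrightarrow> step t = 0"
  and step_eq_1: "1 \<le> t \<Longrightarrow> step t = 1"
  and step_deriv_eq_0: "t \<le> 0 \<or> 1 \<le> t \<Longrightarrow> step_deriv t = 0"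
  by (auto simp: step_def step_deriv_def pos_sq_def)

lemma step_nonneg: "0 \<le> step t"
  by (simp add: step_def pos_sq_nonneg)

lemma step_le_1: "step t \<le> 1"
  using step_denominator_pos[of t] pos_sq_nonneg[of "1 - t"] by (simp add: step_def)

lemma step_deriv_nonneg: "0 \<le> step_deriv t"
  unfolding step_deriv_def
  by (intro divide_nonneg_nonneg add_nonneg_nonneg mult_nonneg_nonneg pos_sq_nonneg) auto

lemma DERIV_step: "DERIV step t :> step_deriv t"
proof -
  have ne: "pos_sq t + pos_sq (1 - t) \<noteq> 0"
    using step_denominator_pos[of t] by simp
  have 1: "DERIV (\<lambda>t. pos_sq (1 - t)) t :> - (2 * max 0 (1 - t))"
  proof -
    have "DERIV (\<lambda>t::real. 1 - t) t :> - 1"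
      by (auto intro!: derivative_eq_intros)
    from DERIV_chain2[where f = pos_sq and g = "\<lambda>t. 1 - t", OF DERIV_pos_sq this]
    show ?thesis
      by simp
  qed
  have "DERIV (\<lambda>t. pos_sq t / (pos_sq t + pos_sq (1 - t))) t :>
      (2 * max 0 t * (pos_sq t + pos_sq (1 - t)) - pos_sq t * (2 * max 0 t + - (2 * max 0 (1 - t))))
      / ((pos_sq t + pos_sq (1 - t)) * (pos_sq t + pos_sq (1 - t)))"
    by (rule DERIV_divide DERIV_add DERIV_pos_sq 1 ne)+
  then show ?thesis
    by (simp add: step_def[abs_def] step_deriv_def power2_eq_square algebra_simps)
qed

lemma continuous_on_pos_sq [continuous_intros]:
  "continuous_on S f \<Longrightarrow> continuous_on S (\<lambda>x. pos_sq (f x))"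
  unfolding pos_sq_def by (intro continuous_intros)

lemma continuous_on_step_deriv: "continuous_on UNIV step_deriv"
proof -
  have "pos_sq t + pos_sq (1 - t) \<noteq> 0" for t
    using step_denominator_pos[of t] by simp
  then show ?thesis
    unfolding step_deriv_def[abs_def] by (intro continuous_intros) auto
qed

lemma C1_on_step: "C1_on U f \<Longrightarrow> C1_on U (\<lambda>x. step (f x))"
  by (rule C1_on_compose[OF _ DERIV_step continuous_on_step_deriv])

lemma C1_on_pos_sq: "C1_on U f \<Longrightarrow> C1_on U (\<lambda>x. pos_sq (f x))"
  by (rule C1_on_compose[OF _ DERIV_pos_sq]) (auto intro!: continuous_intros)

section \<open>Test functions with compact support\<close>

lemma C1c_I:
  assumes "C1_on UNIV \<phi>" and "compact K" and "K \<subseteq> \<Omega>" and "\<And>x. x \<notin> K \<Longrightarrow> \<phi> x = 0"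
  shows "\<phi> \<in> C1c \<Omega>"
proof -
  have "closure {x. \<phi> x \<noteq> 0} \<subseteq> K"
    using assms by (intro closure_minimal compact_imp_closed) auto
  moreover from this have "compact (closure {x. \<phi> x \<noteq> 0})"
    using compact_Int_closed[OF assms(2), of "closure {x. \<phi> x \<noteq> 0}"] by (simp add: inf.absorb2)
  ultimately show ?thesis
    using assms by (auto simp: C1c_def)
qed

lemma C1c_E:
  assumes "\<phi> \<in> C1c \<Omega>"
  obtains K where "C1_on UNIV \<phi>" and "compact K" and "K \<subseteq> \<Omega>"
    and "\<And>x. x \<notin> K \<Longrightarrow> \<phi> x = 0" and "\<And>x. x \<notin> K \<Longrightarrow> grad \<phi> x = 0"
proof (rule that[of "closure {x. \<phi> x \<noteq> 0}"])
  show "\<phi> x = 0" if "x \<notin> closure {x. \<phi> x \<noteq> 0}" for x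
    using that closure_subset[of "{x. \<phi> x \<noteq> 0}"] by auto
qed (use assms grad_eq_0_off_support in \<open>auto simp: C1c_def\<close>)

lemma C1c_mono: "\<phi> \<in> C1c \<Omega> \<Longrightarrow> \<Omega> \<subseteq> \<Omega>' \<Longrightarrow> \<phi> \<in> C1c \<Omega>'"
  by (auto simp: C1c_def)

lemma C1c_imp_C1: "\<phi> \<in> C1c \<Omega> \<Longrightarrow> C1_on UNIV \<phi>"
  by (simp add: C1c_def)

lemma C1c_mult:
  assumes "\<phi> \<in> C1c \<Omega>" and "C1_on UNIV \<psi>"
  shows "(\<lambda>x. \<phi> x * \<psi> x) \<in> C1c \<Omega>"
proof -
  obtain K where "C1_on UNIV \<phi>" and K: "compact K" "K \<subseteq> \<Omega>" "\<And>x. x \<notin> K \<Longrightarrow> \<phi> x = 0"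
    using C1c_E[OF assms(1)] by metis
  then show ?thesis
    by (intro C1c_I[OF C1_on_mult[OF _ assms(2)] K(1,2)]) auto
qed

text \<open>\<open>W\<close> and the complement of \<open>K\<close> are open and cover the space. On
  the first the extension is f, on the second it is 0, so differentiability and continuity of the
  gradient can be glued.\<close>

lemma C1_on_extend_by_0:
  fixes f :: "'a::euclidean_space \<Rightarrow> real"
  assumes "open W" and "C1_on W f" and "compact K" and "K \<subseteq> W" and "\<And>x. x \<in> W - K \<Longrightarrow> f x = 0"
  shows "C1_on UNIV (\<lambda>x. if x \<in> W then f x else 0)"
    and "x \<in> W \<Longrightarrow> grad (\<lambda>x. if x \<in> W then f x else 0) x = grad f x"
proof -
  let ?f = "\<lambda>x. if x \<in> W then f x else 0"
  have W: "GDERIV ?f x :> grad f x" if "x \<in> W" for x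
    by (rule GDERIV_transform_open[OF C1_onD[OF assms(2) that] \<open>open W\<close> that]) simp
  have opK: "open (- K)"
    using assms(3) compact_imp_closed by auto
  have K: "GDERIV ?f x :> 0" if "x \<notin> K" for x
    by (rule GDERIV_transform_open[OF GDERIV_const opK]) (use that assms(5) in auto)
  show "x \<in> W \<Longrightarrow> grad ?f x = grad f x"
    by (rule grad_eqI[OF W])
  have "continuous_on W (grad ?f)"
    using assms(2) W grad_eqI by (subst continuous_on_cong[OF refl, where g = "grad f"]) (auto simp: C1_on_def)
  moreover have "continuous_on (- K) (grad ?f)"
    using K grad_eqI by (subst continuous_on_cong[OF refl, where g = "\<lambda>x. 0"]) auto
  ultimately have "continuous_on (W \<union> - K) (grad ?f)"
    by (rule continuous_on_open_Un[OF \<open>open W\<close> opK])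
  moreover have "W \<union> - K = UNIV"
    using assms(4) by auto
  ultimately have c: "continuous_on UNIV (grad ?f)"
    by simp
  have "GDERIV ?f x :> grad ?f x" for x
    using W[of x] K[of x] assms(4) by (metis grad_eqI subsetD)
  then show "C1_on UNIV ?f"
    by (rule C1_onI[OF _ c])
qed

section \<open>Integrability of functions with bounded support\<close>

lemma borel_measurable_lebesgue_continuous:
  fixes f :: "'a::euclidean_space \<Rightarrow> 'b::euclidean_space"
  shows "continuous_on UNIV f \<Longrightarrow> f \<in> borel_measurable lebesgue"
  by (simp add: borel_measurable_continuous_onI measurable_completion)

lemma integrable_lebesgue_bounded_support:
  fixes f :: "'a::euclidean_space \<Rightarrow> 'b::euclidean_space"
  assumes "f \<in> borel_measurable lebesgue" and "bounded S"
    and "\<And>x. x \<notin> S \<Longrightarrow> f x = 0" and "\<And>x. norm (f x) \<le> B"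
  shows "integrable lebesgue f"
proof -
  obtain c d where S: "S \<subseteq> cbox c d"
    using bounded_subset_cbox_symmetric[OF assms(2)] by blast
  have "integrable lebesgue (\<lambda>x. indicator (cbox c d) x * B)"
    using emeasure_lborel_cbox_finite[of c d]
    by (intro integrable_mult_left integrable_real_indicator) auto
  then show ?thesis
    by (rule Bochner_Integration.integrable_bound[OF _ assms(1)])
      (use S assms(3,4) in \<open>auto simp: indicator_def intro!: order_trans[OF _ abs_ge_self]\<close>)
qed

lemma continuous_bounded_support:
  fixes f :: "'a::euclidean_space \<Rightarrow> 'b::euclidean_space"
  assumes "continuous_on UNIV f" and "bounded S" and "\<And>x. x \<notin> S \<Longrightarrow> f x = 0"
  obtains B where "0 \<le> B" and "\<And>x. norm (f x) \<le> B"
proof -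
  have "compact (f ` closure S)"
    using assms(1,2) by (intro compact_continuous_image) (auto intro: continuous_on_subset)
  then obtain B where "\<And>x. x \<in> closure S \<Longrightarrow> norm (f x) \<le> B"
    using compact_imp_bounded by (fastforce simp: bounded_iff)
  then have "norm (f x) \<le> max 0 B" for x
    using assms(3)[of x] closure_subset[of S] by (cases "x \<in> S") (auto simp: le_max_iff_disj)
  then show ?thesis
    by (rule that[of "max 0 B", rotated]) simp
qed

lemma integrable_lebesgue_continuous_bounded_support:
  fixes f :: "'a::euclidean_space \<Rightarrow> 'b::euclidean_space"
  assumes "continuous_on UNIV f" and "bounded S" and "\<And>x. x \<notin> S \<Longrightarrow> f x = 0"
  shows "integrable lebesgue f"
  using continuous_bounded_support[OF assms]
    integrable_lebesgue_bounded_support[OF borel_measurable_lebesgue_continuous[OF assms(1)] assms(2,3)]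
  by metis

section \<open>Square integrable functions\<close>

lemma L2_on_UNIV: "L2_on UNIV f \<longleftrightarrow> f \<in> borel_measurable lebesgue \<and> integrable lebesgue (\<lambda>x. (norm (f x))\<^sup>2)"
  by (simp add: L2_on_def set_borel_measurable_def set_integrable_def)

text \<open>On the right the function lives on the whole space, where translations and homotheties
  act. The later estimates are made for such extensions by zero.\<close>

lemma L2_on_iff_extension: "L2_on \<Omega> f \<longleftrightarrow> L2_on UNIV (\<lambda>x. indicator \<Omega> x *\<^sub>R f x)"
proof -
  have "(\<lambda>x. (norm (indicator \<Omega> x *\<^sub>R f x))\<^sup>2) = (\<lambda>x. indicator \<Omega> x *\<^sub>R (norm (f x))\<^sup>2)"
    by (auto simp: indicator_def)
  then show ?thesis
    unfolding L2_on_UNIV by (simp add: L2_on_def set_borel_measurable_def set_integrable_def)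
qed

lemma L2_bounded_support:
  fixes f :: "'a::euclidean_space \<Rightarrow> 'b::euclidean_space"
  assumes "f \<in> borel_measurable lebesgue" and "bounded S"
    and "\<And>x. x \<notin> S \<Longrightarrow> f x = 0" and "\<And>x. norm (f x) \<le> B"
  shows "L2_on UNIV f"
  unfolding L2_on_UNIV
proof
  show "integrable lebesgue (\<lambda>x. (norm (f x))\<^sup>2)"
    by (rule integrable_lebesgue_bounded_support[OF _ assms(2), where B = "B\<^sup>2"])
      (use assms in \<open>auto intro!: power_mono borel_measurable_power borel_measurable_norm\<close>)
qed (rule assms(1))

lemma L2_C1c:
  assumes "\<phi> \<in> C1c UNIV"
  shows "L2_on UNIV \<phi>" and "L2_on UNIV (grad \<phi>)"
proof -
  obtain K where C1: "C1_on UNIV \<phi>" and K: "compact K"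
    and 0: "\<And>x. x \<notin> K \<Longrightarrow> \<phi> x = 0" "\<And>x. x \<notin> K \<Longrightarrow> grad \<phi> x = 0"
    using C1c_E[OF assms] by metis
  have c: "continuous_on UNIV \<phi>" "continuous_on UNIV (grad \<phi>)"
    using C1 C1_on_imp_continuous_on C1_on_def by blast+
  show "L2_on UNIV \<phi>"
    using continuous_bounded_support[OF c(1) compact_imp_bounded[OF K] 0(1)]
      L2_bounded_support[OF borel_measurable_lebesgue_continuous[OF c(1)] compact_imp_bounded[OF K] 0(1)]
    by metis
  show "L2_on UNIV (grad \<phi>)"
    using continuous_bounded_support[OF c(2) compact_imp_bounded[OF K] 0(2)]
      L2_bounded_support[OF borel_measurable_lebesgue_continuous[OF c(2)] compact_imp_bounded[OF K] 0(2)]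
    by metis
qed

lemma L2_on_UNIV_D:
  assumes "L2_on UNIV f"
  shows "f \<in> borel_measurable lebesgue" and "integrable lebesgue (\<lambda>x. (norm (f x))\<^sup>2)"
  using assms by (auto simp: L2_on_UNIV)

lemma norm_norm_le_sum_squares: "norm a * norm b \<le> (norm a)\<^sup>2 + (norm b)\<^sup>2"
  using sum_squares_bound[of "norm a" "norm b"] mult_nonneg_nonneg[OF norm_ge_zero[of a] norm_ge_zero[of b]]
  by linarith

lemma L2_scaleR_integrable:
  fixes f :: "'a::euclidean_space \<Rightarrow> real" and g :: "'a \<Rightarrow> 'b::euclidean_space"
  assumes "L2_on UNIV f" and "L2_on UNIV g"
  shows "integrable lebesgue (\<lambda>x. f x *\<^sub>R g x)"
proof -
  have "norm (f x *\<^sub>R g x) \<le> norm ((norm (f x))\<^sup>2 + (norm (g x))\<^sup>2)" for x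
    using norm_norm_le_sum_squares[of "f x" "g x"] by simp
  then show ?thesis
    by (intro Bochner_Integration.integrable_bound
      [OF Bochner_Integration.integrable_add[OF L2_on_UNIV_D(2)[OF assms(1)] L2_on_UNIV_D(2)[OF assms(2)]]]
       borel_measurable_scaleR assms[THEN L2_on_UNIV_D(1)] AE_I2)
qed

lemma L2_inner_integrable:
  fixes f g :: "'a::euclidean_space \<Rightarrow> 'b::euclidean_space"
  assumes "L2_on UNIV f" and "L2_on UNIV g"
  shows "integrable lebesgue (\<lambda>x. f x \<bullet> g x)"
proof -
  have "norm (f x \<bullet> g x) \<le> norm ((norm (f x))\<^sup>2 + (norm (g x))\<^sup>2)" for x
    using Cauchy_Schwarz_ineq2[of "f x" "g x"] norm_norm_le_sum_squares[of "f x" "g x"] by simp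
  then show ?thesis
    by (intro Bochner_Integration.integrable_bound
      [OF Bochner_Integration.integrable_add[OF L2_on_UNIV_D(2)[OF assms(1)] L2_on_UNIV_D(2)[OF assms(2)]]]
       borel_measurable_inner assms[THEN L2_on_UNIV_D(1)] AE_I2)
qed

lemma L2_mult_integrable:
  fixes f g :: "'a::euclidean_space \<Rightarrow> real"
  shows "L2_on UNIV f \<Longrightarrow> L2_on UNIV g \<Longrightarrow> integrable lebesgue (\<lambda>x. f x * g x)"
  using L2_inner_integrable[of f g] by simp

lemma L2_scaleR:
  fixes f :: "'a::euclidean_space \<Rightarrow> 'b::euclidean_space"
  shows "L2_on UNIV f \<Longrightarrow> L2_on UNIV (\<lambda>x. c *\<^sub>R f x)"
  by (auto simp: L2_on_UNIV power_mult_distrib)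

lemma L2_add:
  fixes f g :: "'a::euclidean_space \<Rightarrow> 'b::euclidean_space"
  assumes "L2_on UNIV f" and "L2_on UNIV g"
  shows "L2_on UNIV (\<lambda>x. f x + g x)"
proof -
  have "(norm (f x + g x))\<^sup>2 = (norm (f x))\<^sup>2 + 2 * (f x \<bullet> g x) + (norm (g x))\<^sup>2" for x
    by (simp add: power2_norm_eq_inner inner_add_left inner_add_right inner_commute)
  then show ?thesis
    using assms L2_inner_integrable[OF assms] by (auto simp: L2_on_UNIV)
qed

lemma L2_diff:
  fixes f g :: "'a::euclidean_space \<Rightarrow> 'b::euclidean_space"
  assumes "L2_on UNIV f" and "L2_on UNIV g"
  shows "L2_on UNIV (\<lambda>x. f x - g x)"
  using L2_add[OF assms(1) L2_scaleR[OF assms(2), of "-1"]] by simp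

lemma L2_Cauchy_Schwarz:
  fixes f g :: "'a::euclidean_space \<Rightarrow> 'b::euclidean_space"
  assumes "L2_on UNIV f" and "L2_on UNIV g"
  shows "(\<integral>x. f x \<bullet> g x \<partial>lebesgue)\<^sup>2 \<le> (\<integral>x. (norm (f x))\<^sup>2 \<partial>lebesgue) * (\<integral>x. (norm (g x))\<^sup>2 \<partial>lebesgue)"
    (is "?b\<^sup>2 \<le> ?a * ?c")
proof -
  have q: "0 \<le> s\<^sup>2 * ?a + 2 * s * t * ?b + t\<^sup>2 * ?c" for s t
  proof -
    have "0 \<le> (\<integral>x. (norm (s *\<^sub>R f x + t *\<^sub>R g x))\<^sup>2 \<partial>lebesgue)"
      by simp
    also have "\<dots> = (\<integral>x. s\<^sup>2 * (norm (f x))\<^sup>2 + 2 * s * t * (f x \<bullet> g x) + t\<^sup>2 * (norm (g x))\<^sup>2 \<partial>lebesgue)"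
      by (rule Bochner_Integration.integral_cong, rule refl)
        (simp only: power2_norm_eq_inner inner_add_left inner_add_right inner_scaleR_left inner_scaleR_right,
          simp add: inner_commute power2_eq_square algebra_simps)
    also have "\<dots> = s\<^sup>2 * ?a + 2 * s * t * ?b + t\<^sup>2 * ?c"
      using assms[THEN L2_on_UNIV_D(2)] L2_inner_integrable[OF assms] by simp
    finally show ?thesis .
  qed
  have a: "0 \<le> ?a" and c: "0 \<le> ?c"
    by auto
  show ?thesis
  proof (cases "?a = 0")
    case True
    have "?b = 0"
    proof (rule ccontr)
      assume "?b \<noteq> 0"
      \<comment> \<open>For a = 0 and t = 1 the form is 2 s b + c, and this choice of s gives it the
        value -1.\<close>
      then show False
        using q[of "- (?c + 1) / (2 * ?b)" 1] True c by (simp add: field_simps)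
    qed
    then show ?thesis
      by (simp add: a c)
  next
    case False
    then have "0 < ?a"
      using a by linarith
    \<comment> \<open>The form at s = -b, t = a.\<close>
    have "0 \<le> ?a * (?a * ?c - ?b\<^sup>2)"
      using q[of "- ?b" ?a] by (simp add: power2_eq_square algebra_simps)
    then show ?thesis
      using \<open>0 < ?a\<close> by (simp add: zero_le_mult_iff)
  qed
qed

lemma L2_tendsto_inner:
  fixes f h :: "'a::euclidean_space \<Rightarrow> 'b::euclidean_space"
  assumes "L2_on UNIV f" and "L2_on UNIV h" and "\<And>n. L2_on UNIV (h' n)"
    and lim: "(\<lambda>n. \<integral>x. (norm (h x - h' n x))\<^sup>2 \<partial>lebesgue) \<longlonglongrightarrow> 0"
  shows "(\<lambda>n. \<integral>x. f x \<bullet> h' n x \<partial>lebesgue) \<longlonglongrightarrow> (\<integral>x. f x \<bullet> h x \<partial>lebesgue)"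
proof -
  let ?F = "\<integral>x. (norm (f x))\<^sup>2 \<partial>lebesgue"
  have "(\<lambda>n. (\<integral>x. f x \<bullet> h x \<partial>lebesgue) - (\<integral>x. f x \<bullet> h' n x \<partial>lebesgue)) \<longlonglongrightarrow> 0"
  proof (rule Lim_null_comparison)
    show "(\<lambda>n. sqrt (?F * (\<integral>x. (norm (h x - h' n x))\<^sup>2 \<partial>lebesgue))) \<longlonglongrightarrow> 0"
      by (rule tendsto_eq_intros lim refl)+ simp
    have "(\<integral>x. f x \<bullet> h x \<partial>lebesgue) - (\<integral>x. f x \<bullet> h' n x \<partial>lebesgue) = (\<integral>x. f x \<bullet> (h x - h' n x) \<partial>lebesgue)" for n
      using L2_inner_integrable[OF assms(1,2)] L2_inner_integrable[OF assms(1,3)]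
      by (simp add: inner_diff_right)
    then show "\<forall>\<^sub>F n in sequentially. norm ((\<integral>x. f x \<bullet> h x \<partial>lebesgue) - (\<integral>x. f x \<bullet> h' n x \<partial>lebesgue))
        \<le> sqrt (?F * (\<integral>x. (norm (h x - h' n x))\<^sup>2 \<partial>lebesgue))"
      using L2_Cauchy_Schwarz[OF assms(1) L2_diff[OF assms(2,3)]]
      by (intro always_eventually) (simp add: real_le_rsqrt)
  qed
  from tendsto_diff[OF tendsto_const[of "\<integral>x. f x \<bullet> h x \<partial>lebesgue"] this] show ?thesis
    by simp
qed

section \<open>Integrals under homotheties\<close>

lemma lebesgue_homothety:
  fixes a :: "'a::euclidean_space"
  assumes "t > 0"
  defines "T \<equiv> (\<lambda>x. a + t *\<^sub>R (x - a))"
  shows "lebesgue = density (distr lebesgue lebesgue T) (\<lambda>_. ennreal (t ^ DIM('a)))"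
    and "T \<in> lebesgue \<rightarrow>\<^sub>M lebesgue"
proof -
  \<comment> \<open>The coordinatewise form, with the same factor t for every coordinate, in which
    the affine transformation rule for Lebesgue measure is stated.\<close>
  have T: "T x = (a - t *\<^sub>R a) + (\<Sum>j\<in>Basis. (t * (x \<bullet> j)) *\<^sub>R j)" for x
  proof -
    have "(\<Sum>j\<in>Basis. (t * (x \<bullet> j)) *\<^sub>R j) = t *\<^sub>R x"
      by (simp only: scaleR_scaleR[symmetric] scaleR_sum_right[symmetric] euclidean_representation)
    then show ?thesis
      by (simp add: T_def algebra_simps)
  qed
  show "lebesgue = density (distr lebesgue lebesgue T) (\<lambda>_. ennreal (t ^ DIM('a)))"
    using lebesgue_affine_euclidean[of "\<lambda>_. t" "a - t *\<^sub>R a"] assms(1) by (simp add: T[abs_def])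
  show "T \<in> lebesgue \<rightarrow>\<^sub>M lebesgue"
    using lebesgue_affine_measurable[of "\<lambda>_. t" "a - t *\<^sub>R a"] assms(1) by (simp add: T[abs_def])
qed

lemma
  fixes f :: "'a::euclidean_space \<Rightarrow> 'b::euclidean_space"
  assumes "t > 0" and f: "f \<in> borel_measurable lebesgue"
  shows borel_measurable_homothety: "(\<lambda>x. f (a + t *\<^sub>R (x - a))) \<in> borel_measurable lebesgue"
    and integrable_homothety_iff:
      "integrable lebesgue (\<lambda>x. f (a + t *\<^sub>R (x - a))) \<longleftrightarrow> integrable lebesgue f"
    and integral_homothety:
      "(\<integral>x. f (a + t *\<^sub>R (x - a)) \<partial>lebesgue) = (\<integral>x. f x \<partial>lebesgue) /\<^sub>R t ^ DIM('a)"
proof -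
  let ?T = "\<lambda>x. a + t *\<^sub>R (x - a)"
  note hom = lebesgue_homothety[OF assms(1), of a]
  have pos: "0 < t ^ DIM('a)"
    using assms(1) by simp
  show m: "(\<lambda>x. f (?T x)) \<in> borel_measurable lebesgue"
    using measurable_compose[OF hom(2) f] .
  have md: "f \<in> borel_measurable (distr lebesgue lebesgue ?T)"
    using f by simp
  have "integrable lebesgue f \<longleftrightarrow> integrable (density (distr lebesgue lebesgue ?T) (\<lambda>_. ennreal (t ^ DIM('a)))) f"
    using hom(1) by metis
  also have "\<dots> \<longleftrightarrow> integrable (distr lebesgue lebesgue ?T) (\<lambda>x. t ^ DIM('a) *\<^sub>R f x)"
    using pos md by (intro integrable_density) auto
  also have "\<dots> \<longleftrightarrow> integrable lebesgue (\<lambda>x. t ^ DIM('a) *\<^sub>R f (?T x))"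
    using hom(2) f by (intro integrable_distr_eq) auto
  also have "\<dots> \<longleftrightarrow> integrable lebesgue (\<lambda>x. f (?T x))"
  proof
    assume "integrable lebesgue (\<lambda>x. t ^ DIM('a) *\<^sub>R f (?T x))"
    then have "integrable lebesgue (\<lambda>x. inverse (t ^ DIM('a)) *\<^sub>R (t ^ DIM('a) *\<^sub>R f (?T x)))"
      by (rule integrable_scaleR_right)
    then show "integrable lebesgue (\<lambda>x. f (?T x))"
      using assms(1) by simp
  qed (rule integrable_scaleR_right)
  finally show "integrable lebesgue (\<lambda>x. f (?T x)) \<longleftrightarrow> integrable lebesgue f" ..
  have "(\<integral>x. f x \<partial>lebesgue) = (\<integral>x. f x \<partial>(density (distr lebesgue lebesgue ?T) (\<lambda>_. ennreal (t ^ DIM('a)))))"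
    using hom(1) by metis
  also have "\<dots> = (\<integral>x. t ^ DIM('a) *\<^sub>R f x \<partial>(distr lebesgue lebesgue ?T))"
    using pos md by (intro integral_density) auto
  also have "\<dots> = (\<integral>x. t ^ DIM('a) *\<^sub>R f (?T x) \<partial>lebesgue)"
    using hom(2) f by (intro integral_distr) auto
  finally show "(\<integral>x. f (?T x) \<partial>lebesgue) = (\<integral>x. f x \<partial>lebesgue) /\<^sub>R t ^ DIM('a)"
    using assms(1) by simp
qed

lemma
  fixes f :: "'a::euclidean_space \<Rightarrow> 'b::euclidean_space"
  assumes "t > 0" and "L2_on UNIV f"
  shows L2_homothety: "L2_on UNIV (\<lambda>x. f (a + t *\<^sub>R (x - a)))"
    and L2_norm_homothety: "(\<integral>x. (norm (f (a + t *\<^sub>R (x - a))))\<^sup>2 \<partial>lebesgue) = (\<integral>x. (norm (f x))\<^sup>2 \<partial>lebesgue) / t ^ DIM('a)"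
  using L2_on_UNIV_D[OF assms(2)] borel_measurable_homothety[OF assms(1), of f a]
    integrable_homothety_iff[OF assms(1), of "\<lambda>x. (norm (f x))\<^sup>2" a]
    integral_homothety[OF assms(1), of "\<lambda>x. (norm (f x))\<^sup>2" a]
  by (auto simp: L2_on_UNIV divide_inverse mult.commute)

section \<open>Integration by parts\<close>

lemma integral_translation:
  fixes f :: "'a::euclidean_space \<Rightarrow> 'b::euclidean_space"
  assumes "f \<in> borel_measurable borel"
  shows "(\<integral>x. f (x + v) \<partial>lebesgue) = (\<integral>x. f x \<partial>lebesgue)"
proof -
  have "(\<integral>x. f x \<partial>lebesgue) = (\<integral>x. f x \<partial>lborel)"
    using assms by (intro integral_completion) simp
  also have "\<dots> = (\<integral>x. f x \<partial>distr lborel borel ((+) v))"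
    by (simp add: lborel_distr_plus)
  also have "\<dots> = (\<integral>x. f (v + x) \<partial>lborel)"
    using assms by (intro integral_distr) auto
  also have "\<dots> = (\<integral>x. f (x + v) \<partial>lebesgue)"
    using assms by (subst integral_completion) (auto simp: add.commute)
  finally show ?thesis ..
qed

text \<open>By translation invariance every difference quotient of f in the direction e has integral
  0. The quotients converge to the directional derivative, dominated by means of the Lipschitz
  bound.\<close>

lemma integral_grad_eq_0:
  fixes f :: "'a::euclidean_space \<Rightarrow> real"
  assumes "f \<in> C1c UNIV"
  shows "(\<integral>x. grad f x \<bullet> e \<partial>lebesgue) = 0"
proof -
  obtain K where C1: "C1_on UNIV f" and K: "compact K"
    and 0: "\<And>x. x \<notin> K \<Longrightarrow> f x = 0" "\<And>x. x \<notin> K \<Longrightarrow> grad f x = 0"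
    using C1c_E[OF assms] by metis
  have cf: "continuous_on UNIV f" and cg: "continuous_on UNIV (grad f)"
    using C1 C1_on_imp_continuous_on C1_on_def by blast+
  obtain B where "0 \<le> B" and B: "\<And>x. norm (grad f x) \<le> B"
    using continuous_bounded_support[OF cg compact_imp_bounded[OF K] 0(2)] by metis
  have der: "(f has_derivative (\<lambda>h. h \<bullet> grad f x)) (at x)" for x
    using C1_onD[OF C1] by (simp add: gderiv_def)
  have lip: "\<bar>f y - f x\<bar> \<le> B * norm (y - x)" for x y
  proof -
    have "onorm (\<lambda>h. h \<bullet> grad f x) \<le> B" for x
    proof (rule onorm_bound[OF \<open>0 \<le> B\<close>])
      show "norm (h \<bullet> grad f x) \<le> B * norm h" for h
        using Cauchy_Schwarz_ineq2[of h "grad f x"] mult_right_mono[OF B[of x] norm_ge_zero[of h]]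
        by (simp add: mult.commute)
    qed
    then have "norm (f y - f x) \<le> B * norm (y - x)"
      by (intro differentiable_bound[OF convex_UNIV, where f' = "\<lambda>x h. h \<bullet> grad f x"])
        (auto intro: has_derivative_at_withinI der)
    then show ?thesis
      by simp
  qed
  obtain R where R: "\<And>x. x \<in> K \<Longrightarrow> norm x \<le> R"
    using compact_imp_bounded[OF K] bounded_iff by metis
  define h where "h n = inverse (real (Suc n))" for n
  have h0: "0 < h n" "h n \<le> 1" for n
    by (auto simp: h_def inverse_le_1_iff)
  have hlim: "h \<longlonglongrightarrow> 0"
    unfolding h_def by (rule LIMSEQ_inverse_real_of_nat)
  let ?q = "\<lambda>n x. (f (x + h n *\<^sub>R e) - f x) / h n"
  have "(\<lambda>n. \<integral>x. ?q n x \<partial>lebesgue) \<longlonglongrightarrow> (\<integral>x. grad f x \<bullet> e \<partial>lebesgue)"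
  \<comment> \<open>The quotient vanishes unless x or x + h e lies in \<open>K\<close>. As h \<le>
    1, either case forces norm x \<le> R + norm e.\<close>
  proof (rule integral_dominated_convergence[where w = "\<lambda>x. indicator (cball 0 (R + norm e)) x * (B * norm e)"])
    show "(\<lambda>x. grad f x \<bullet> e) \<in> borel_measurable lebesgue"
      by (intro borel_measurable_lebesgue_continuous continuous_intros cg)
    show "(\<lambda>x. ?q n x) \<in> borel_measurable lebesgue" for n
      using h0(1)[of n]
      by (intro borel_measurable_lebesgue_continuous continuous_intros continuous_on_compose2[OF cf] cf) auto
    show "integrable lebesgue (\<lambda>x. indicator (cball (0::'a) (R + norm e)) x * (B * norm e))"
      using emeasure_bounded_finite[OF bounded_cball, of "0::'a" "R + norm e"]
      by (intro integrable_mult_left integrable_real_indicator) auto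
    show "AE x in lebesgue. (\<lambda>n. ?q n x) \<longlonglongrightarrow> grad f x \<bullet> e"
    proof (rule AE_I2)
      fix x
      have "((\<lambda>t. f (x + t *\<^sub>R e)) has_derivative (\<lambda>t. (t *\<^sub>R e) \<bullet> grad f x)) (at 0)"
      proof (rule has_derivative_compose[where f = "\<lambda>t. x + t *\<^sub>R e" and g = f and g' = "\<lambda>h. h \<bullet> grad f x"])
        show "(f has_derivative (\<lambda>h. h \<bullet> grad f x)) (at (x + 0 *\<^sub>R e))"
          using der by simp
      qed (auto intro!: derivative_eq_intros)
      then have "DERIV (\<lambda>t. f (x + t *\<^sub>R e)) 0 :> grad f x \<bullet> e"
        by (simp add: has_field_derivative_def inner_commute mult_commute_abs)
      then have "((\<lambda>t. (f (x + t *\<^sub>R e) - f x) / t) \<longlongrightarrow> grad f x \<bullet> e) (at 0)"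
        by (simp add: DERIV_def)
      moreover have "filterlim h (at 0) sequentially"
        using hlim h0(1) by (simp add: filterlim_at less_imp_neq[symmetric])
      ultimately show "(\<lambda>n. ?q n x) \<longlonglongrightarrow> grad f x \<bullet> e"
        by (rule filterlim_compose)
    qed
    show "AE x in lebesgue. norm (?q n x) \<le> indicator (cball 0 (R + norm e)) x * (B * norm e)" for n
    proof (rule AE_I2)
      fix x
      show "norm (?q n x) \<le> indicator (cball 0 (R + norm e)) x * (B * norm e)"
      proof (cases "x \<in> cball 0 (R + norm e)")
        case True
        then show ?thesis
          using lip[of "x + h n *\<^sub>R e" x] h0[of n] by (simp add: field_simps)
      next
        case False
        have "norm x \<le> norm (x + h n *\<^sub>R e) + norm (h n *\<^sub>R e)"
          using norm_triangle_ineq4[of "x + h n *\<^sub>R e" "h n *\<^sub>R e"] by simp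
        moreover have "norm (h n *\<^sub>R e) \<le> norm e"
          using h0[of n] by (simp add: mult_left_le_one_le)
        ultimately have "x + h n *\<^sub>R e \<notin> K" and "x \<notin> K"
          using False R[of x] R[of "x + h n *\<^sub>R e"] norm_ge_zero[of e] by auto
        then show ?thesis
          using 0 False by simp
      qed
    qed
  qed
  moreover have "(\<integral>x. ?q n x \<partial>lebesgue) = 0" for n
  proof -
    have i: "integrable lebesgue f"
      using integrable_lebesgue_continuous_bounded_support[OF cf compact_imp_bounded[OF K] 0(1)] .
    have "integrable lebesgue (\<lambda>x. f (x + h n *\<^sub>R e))"
    proof (rule integrable_lebesgue_continuous_bounded_support)
      show "bounded ((\<lambda>x. x - h n *\<^sub>R e) ` K)"
        using K by (intro compact_imp_bounded compact_continuous_image continuous_intros)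
      show "f (x + h n *\<^sub>R e) = 0" if "x \<notin> (\<lambda>x. x - h n *\<^sub>R e) ` K" for x
        using that by (intro 0) (auto simp: image_iff algebra_simps)
    qed (auto intro!: continuous_intros continuous_on_compose2[OF cf])
    then show ?thesis
      using i integral_translation[of f "h n *\<^sub>R e"] borel_measurable_continuous_onI[OF cf] by simp
  qed
  ultimately show ?thesis
    by (simp only: LIMSEQ_const_iff)
qed

text \<open>f vanishes off a compact subset of \<open>W\<close>, so the product f g, extended by
  zero, is a test function on the whole space and its gradient integrates to zero. Allowing g to be
  C1 on \<open>W\<close> alone covers cut-offs made from local defining functions.\<close>

lemma integral_grad_by_parts:
  fixes f g :: "'a::euclidean_space \<Rightarrow> real"
  assumes "open W" and f: "f \<in> C1c W" and g: "C1_on W g"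
  shows "integrable lebesgue (\<lambda>x. indicator W x *\<^sub>R f x *\<^sub>R grad g x)"
    and "integrable lebesgue (\<lambda>x. indicator W x *\<^sub>R g x *\<^sub>R grad f x)"
    and "(LINT x:W|lebesgue. f x *\<^sub>R grad g x) = - (LINT x:W|lebesgue. g x *\<^sub>R grad f x)"
proof -
  obtain K where C1: "C1_on UNIV f" and K: "compact K" "K \<subseteq> W"
    and 0: "\<And>x. x \<notin> K \<Longrightarrow> f x = 0" "\<And>x. x \<notin> K \<Longrightarrow> grad f x = 0"
    using C1c_E[OF f] by metis
  have C1W: "C1_on W f"
    by (rule C1_on_subset[OF C1 subset_UNIV])
  have ext: "continuous_on UNIV (\<lambda>x. indicator W x *\<^sub>R h x)"
    if "continuous_on W h" and "\<And>x. x \<notin> K \<Longrightarrow> h x = 0" for h :: "'a \<Rightarrow> 'a"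
  proof -
    have "continuous_on W (\<lambda>x. indicator W x *\<^sub>R h x)"
      using that(1) by (subst continuous_on_cong[OF refl, where g = h]) auto
    moreover have "continuous_on (- K) (\<lambda>x. indicator W x *\<^sub>R h x)"
      using that(2) by (subst continuous_on_cong[OF refl, where g = "\<lambda>x. 0"]) auto
    ultimately have "continuous_on (W \<union> - K) (\<lambda>x. indicator W x *\<^sub>R h x)"
      using K(1) \<open>open W\<close> by (intro continuous_on_open_Un) (auto simp: open_Compl compact_imp_closed)
    moreover have "W \<union> - K = UNIV"
      using K(2) by auto
    ultimately show ?thesis
      by simp
  qed
  have c: "continuous_on W (\<lambda>x. f x *\<^sub>R grad g x)" "continuous_on W (\<lambda>x. g x *\<^sub>R grad f x)"
    using C1W g by (auto intro!: continuous_on_scaleR C1_on_imp_continuous_on simp: C1_on_def)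
  show i: "integrable lebesgue (\<lambda>x. indicator W x *\<^sub>R f x *\<^sub>R grad g x)"
      "integrable lebesgue (\<lambda>x. indicator W x *\<^sub>R g x *\<^sub>R grad f x)"
    by (rule integrable_lebesgue_continuous_bounded_support[OF ext[OF c(1)] compact_imp_bounded[OF K(1)]]
        integrable_lebesgue_continuous_bounded_support[OF ext[OF c(2)] compact_imp_bounded[OF K(1)]]; simp add: 0)+
  let ?h = "\<lambda>x. if x \<in> W then f x * g x else 0"
  note h = C1_on_extend_by_0[OF \<open>open W\<close> C1_on_mult[OF C1W g] K]
  have "?h \<in> C1c UNIV"
    using 0 by (intro C1c_I[OF h(1) K(1)]) auto
  have grad_h: "grad ?h x = indicator W x *\<^sub>R f x *\<^sub>R grad g x + indicator W x *\<^sub>R g x *\<^sub>R grad f x" for x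
  proof (cases "x \<in> W")
    case True
    have "grad ?h x = grad (\<lambda>x. f x * g x) x"
      using 0 by (intro h(2) True) auto
    also have "\<dots> = f x *\<^sub>R grad g x + g x *\<^sub>R grad f x"
      by (rule grad_mult[OF C1W g True])
    finally show ?thesis
      using True by simp
  next
    case False
    have "closure {x. ?h x \<noteq> 0} \<subseteq> K"
      using 0 by (intro closure_minimal compact_imp_closed K(1)) auto
    then have "x \<notin> closure {x. ?h x \<noteq> 0}"
      using K(2) False by blast
    then show ?thesis
      using grad_eq_0_off_support[of x ?h] False by simp
  qed
  let ?f = "LINT x:W|lebesgue. f x *\<^sub>R grad g x" and ?g = "LINT x:W|lebesgue. g x *\<^sub>R grad f x"
  have "(?f + ?g) \<bullet> e = 0" for e
  proof -
    have "?f + ?g = (\<integral>x. grad ?h x \<partial>lebesgue)"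
      unfolding grad_h set_lebesgue_integral_def using i by simp
    also have "\<dots> \<bullet> e = (\<integral>x. grad ?h x \<bullet> e \<partial>lebesgue)"
      unfolding grad_h using i by (intro integral_inner_left[symmetric]) auto
    also have "\<dots> = 0"
      by (rule integral_grad_eq_0[OF \<open>?h \<in> C1c UNIV\<close>])
    finally show ?thesis .
  qed
  \<comment> \<open>Taking e to be the vector itself makes its norm vanish.\<close>
  from this[of "?f + ?g"] show "?f = - ?g"
    by (simp only: eq_neg_iff_add_eq_0 inner_eq_zero_iff)
qed

section \<open>The fundamental lemma of the calculus of variations\<close>

text \<open>On {h \<ge> 0} and on {h \<le> 0} the integrand has one sign, so a zero integral makes
  it vanish almost everywhere; the two sets cover the space.\<close>

lemma AE_eq_0_if_borel_integrals_0:
  fixes h :: "'a::euclidean_space \<Rightarrow> real"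
  assumes h: "integrable lborel h" and int: "\<And>A. A \<in> sets borel \<Longrightarrow> (\<integral>x. indicator A x * h x \<partial>lborel) = 0"
  shows "AE x in lborel. h x = 0"
proof -
  have [measurable]: "h \<in> borel_measurable borel"
    using borel_measurable_integrable[OF h] by simp
  have "AE x in lborel. indicator A x * h x = 0"
    if A: "A \<in> sets borel" and sgn: "(\<forall>x. 0 \<le> indicator A x * h x) \<or> (\<forall>x. 0 \<le> indicator A x * - h x)" for A
  proof -
    have "integrable lborel (\<lambda>x. indicator A x * h x)"
      using integrable_mult_indicator[OF _ h, of A] A by simp
    moreover from this have "integrable lborel (\<lambda>x. indicator A x * - h x)"
      by simp
    ultimately show ?thesis
      using sgn
      using integral_nonneg_eq_0_iff_AE[of lborel "\<lambda>x. indicator A x * h x"]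
        integral_nonneg_eq_0_iff_AE[of lborel "\<lambda>x. indicator A x * - h x"] int[OF A]
      by auto
  qed
  from this[of "{x. 0 \<le> h x}"] this[of "{x. h x \<le> 0}"]
  have "AE x in lborel. indicator {x. 0 \<le> h x} x * h x = 0" "AE x in lborel. indicator {x. h x \<le> 0} x * h x = 0"
    by (auto simp: indicator_def)
  then show ?thesis
    by eventually_elim (auto simp: indicator_def split: if_splits)
qed

text \<open>With c = n these functions stay in [0, 1), vanish where f does and increase to 1
  elsewhere: bounded C1 approximations of the indicator of {f \<noteq> 0}.\<close>

lemma C1_on_sq_saturation:
  assumes "C1_on UNIV f" and "0 \<le> c"
  shows "C1_on UNIV (\<lambda>x. 1 - inverse (1 + c * (f x)\<^sup>2))"
proof (rule C1_on_diff[OF C1_on_const C1_on_compose[OF assms(1)]])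
  have ne: "1 + c * t\<^sup>2 \<noteq> 0" for t :: real
    using assms(2) by (metis add_pos_nonneg less_irrefl mult_nonneg_nonneg zero_le_power2 zero_less_one)
  show "DERIV (\<lambda>t. inverse (1 + c * t\<^sup>2)) t :> - (inverse (1 + c * t\<^sup>2) * (c * (2 * t)) * inverse (1 + c * t\<^sup>2))" for t
    by (rule DERIV_inverse'[where f = "\<lambda>t. 1 + c * t\<^sup>2", OF _ ne]) (auto intro!: derivative_eq_intros)
  show "continuous_on UNIV (\<lambda>t. - (inverse (1 + c * t\<^sup>2) * (c * (2 * t)) * inverse (1 + c * t\<^sup>2)))"
    using ne by (intro continuous_intros) auto
qed

text \<open>The indicators of the sets \<open>{x. \<psi> x \<noteq> 0}\<close> are limits of bounded C1 functions. These sets are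
  closed under intersection and include all half spaces, so Dynkin's lemma applies.\<close>

lemma AE_eq_0_if_C1_integrals_0:
  fixes h :: "'a::euclidean_space \<Rightarrow> real"
  assumes h: "integrable lborel h"
    and int: "\<And>\<psi>. C1_on UNIV \<psi> \<Longrightarrow> (\<And>x. \<bar>\<psi> x\<bar> \<le> 1) \<Longrightarrow> (\<integral>x. \<psi> x * h x \<partial>lborel) = 0"
  shows "AE x in lborel. h x = 0"
proof (rule AE_eq_0_if_borel_integrals_0[OF h])
  have hm [measurable]: "h \<in> borel_measurable borel"
    using borel_measurable_integrable[OF h] by simp
  have ih: "integrable lborel (\<lambda>x. indicator A x * h x)" if "A \<in> sets borel" for A
    using integrable_mult_indicator[OF _ h, of A] that by simp
  define \<G> where "\<G> = {{x. \<psi> x \<noteq> 0} | \<psi>. C1_on (UNIV :: 'a set) \<psi>}"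
  have open\<G>: "A \<in> sets borel" if "A \<in> \<G>" for A
    using that unfolding \<G>_def
    by (auto intro!: borel_open open_Collect_neq C1_on_imp_continuous_on continuous_on_const)
  have Int: "Int_stable \<G>"
  proof (rule Int_stableI)
    fix A B assume "A \<in> \<G>" "B \<in> \<G>"
    then obtain \<phi> \<psi> where "C1_on UNIV \<phi>" "C1_on UNIV \<psi>" "A = {x. \<phi> x \<noteq> 0}" "B = {x. \<psi> x \<noteq> 0}"
      unfolding \<G>_def by blast
    then have "C1_on UNIV (\<lambda>x. \<phi> x * \<psi> x)" and "A \<inter> B = {x. \<phi> x * \<psi> x \<noteq> 0}"
      by (auto intro: C1_on_mult)
    then show "A \<inter> B \<in> \<G>"
      unfolding \<G>_def by (intro CollectI exI conjI)
  qed
  have pow: "\<G> \<subseteq> Pow UNIV"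
    by simp
  have integral_\<G>: "(\<integral>x. indicator A x * h x \<partial>lborel) = 0" if A\<G>: "A \<in> \<G>" for A
  proof -
    obtain \<psi> where \<psi>: "C1_on UNIV \<psi>" and A: "A = {x. \<psi> x \<noteq> 0}"
      using A\<G> by (auto simp: \<G>_def)
    let ?\<psi> = "\<lambda>n x. 1 - inverse (1 + real n * (\<psi> x)\<^sup>2)"
    have c: "C1_on UNIV (?\<psi> n)" for n
      by (rule C1_on_sq_saturation[OF \<psi>]) simp
    have le: "\<bar>?\<psi> n x\<bar> \<le> 1" for n x
    proof -
      have "1 \<le> 1 + real n * (\<psi> x)\<^sup>2"
        by simp
      then have "inverse (1 + real n * (\<psi> x)\<^sup>2) \<le> 1" "0 < inverse (1 + real n * (\<psi> x)\<^sup>2)"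
        by (auto simp only: inverse_le_1_iff inverse_positive_iff_positive)
      then show ?thesis
        by linarith
    qed
    have [measurable]: "?\<psi> n \<in> borel_measurable borel" for n
      by (intro borel_measurable_continuous_onI C1_on_imp_continuous_on c)
    have [measurable]: "A \<in> sets borel"
      by (rule open\<G>[OF A\<G>])
    have "(\<lambda>n. \<integral>x. ?\<psi> n x * h x \<partial>lborel) \<longlonglongrightarrow> (\<integral>x. indicator A x * h x \<partial>lborel)"
    proof (rule integral_dominated_convergence[where w = "\<lambda>x. \<bar>h x\<bar>"])
      show "AE x in lborel. (\<lambda>n. ?\<psi> n x * h x) \<longlonglongrightarrow> indicator A x * h x"
      proof (intro AE_I2 tendsto_mult_right)
        fix x
        show "(\<lambda>n. ?\<psi> n x) \<longlonglongrightarrow> indicator A x"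
        proof (cases "\<psi> x = 0")
          case False
          then have "0 < (\<psi> x)\<^sup>2"
            by simp
          then have "(\<lambda>n. 1 - inverse (1 + real n * (\<psi> x)\<^sup>2)) \<longlonglongrightarrow> 1 - 0"
            by (intro tendsto_diff tendsto_const tendsto_inverse_0_at_top
                filterlim_tendsto_add_at_top[OF tendsto_const] filterlim_at_top_mult_tendsto_pos[OF tendsto_const]
                filterlim_real_sequentially)
          then show ?thesis
            using False by (simp add: A)
        next
          case True
          then show ?thesis
            by (simp add: A)
        qed
      qed
      show "AE x in lborel. norm (?\<psi> n x * h x) \<le> \<bar>h x\<bar>" for n
      proof (rule AE_I2)
        show "norm (?\<psi> n x * h x) \<le> \<bar>h x\<bar>" for x
          using mult_right_mono[OF le[of n x] abs_ge_zero[of "h x"]] by (simp only: real_norm_def abs_mult mult_1_left)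
      qed
    qed (use h in auto)
    moreover have "(\<integral>x. ?\<psi> n x * h x \<partial>lborel) = 0" for n
      by (rule int[OF c le])
    ultimately show ?thesis
      by (simp add: LIMSEQ_const_iff)
  qed
  have borel: "sets borel \<subseteq> sigma_sets UNIV \<G>"
  proof -
    have "{x. x \<bullet> i < c} \<in> \<G>" for i :: 'a and c
    proof -
      \<comment> \<open>The squared positive part of c - x . i is nonzero exactly on the half space.
        The term \<open>x - 0\<close> only matches the shape of
        \<open>C1_on_inner_left\<close>.\<close>
      have "C1_on UNIV (\<lambda>x::'a. pos_sq ((x - 0) \<bullet> (- i) + c))"
        by (intro C1_on_pos_sq C1_on_add C1_on_inner_left C1_on_const)
      moreover have "{x. x \<bullet> i < c} = {x. pos_sq ((x - 0) \<bullet> (- i) + c) \<noteq> 0}"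
        by (auto simp: pos_sq_eq_0_iff)
      ultimately show ?thesis
        unfolding \<G>_def by (intro CollectI exI conjI)
    qed
    then have "(\<lambda>(a, i). {x::'a. x \<bullet> i < a}) ` (UNIV \<times> Basis) \<subseteq> \<G>"
      by auto
    then show ?thesis
      by (subst borel_eq_halfspace_less) (auto simp: sets_measure_of dest: sigma_sets_mono')
  qed
  fix A :: "'a set" assume "A \<in> sets borel"
  then have "A \<in> sigma_sets UNIV \<G>"
    using borel by blast
  then show "(\<integral>x. indicator A x * h x \<partial>lborel) = 0"
  proof (induction rule: sigma_sets_induct_disjoint[OF Int pow, consumes 1, case_names basic empty compl union])
    case (basic A)
    then show ?case by (rule integral_\<G>)
  next
    case empty
    show ?case by simp
  next
    case (compl A)
    have "A \<in> sets borel"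
      using compl(1) open\<G> sets.sigma_sets_subset[of \<G> borel] by auto
    note iA = ih[OF this]
    have "(\<integral>x. indicator (UNIV - A) x * h x \<partial>lborel) = (\<integral>x. h x - indicator A x * h x \<partial>lborel)"
      by (intro Bochner_Integration.integral_cong) (auto simp: indicator_def)
    also have "\<dots> = (\<integral>x. h x \<partial>lborel)"
      using compl(2) iA h by simp
    \<comment> \<open>The constant 1 is an admissible test function, since the hypothesis asks for
      boundedness and not for compact support.\<close>
    also have "\<dots> = 0"
      using int[OF C1_on_const[of UNIV 1]] by simp
    finally show ?case .
  next
    case (union A)
    have mA: "A i \<in> sets borel" for i
      using union(2) open\<G> sets.sigma_sets_subset[of \<G> borel] by auto
    have "(LINT x:(\<Union>i. A i)|lborel. h x) = (\<Sum>i. LINT x:A i|lborel. h x)"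
      using mA union(1) h
      by (intro lebesgue_integral_countable_add)
        (auto simp: set_integrable_def disjoint_family_on_def intro!: ih)
    then show ?case
      using union(3) by (simp add: set_lebesgue_integral_def)
  qed
qed

text \<open>Using the squared norm keeps the bump C1 at the centre as well. It is nonzero exactly on
  the open ball.\<close>

lemma C1c_ball_bump:
  fixes x :: "'a::euclidean_space"
  assumes "0 < r" and "cball x r \<subseteq> \<Omega>"
  shows "(\<lambda>y. pos_sq (r\<^sup>2 - (norm (y - x))\<^sup>2)) \<in> C1c \<Omega>"
proof (rule C1c_I[OF _ compact_cball assms(2)])
  show "pos_sq (r\<^sup>2 - (norm (y - x))\<^sup>2) = 0" if "y \<notin> cball x r" for y
  proof -
    have "r\<^sup>2 \<le> (norm (y - x))\<^sup>2"
      using that assms(1) by (intro power_mono) (auto simp: dist_norm norm_minus_commute)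
    then show ?thesis
      by (simp add: pos_sq_eq_0_iff)
  qed
qed (intro C1_on_pos_sq C1_on_diff C1_on_const C1_on_norm_sq)

text \<open>Localisation: for a test function \<phi> and any C1 function \<psi> the product \<phi>
  \<psi> is again a test function, so \<phi> h satisfies the global criterion and h vanishes where
  \<phi> does not. Bumps on countably many balls exhaust \<Omega>.\<close>

lemma AE_eq_0_if_C1c_integrals_0:
  fixes h :: "'a::euclidean_space \<Rightarrow> real"
  assumes "open \<Omega>" and m: "(\<lambda>x. indicator \<Omega> x * h x) \<in> borel_measurable lebesgue"
    and i: "\<And>\<phi>. \<phi> \<in> C1c \<Omega> \<Longrightarrow> integrable lebesgue (\<lambda>x. \<phi> x * h x)"
    and int: "\<And>\<phi>. \<phi> \<in> C1c \<Omega> \<Longrightarrow> (\<integral>x. \<phi> x * h x \<partial>lebesgue) = 0"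
  shows "AE x in lebesgue. x \<in> \<Omega> \<longrightarrow> h x = 0"
proof -
  have local: "AE x in lebesgue. \<phi> x \<noteq> 0 \<longrightarrow> h x = 0" if \<phi>: "\<phi> \<in> C1c \<Omega>" for \<phi>
  proof -
    let ?g = "\<lambda>x. \<phi> x * h x"
    have "?g \<in> borel_measurable lebesgue"
      by (rule borel_measurable_integrable[OF i[OF \<phi>]])
    \<comment> \<open>A Borel version is needed because the global criterion is stated for
      \<open>lborel\<close>.\<close>
    from completion_ex_borel_measurable_real[OF this]
    obtain g where g: "g \<in> borel_measurable lborel" and "AE x in lborel. ?g x = g x"
      by blast
    then have eq: "AE x in lebesgue. ?g x = g x"
      using AE_completion by blast
    have gl: "g \<in> borel_measurable lebesgue"
      by (rule measurable_completion[OF g])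
    have "AE x in lborel. g x = 0"
    proof (rule AE_eq_0_if_C1_integrals_0)
      have "integrable lebesgue g"
        using i[OF \<phi>] integrable_cong_AE[OF borel_measurable_integrable[OF i[OF \<phi>]] gl eq] by blast
      then show "integrable lborel g"
        using integrable_completion[OF g] by simp
      fix \<psi> :: "'a \<Rightarrow> real" assume \<psi>: "C1_on UNIV \<psi>"
      have \<psi>m: "\<psi> \<in> borel_measurable borel"
        by (intro borel_measurable_continuous_onI C1_on_imp_continuous_on \<psi>)
      have "(\<integral>x. \<psi> x * g x \<partial>lborel) = (\<integral>x. \<psi> x * g x \<partial>lebesgue)"
        using g \<psi>m by (intro integral_completion[symmetric]) auto
      also have "\<dots> = (\<integral>x. (\<phi> x * \<psi> x) * h x \<partial>lebesgue)"
      proof (rule integral_cong_AE)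
        show "(\<lambda>x. \<psi> x * g x) \<in> borel_measurable lebesgue"
          using \<psi>m by (intro borel_measurable_times gl measurable_completion) simp
        show "AE x in lebesgue. \<psi> x * g x = \<phi> x * \<psi> x * h x"
          using eq by eventually_elim (metis mult.assoc mult.commute)
      qed (rule borel_measurable_integrable[OF i[OF C1c_mult[OF \<phi> \<psi>]]])
      also have "\<dots> = 0"
        by (rule int[OF C1c_mult[OF \<phi> \<psi>]])
      finally show "(\<integral>x. \<psi> x * g x \<partial>lborel) = 0" .
    qed
    from AE_completion[OF this] eq show ?thesis
      by eventually_elim auto
  qed
  define \<F> where "\<F> = {ball x r |x r. 0 < r \<and> cball x r \<subseteq> \<Omega>}"
  have AE_ball: "AE x in lebesgue. x \<in> B \<longrightarrow> h x = 0" if B\<F>: "B \<in> \<F>" for B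
  proof -
    obtain x r where B: "B = ball x r" "0 < r" "cball x r \<subseteq> \<Omega>"
      using B\<F> by (auto simp: \<F>_def)
    have ne: "pos_sq (r\<^sup>2 - (norm (y - x))\<^sup>2) \<noteq> 0" if "y \<in> B" for y
    proof -
      have "(norm (y - x))\<^sup>2 < r\<^sup>2"
        using that B(1) by (intro power_strict_mono) (auto simp: dist_norm norm_minus_commute)
      then show ?thesis
        by (simp add: pos_sq_eq_0_iff)
    qed
    then show ?thesis
      using local[OF C1c_ball_bump[OF B(2,3)]] by eventually_elim (use ne in blast)
  qed
  obtain \<F>' where \<F>': "\<F>' \<subseteq> \<F>" "countable \<F>'" "\<Union>\<F>' = \<Union>\<F>"
    by (rule Lindelof[of \<F>]) (auto simp: \<F>_def)
  have "\<Omega> \<subseteq> \<Union>\<F>"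
  proof
    fix x assume "x \<in> \<Omega>"
    then obtain r where "0 < r" "cball x r \<subseteq> \<Omega>"
      using \<open>open \<Omega>\<close> open_contains_cball by blast
    then show "x \<in> \<Union>\<F>"
      unfolding \<F>_def using centre_in_ball by blast
  qed
  moreover have "AE x in lebesgue. \<forall>B\<in>\<F>'. x \<in> B \<longrightarrow> h x = 0"
    using \<F>' AE_ball by (intro AE_ball_countable') auto
  ultimately show ?thesis
    using \<F>'(3) by (auto elim!: eventually_mono)
qed

section \<open>Weak gradients\<close>

lemma C1c_indicator:
  assumes "\<phi> \<in> C1c \<Omega>"
  shows "indicator \<Omega> x *\<^sub>R \<phi> x = \<phi> x" and "indicator \<Omega> x *\<^sub>R grad \<phi> x = grad \<phi> x"
  by (rule C1c_E[OF assms], auto simp: indicator_def)+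

lemma L2_on_C1c:
  assumes "\<phi> \<in> C1c \<Omega>"
  shows "L2_on \<Omega> \<phi>" and "L2_on \<Omega> (grad \<phi>)"
  using L2_C1c[OF C1c_mono[OF assms subset_UNIV]]
  unfolding L2_on_iff_extension[of \<Omega>] C1c_indicator[OF assms] by simp_all

lemma set_integral_C1c:
  fixes f :: "'a::euclidean_space \<Rightarrow> 'b::euclidean_space"
  assumes "\<phi> \<in> C1c \<Omega>"
  shows "(LINT x:\<Omega>|lebesgue. \<phi> x *\<^sub>R f x) = (\<integral>x. \<phi> x *\<^sub>R (indicator \<Omega> x *\<^sub>R f x) \<partial>lebesgue)"
  unfolding set_lebesgue_integral_def by (rule Bochner_Integration.integral_cong) (auto simp: indicator_def)

text \<open>Each component of the difference of two weak gradients is orthogonal to all test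
  functions.\<close>

lemma weak_gradient_unique:
  fixes u :: "'a::euclidean_space \<Rightarrow> real"
  assumes "open \<Omega>" and L2: "L2_on \<Omega> G" "L2_on \<Omega> H"
    and wg: "is_weak_gradient \<Omega> u G" "is_weak_gradient \<Omega> u H"
  shows "AE x in lebesgue. x \<in> \<Omega> \<longrightarrow> G x = H x"
proof -
  note ext = L2[unfolded L2_on_iff_extension[of \<Omega>]]
  \<comment> \<open>The additional indicator puts the component on the whole space, where
    measurability and the L2 product rule are available.\<close>
  have "AE x in lebesgue. x \<in> \<Omega> \<longrightarrow> indicator \<Omega> x * ((G x - H x) \<bullet> b) = 0" for b
  proof (rule AE_eq_0_if_C1c_integrals_0[OF \<open>open \<Omega>\<close>])
    have "(\<lambda>x. (indicator \<Omega> x *\<^sub>R G x - indicator \<Omega> x *\<^sub>R H x) \<bullet> b) \<in> borel_measurable lebesgue"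
      using L2_on_UNIV_D(1)[OF L2_diff[OF ext]] by (intro borel_measurable_inner) auto
    then show "(\<lambda>x. indicator \<Omega> x * (indicator \<Omega> x * ((G x - H x) \<bullet> b))) \<in> borel_measurable lebesgue"
      by (rule measurable_cong[THEN iffD1, rotated]) (auto simp: indicator_def)
    fix \<phi> assume \<phi>: "\<phi> \<in> C1c \<Omega>"
    have eq: "\<phi> x * (indicator \<Omega> x * ((G x - H x) \<bullet> b))
        = (\<phi> x *\<^sub>R (indicator \<Omega> x *\<^sub>R G x - indicator \<Omega> x *\<^sub>R H x)) \<bullet> b" for x
      by (simp add: algebra_simps)
    note i = L2_scaleR_integrable[OF L2_C1c(1)[OF C1c_mono[OF \<phi> subset_UNIV]]]
    note iD = i[OF L2_diff[OF ext]]
    show "integrable lebesgue (\<lambda>x. \<phi> x * (indicator \<Omega> x * ((G x - H x) \<bullet> b)))"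
      unfolding eq using iD by (rule integrable_inner_left)
    have "(\<integral>x. \<phi> x *\<^sub>R (indicator \<Omega> x *\<^sub>R G x - indicator \<Omega> x *\<^sub>R H x) \<partial>lebesgue) = 0"
      using wg[unfolded is_weak_gradient_def, THEN bspec, OF \<phi>] i[OF ext(1)] i[OF ext(2)]
      by (simp add: set_integral_C1c[OF \<phi>] scaleR_diff_right)
    then show "(\<integral>x. \<phi> x * (indicator \<Omega> x * ((G x - H x) \<bullet> b)) \<partial>lebesgue) = 0"
      unfolding eq integral_inner_left[OF iD] by simp
  qed
  then have "AE x in lebesgue. \<forall>b\<in>Basis. x \<in> \<Omega> \<longrightarrow> indicator \<Omega> x * ((G x - H x) \<bullet> b) = 0"
    by (intro AE_ball_countable') (auto intro: countable_finite)
  then show ?thesis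
    by eventually_elim (auto simp: indicator_def inner_diff_left intro: euclidean_eqI)
qed

text \<open>By uniqueness the arbitrary choice in \<open>wgrad\<close> is harmless: every explicit
  candidate agrees with it almost everywhere.\<close>

lemma wgrad_AE_eq:
  assumes "open \<Omega>" and "L2_on \<Omega> G" and "is_weak_gradient \<Omega> u G"
  shows "AE x in lebesgue. x \<in> \<Omega> \<longrightarrow> wgrad \<Omega> u x = G x"
proof -
  have "L2_on \<Omega> (wgrad \<Omega> u) \<and> is_weak_gradient \<Omega> u (wgrad \<Omega> u)"
    unfolding wgrad_def by (rule someI[where x = G]) (use assms in blast)
  then show ?thesis
    using weak_gradient_unique[OF assms(1)] assms(2,3) by blast
qed

lemma H1_wgrad:
  assumes "u \<in> H1 \<Omega>"
  shows "L2_on \<Omega> (wgrad \<Omega> u)" and "is_weak_gradient \<Omega> u (wgrad \<Omega> u)"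
proof -
  have "\<exists>G. L2_on \<Omega> G \<and> is_weak_gradient \<Omega> u G"
    using assms by (auto simp: H1_def)
  then have "L2_on \<Omega> (wgrad \<Omega> u) \<and> is_weak_gradient \<Omega> u (wgrad \<Omega> u)"
    unfolding wgrad_def by (rule someI_ex)
  then show "L2_on \<Omega> (wgrad \<Omega> u)" and "is_weak_gradient \<Omega> u (wgrad \<Omega> u)"
    by auto
qed

lemma is_weak_gradient_grad:
  assumes "open \<Omega>" and "\<phi> \<in> C1c \<Omega>"
  shows "is_weak_gradient \<Omega> \<phi> (grad \<phi>)"
  unfolding is_weak_gradient_def
proof
  fix \<psi> assume "\<psi> \<in> C1c \<Omega>"
  then show "(LINT x:\<Omega>|lebesgue. \<phi> x *\<^sub>R grad \<psi> x) = - (LINT x:\<Omega>|lebesgue. \<psi> x *\<^sub>R grad \<phi> x)"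
    using integral_grad_by_parts(3)[OF assms(1,2)] C1c_imp_C1 C1_on_subset by blast
qed

lemma wgrad_C1c:
  assumes "open \<Omega>" and "\<phi> \<in> C1c \<Omega>"
  shows "AE x in lebesgue. x \<in> \<Omega> \<longrightarrow> wgrad \<Omega> \<phi> x = grad \<phi> x"
  by (rule wgrad_AE_eq[OF assms(1) L2_on_C1c(2)[OF assms(2)] is_weak_gradient_grad[OF assms]])

text \<open>The constant sequence approximates. Its distance is zero only after an almost everywhere
  argument, since \<open>wgrad\<close> may differ from the classical gradient on a null set.\<close>

lemma C1c_subset_H1_0:
  assumes "open \<Omega>" and "\<phi> \<in> C1c \<Omega>"
  shows "\<phi> \<in> H1_0 \<Omega>"
  unfolding H1_0_def
proof (intro CollectI conjI exI allI)
  show "\<phi> \<in> H1 \<Omega>"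
    unfolding H1_def using L2_on_C1c[OF assms(2)] is_weak_gradient_grad[OF assms] by blast
  have "(LINT x:\<Omega>|lebesgue. (norm (wgrad \<Omega> \<phi> x - grad \<phi> x))\<^sup>2) = 0"
    unfolding set_lebesgue_integral_def using wgrad_C1c[OF assms]
    by (intro integral_eq_zero_AE) (auto elim!: eventually_mono simp: indicator_def)
  then show "(\<lambda>n. (LINT x:\<Omega>|lebesgue. (\<phi> x - \<phi> x)\<^sup>2)
      + (LINT x:\<Omega>|lebesgue. (norm (wgrad \<Omega> \<phi> x - grad \<phi> x))\<^sup>2)) \<longlonglongrightarrow> 0"
    by (simp add: set_lebesgue_integral_def)
qed (rule assms(2))

lemma L2_on_scaleR:
  assumes "L2_on \<Omega> f"
  shows "L2_on \<Omega> (\<lambda>x. r *\<^sub>R f x)"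
proof -
  have "(\<lambda>x. indicator \<Omega> x *\<^sub>R r *\<^sub>R f x) = (\<lambda>x. r *\<^sub>R indicator \<Omega> x *\<^sub>R f x)"
    by (simp add: mult.commute)
  then show ?thesis
    using L2_scaleR[OF assms[unfolded L2_on_iff_extension[of \<Omega>]], of r]
    by (simp only: L2_on_iff_extension[of \<Omega>])
qed

lemma is_weak_gradient_scale:
  assumes "is_weak_gradient \<Omega> u G"
  shows "is_weak_gradient \<Omega> (\<lambda>x. r * u x) (\<lambda>x. r *\<^sub>R G x)"
proof -
  have "(LINT x:\<Omega>|lebesgue. (r * u x) *\<^sub>R grad \<psi> x) = r *\<^sub>R (LINT x:\<Omega>|lebesgue. u x *\<^sub>R grad \<psi> x)"
    "(LINT x:\<Omega>|lebesgue. \<psi> x *\<^sub>R r *\<^sub>R G x) = r *\<^sub>R (LINT x:\<Omega>|lebesgue. \<psi> x *\<^sub>R G x)" for \<psi>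
    unfolding set_lebesgue_integral_def integral_scaleR_right[symmetric]
    by (rule Bochner_Integration.integral_cong; simp add: ac_simps)+
  then show ?thesis
    using assms by (simp add: is_weak_gradient_def)
qed

lemma H1_scale: "u \<in> H1 \<Omega> \<Longrightarrow> (\<lambda>x. r * u x) \<in> H1 \<Omega>"
  using L2_on_scaleR[of \<Omega> u r] L2_on_scaleR is_weak_gradient_scale by (fastforce simp: H1_def)

text \<open>\<open>fibering\<close> takes the energy of r u, whose weak gradient is chosen afresh;
  this ties that choice to the one made for u.\<close>

lemma wgrad_scale:
  assumes "open \<Omega>" and "u \<in> H1 \<Omega>"
  shows "AE x in lebesgue. x \<in> \<Omega> \<longrightarrow> wgrad \<Omega> (\<lambda>x. r * u x) x = r *\<^sub>R wgrad \<Omega> u x"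
  by (intro wgrad_AE_eq assms L2_on_scaleR is_weak_gradient_scale H1_wgrad)

section \<open>The power nonlinearity\<close>

lemma powr_mult_self: "\<bar>s\<bar> powr (p - 1) * s * s = \<bar>s\<bar> powr (p + 1)" for s p :: real
proof (cases "s = 0")
  case False
  have "\<bar>s\<bar> powr (p + 1) = \<bar>s\<bar> powr (p - 1) * \<bar>s\<bar> powr 2"
    using powr_add[of "\<bar>s\<bar>" "p - 1" 2] by (simp add: add.commute)
  also have "\<bar>s\<bar> powr 2 = s * s"
    using False by (simp add: powr_numeral power2_eq_square)
  finally show ?thesis
    by simp
qed simp

lemma abs_powr_mult: "\<bar>\<bar>s\<bar> powr (p - 1) * s\<bar> = \<bar>s\<bar> powr p" for s p :: real
proof (cases "s = 0")
  case False
  have "\<bar>s\<bar> powr p = \<bar>s\<bar> powr (p - 1) * \<bar>s\<bar> powr 1"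
    using powr_add[of "\<bar>s\<bar>" "p - 1" 1] by simp
  then show ?thesis
    using False by (simp add: abs_mult)
qed simp

lemma powr_mult_eq_powr: "0 < s \<Longrightarrow> s powr (p - 1) * s = s powr p" for s p :: real
  using abs_powr_mult[of s p] by (simp add: abs_mult)

text \<open>Young's inequality for the conjugate exponents (p + 1)/p and p + 1. Equality holds for s
  = t, so nothing is lost at the unscaled function.\<close>

lemma powr_young:
  fixes s t p :: real
  assumes "0 < p"
  shows "\<bar>s\<bar> powr (p - 1) * s * t \<le> p / (p + 1) * \<bar>s\<bar> powr (p + 1) + 1 / (p + 1) * \<bar>t\<bar> powr (p + 1)"
proof -
  have "\<bar>s\<bar> powr (p - 1) * s * t \<le> \<bar>s\<bar> powr p * \<bar>t\<bar>"
    using abs_ge_self[of "\<bar>s\<bar> powr (p - 1) * s * t"] by (simp only: abs_mult[of _ t] abs_powr_mult)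
  also have "\<dots> \<le> (\<bar>s\<bar> powr p) powr ((p + 1) / p) / ((p + 1) / p) + \<bar>t\<bar> powr (p + 1) / (p + 1)"
    by (rule Youngs_inequality) (use assms in \<open>auto simp: field_simps\<close>)
  also have "\<dots> = p / (p + 1) * \<bar>s\<bar> powr (p + 1) + 1 / (p + 1) * \<bar>t\<bar> powr (p + 1)"
    using assms by (simp add: powr_powr)
  finally show ?thesis .
qed

text \<open>A number c/(a + b) in [0, 1] is at most its p-th power, as p \<le> 1; add this for c = a
  and c = b.\<close>

lemma powr_add_le:
  fixes a b p :: real
  assumes "0 \<le> a" "0 \<le> b" "0 < p" "p \<le> 1"
  shows "(a + b) powr p \<le> a powr p + b powr p"
proof (cases "a + b = 0")
  case False
  then have pos: "0 < a + b"
    using assms by linarith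
  have le: "c / (a + b) \<le> (c / (a + b)) powr p" if "0 \<le> c" "c \<le> a + b" for c
  proof (cases "c = 0")
    case False
    then show ?thesis
      using powr_mono'[of p 1 "c / (a + b)"] that assms pos by (simp add: divide_le_eq_1)
  qed simp
  have "1 = a / (a + b) + b / (a + b)"
    using pos by (simp flip: add_divide_distrib)
  also have "\<dots> \<le> (a / (a + b)) powr p + (b / (a + b)) powr p"
    using assms by (intro add_mono le) auto
  also have "\<dots> = (a powr p + b powr p) / (a + b) powr p"
    using assms pos by (simp add: powr_divide add_divide_distrib)
  finally show ?thesis
    using pos by (simp add: field_simps)
qed (use assms in auto)

text \<open>For equal signs this is subadditivity of the power. For opposite signs |s| and |t| are
  both at most |s - t|, which is where the factor 2 comes from.\<close>

lemma powr_mult_holder: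
  fixes s t p :: real
  assumes "0 < p" "p \<le> 1"
  shows "\<bar>\<bar>s\<bar> powr (p - 1) * s - \<bar>t\<bar> powr (p - 1) * t\<bar> \<le> 2 * \<bar>s - t\<bar> powr p"
proof -
  have mono: "x powr p - y powr p \<le> (x - y) powr p \<and> 0 \<le> x powr p - y powr p" if "0 \<le> y" "y \<le> x" for x y :: real
    using powr_add_le[of "x - y" y p] powr_mono2[of p y x] assms that by simp
  have same: "\<bar>x powr p - y powr p\<bar> \<le> 2 * \<bar>x - y\<bar> powr p" if "0 \<le> x" "0 \<le> y" for x y :: real
  proof (cases "y \<le> x")
    case True
    then show ?thesis
      using mono[of y x] that by (smt (verit, best))
  next
    case False
    then show ?thesis
      using mono[of x y] that by (smt (verit, best))
  qed
  have opp: "\<bar>x powr p + y powr p\<bar> \<le> 2 * \<bar>x + y\<bar> powr p" if "0 \<le> x" "0 \<le> y" for x y :: real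
    using powr_mono2[of p x "x + y"] powr_mono2[of p y "x + y"] assms that
    by (smt (verit, best) powr_ge_zero)
  have sp: "\<bar>x\<bar> powr (p - 1) * x = (if 0 \<le> x then x powr p else - ((- x) powr p))" for x :: real
    using powr_mult_eq_powr[of x p] powr_mult_eq_powr[of "- x" p] by (cases "x = 0") auto
  show ?thesis
    unfolding sp using same[of s t] same[of "- s" "- t"] opp[of s "- t"] opp[of "- s" t]
    by (smt (verit, best))
qed

text \<open>Young bounds f(s) t from above only. The lower bound comes from f(s) t = |s|^(p+1) +
  |t|^(p+1) - f(t) s - (f(t) - f(s)) (t - s): Young applies to f(t) s, and Hoelder continuity makes
  the last product at most 2 |t - s|^(p+1), which is of higher than first order.\<close>

lemma powr_convexity_gap:
  fixes s t p :: real
  assumes "0 < p" "p \<le> 1"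
  shows "\<bar>s\<bar> powr (p + 1) + 1 / (p + 1) * (\<bar>t\<bar> powr (p + 1) - \<bar>s\<bar> powr (p + 1)) - 2 * \<bar>t - s\<bar> powr (p + 1)
    \<le> \<bar>s\<bar> powr (p - 1) * s * t"
proof -
  let ?f = "\<lambda>s. \<bar>s\<bar> powr (p - 1) * s"
  have "(?f t - ?f s) * (t - s) \<le> \<bar>?f t - ?f s\<bar> * \<bar>t - s\<bar>"
    using abs_ge_self[of "(?f t - ?f s) * (t - s)"] by (simp only: abs_mult)
  also have "\<dots> \<le> (2 * \<bar>t - s\<bar> powr p) * \<bar>t - s\<bar>"
    by (intro mult_right_mono powr_mult_holder assms) auto
  also have "\<dots> = 2 * \<bar>t - s\<bar> powr (p + 1)"
    by (simp add: powr_add)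
  finally have 1: "(?f t - ?f s) * (t - s) \<le> 2 * \<bar>t - s\<bar> powr (p + 1)" .
  have 2: "?f t * s \<le> p / (p + 1) * \<bar>t\<bar> powr (p + 1) + 1 / (p + 1) * \<bar>s\<bar> powr (p + 1)"
    by (rule powr_young[OF assms(1)])
  have 3: "p / (p + 1) = 1 - 1 / (p + 1)"
    using assms by (simp add: field_simps)
  have 4: "(?f t - ?f s) * (t - s) = \<bar>t\<bar> powr (p + 1) + \<bar>s\<bar> powr (p + 1) - ?f t * s - ?f s * t"
    using powr_mult_self[of s p] powr_mult_self[of t p] by (simp add: algebra_simps)
  show ?thesis
    using 1 2 unfolding 4 unfolding 3 left_diff_distrib right_diff_distrib mult_1_left by linarith
qed

text \<open>|U|^p \<le> 1 + U^2 for p \<le> 2, and the bounded support makes the 1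
  integrable.\<close>

lemma integrable_powr:
  fixes U :: "'a::euclidean_space \<Rightarrow> real"
  assumes "L2_on UNIV U" and "bounded S" and "\<And>x. x \<notin> S \<Longrightarrow> U x = 0" and "0 < p" and "p \<le> 2"
  shows "integrable lebesgue (\<lambda>x. \<bar>U x\<bar> powr p)"
proof -
  obtain c d where S: "S \<subseteq> cbox c d"
    using bounded_subset_cbox_symmetric[OF assms(2)] by blast
  have "integrable lebesgue (\<lambda>x. indicator (cbox c d) x + (norm (U x))\<^sup>2)"
    using emeasure_lborel_cbox_finite[of c d] L2_on_UNIV_D[OF assms(1)]
    by (intro Bochner_Integration.integrable_add integrable_real_indicator) auto
  then show ?thesis
  proof (rule Bochner_Integration.integrable_bound)
    show "(\<lambda>x. \<bar>U x\<bar> powr p) \<in> borel_measurable lebesgue"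
      using L2_on_UNIV_D[OF assms(1)] by (intro powr_real_measurable borel_measurable_abs) auto
    show "AE x in lebesgue. norm (\<bar>U x\<bar> powr p) \<le> norm (indicator (cbox c d) x + (norm (U x))\<^sup>2)"
    proof (rule AE_I2)
      fix x
      have "\<bar>U x\<bar> powr p \<le> 1 + (U x)\<^sup>2"
      proof (cases "\<bar>U x\<bar> \<le> 1")
        case True
        then show ?thesis
          using powr_mono2[of p "\<bar>U x\<bar>" 1] assms(4) add_increasing2[of "(U x)\<^sup>2" "\<bar>U x\<bar> powr p" 1] by simp
      next
        case False
        then have "\<bar>U x\<bar> powr p \<le> \<bar>U x\<bar> powr 2"
          using assms(5) by (intro powr_mono) auto
        also have "\<dots> = (U x)\<^sup>2"
          using False by (simp add: powr_numeral)
        finally show ?thesis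
          by simp
      qed
      then show "norm (\<bar>U x\<bar> powr p) \<le> norm (indicator (cbox c d) x + (norm (U x))\<^sup>2)"
        using assms(3)[of x] S by (cases "x \<in> S") auto
    qed
  qed
qed

text \<open>The square is |U|^(2p) with 2p \<le> 2. Thus the nonlinear terms pair continuously with
  L2 convergent test functions.\<close>

lemma L2_powr_mult:
  fixes U :: "'a::euclidean_space \<Rightarrow> real"
  assumes "L2_on UNIV U" and "bounded S" and "\<And>x. x \<notin> S \<Longrightarrow> U x = 0" and "0 < p" and "p \<le> 1"
  shows "L2_on UNIV (\<lambda>x. \<bar>U x\<bar> powr (p - 1) * U x)"
  unfolding L2_on_UNIV
proof
  show "(\<lambda>x. \<bar>U x\<bar> powr (p - 1) * U x) \<in> borel_measurable lebesgue"
    using L2_on_UNIV_D[OF assms(1)] by (intro borel_measurable_times powr_real_measurable borel_measurable_abs) auto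
  have "(norm (\<bar>U x\<bar> powr (p - 1) * U x))\<^sup>2 = \<bar>U x\<bar> powr (2 * p)" for x
    using abs_powr_mult[of "U x" p] by (simp only: real_norm_def power2_eq_square) (simp flip: powr_add)
  then show "integrable lebesgue (\<lambda>x. (norm (\<bar>U x\<bar> powr (p - 1) * U x))\<^sup>2)"
    using integrable_powr[OF assms(1-3), of "2 * p"] assms(4,5) by simp
qed

section \<open>Square integrals of differences under homotheties\<close>

text \<open>In the constant, (2R)^2 bounds |x - a|^2 wherever some intermediate homothety maps x
  into \<Omega>, and 2^N bounds the Jacobian factor s^(-N) for s \<ge> 1/2.\<close>

lemma C1c_homothety_diff:
  fixes \<phi> :: "'a::euclidean_space \<Rightarrow> real"
  assumes \<phi>: "\<phi> \<in> C1c \<Omega>" and \<Omega>: "\<Omega> \<subseteq> cball a R" and t: "t \<in> {1/2..2}"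
  shows "(\<integral>x. (\<phi> (a + t *\<^sub>R (x - a)) - \<phi> x)\<^sup>2 \<partial>lebesgue)
    \<le> (t - 1)\<^sup>2 * ((2 * R)\<^sup>2 * 2 ^ DIM('a) * (\<integral>x. (norm (grad \<phi> x))\<^sup>2 \<partial>lebesgue))"
proof -
  obtain K where C1: "C1_on UNIV \<phi>" and K: "compact K" "K \<subseteq> \<Omega>"
    and 0: "\<And>x. x \<notin> K \<Longrightarrow> \<phi> x = 0" "\<And>x. x \<notin> K \<Longrightarrow> grad \<phi> x = 0"
    using C1c_E[OF \<phi>] by metis
  have c: "continuous_on UNIV \<phi>" "continuous_on UNIV (grad \<phi>)"
    using C1 C1_on_imp_continuous_on C1_on_def by blast+
  define T where "T s x = a + s *\<^sub>R (x - a)" for s :: real and x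
  \<comment> \<open>s |x - a| \<le> R, and s \<ge> 1/2.\<close>
  have supp: "norm (x - a) \<le> 2 * R" if "s \<in> {1/2..2}" "T s x \<in> K" for s x
  proof -
    have "dist a (T s x) \<le> R"
      using that(2) K(2) \<Omega> by auto
    then have "s * norm (x - a) \<le> R"
      using that(1) by (simp add: T_def dist_norm)
    moreover have "1/2 * norm (x - a) \<le> s * norm (x - a)"
      using that(1) by (intro mult_right_mono) auto
    ultimately show ?thesis
      by linarith
  qed
  obtain p q where pq: "cball a (2 * R) \<subseteq> cbox p q"
    using bounded_subset_cbox_symmetric[OF bounded_cball] by blast
  \<comment> \<open>Duality: the mean value theorem for \<open>s \<mapsto> \<integral>x. w x * \<phi> (T s x)\<close> bounds the square norm of \<open>w\<close>.\<close>
  define w where "w x = \<phi> (T t x) - \<phi> x" for x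
  have w0: "w x = 0" if "x \<notin> cball a (2 * R)" for x
  proof -
    have "x \<notin> K" and "T t x \<notin> K"
      using that supp[OF t, of x] supp[of 1 x] by (auto simp: T_def dist_norm norm_minus_commute)
    then show ?thesis
      by (simp add: w_def 0)
  qed
  have cw: "continuous_on UNIV w"
    unfolding w_def T_def by (intro continuous_intros continuous_on_compose2[OF c(1)] c(1)) auto
  have L2w: "L2_on UNIV w"
    unfolding w_def T_def using t C1c_mono[OF \<phi> subset_UNIV, THEN L2_C1c(1)]
    by (intro L2_diff L2_homothety) auto
  \<comment> \<open>A gauge integral over a box, because differentiation under the integral sign is
    available in that form; \<open>int_eq\<close> translates back to Lebesgue integrals.\<close>
  define m where "m s = integral (cbox p q) (\<lambda>x. w x * \<phi> (T s x))" for s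
  define m' where "m' s = integral (cbox p q) (\<lambda>x. w x * ((x - a) \<bullet> grad \<phi> (T s x)))" for s
  have der: "(m has_field_derivative m' s) (at s within {1/2..2})" if "s \<in> {1/2..2}" for s
    unfolding m_def m'_def
  proof (rule leibniz_rule_field_derivative)
    show "((\<lambda>s. w x * \<phi> (T s x)) has_field_derivative w x * ((x - a) \<bullet> grad \<phi> (T s x))) (at s within {1/2..2})" for s x
    proof (rule DERIV_cmult, rule has_field_derivative_at_within)
      have "((\<lambda>s. \<phi> (T s x)) has_derivative (\<lambda>h. (h *\<^sub>R (x - a)) \<bullet> grad \<phi> (T s x))) (at s)"
        by (rule has_derivative_compose[where f = "\<lambda>s. T s x" and g = \<phi> and g' = "\<lambda>h. h \<bullet> grad \<phi> (T s x)"])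
          (use C1_onD[OF C1] in \<open>auto simp: gderiv_def T_def intro!: derivative_eq_intros\<close>)
      then show "((\<lambda>s. \<phi> (T s x)) has_field_derivative (x - a) \<bullet> grad \<phi> (T s x)) (at s)"
        by (simp add: has_field_derivative_def mult_commute_abs)
    qed
    show "(\<lambda>x. w x * \<phi> (T s x)) integrable_on cbox p q" for s
      unfolding T_def
      by (intro integrable_continuous continuous_intros continuous_on_compose2[OF c(1)] continuous_on_subset[OF cw]) auto
    show "continuous_on ({1/2..2} \<times> cbox p q) (\<lambda>(s, x). w x * ((x - a) \<bullet> grad \<phi> (T s x)))"
      unfolding T_def case_prod_beta
      by (intro continuous_intros continuous_on_compose2[OF c(2)] continuous_on_compose2[OF cw]) auto
  qed (use that in auto)
  define W where "W = (\<integral>x. (w x)\<^sup>2 \<partial>lebesgue)"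
  define M where "M = (2 * R)\<^sup>2 * 2 ^ DIM('a) * (\<integral>x. (norm (grad \<phi> x))\<^sup>2 \<partial>lebesgue)"
  have int_eq: "integral (cbox p q) (\<lambda>x. w x * g x) = (\<integral>x. w x * g x \<partial>lebesgue)"
    if g: "continuous_on UNIV g" for g
  proof -
    have i: "integrable lebesgue (\<lambda>x. w x * g x)"
      using w0 by (intro integrable_lebesgue_continuous_bounded_support[OF _ bounded_cball] continuous_intros cw g) auto
    then have "set_integrable lebesgue (cbox p q) (\<lambda>x. w x * g x)"
      unfolding set_integrable_def by (intro integrable_mult_indicator) auto
    then have "integral (cbox p q) (\<lambda>x. w x * g x) = (LINT x:cbox p q|lebesgue. w x * g x)"
      by (rule set_lebesgue_integral_eq_integral(2)[symmetric])
    also have "\<dots> = (\<integral>x. w x * g x \<partial>lebesgue)"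
      unfolding set_lebesgue_integral_def using w0 pq
      by (intro Bochner_Integration.integral_cong) (auto simp: indicator_def simp del: mem_cball)
    finally show ?thesis .
  qed
  have bound: "\<bar>m' s\<bar> \<le> sqrt W * sqrt M" if s: "s \<in> {1/2..2}" for s
  proof -
    define g where "g x = (x - a) \<bullet> grad \<phi> (T s x)" for x
    have g: "continuous_on UNIV g"
      unfolding g_def T_def by (intro continuous_intros continuous_on_compose2[OF c(2)]) auto
    have gle: "(g x)\<^sup>2 \<le> (2 * R)\<^sup>2 * (norm (grad \<phi> (T s x)))\<^sup>2" for x
    proof (cases "T s x \<in> K")
      case True
      have "\<bar>g x\<bar> \<le> norm (x - a) * norm (grad \<phi> (T s x))"
        unfolding g_def by (rule Cauchy_Schwarz_ineq2)
      also have "\<dots> \<le> 2 * R * norm (grad \<phi> (T s x))"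
        by (intro mult_right_mono supp[OF s True]) auto
      finally have "\<bar>g x\<bar>\<^sup>2 \<le> (2 * R * norm (grad \<phi> (T s x)))\<^sup>2"
        by (intro power_mono) auto
      then show ?thesis
        by (simp add: power_mult_distrib)
    qed (simp add: g_def 0)
    have L2g: "L2_on UNIV g"
    proof -
      have g0: "g x = 0" if "x \<notin> cball a (2 * R)" for x
      proof -
        have "T s x \<notin> K"
          using that supp[OF s, of x] by (auto simp: dist_norm norm_minus_commute)
        then show ?thesis
          by (simp add: g_def 0)
      qed
      obtain B where "\<And>x. norm (g x) \<le> B"
        using continuous_bounded_support[OF g bounded_cball g0] by metis
      then show ?thesis
        by (intro L2_bounded_support[OF borel_measurable_lebesgue_continuous[OF g] bounded_cball g0])
    qed
    have L2grad: "L2_on UNIV (\<lambda>x. grad \<phi> (T s x))"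
      unfolding T_def using s C1c_mono[OF \<phi> subset_UNIV, THEN L2_C1c(2)] by (intro L2_homothety) auto
    have "(\<integral>x. (g x)\<^sup>2 \<partial>lebesgue) \<le> (\<integral>x. (2 * R)\<^sup>2 * (norm (grad \<phi> (T s x)))\<^sup>2 \<partial>lebesgue)"
      using L2_on_UNIV_D(2)[OF L2g] L2_on_UNIV_D(2)[OF L2grad] gle by (intro integral_mono) auto
    also have "\<dots> = (2 * R)\<^sup>2 * ((\<integral>x. (norm (grad \<phi> x))\<^sup>2 \<partial>lebesgue) / s ^ DIM('a))"
      using s L2_norm_homothety[of s "grad \<phi>" a] C1c_mono[OF \<phi> subset_UNIV, THEN L2_C1c(2)] by (simp add: T_def)
    also have "\<dots> \<le> (2 * R)\<^sup>2 * ((\<integral>x. (norm (grad \<phi> x))\<^sup>2 \<partial>lebesgue) / (1/2) ^ DIM('a))"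
      using s by (intro mult_left_mono divide_left_mono power_mono) auto
    also have "\<dots> = M"
      by (simp add: M_def power_divide)
    finally have gM: "(\<integral>x. (g x)\<^sup>2 \<partial>lebesgue) \<le> M" .
    have "(m' s)\<^sup>2 = (\<integral>x. w x \<bullet> g x \<partial>lebesgue)\<^sup>2"
      using int_eq[OF g] by (simp add: m'_def g_def)
    also have "\<dots> \<le> W * (\<integral>x. (g x)\<^sup>2 \<partial>lebesgue)"
      using L2_Cauchy_Schwarz[OF L2w L2g] by (simp add: W_def)
    also have "\<dots> \<le> W * M"
      by (intro mult_left_mono gM) (simp add: W_def)
    finally show ?thesis
      by (simp add: real_le_rsqrt flip: real_sqrt_mult)
  qed
  have W0: "0 \<le> W" and M0: "0 \<le> M"
    by (auto simp: W_def M_def)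
  have "norm (m t - m 1) \<le> sqrt W * sqrt M * norm (t - 1)"
    by (rule field_differentiable_bound[OF _ der]) (use bound t in auto)
  moreover have "m t - m 1 = W"
  proof -
    have "continuous_on UNIV (\<lambda>x. \<phi> (T s x))" for s
      unfolding T_def by (intro continuous_intros continuous_on_compose2[OF c(1)]) auto
    note * = int_eq[OF this] L2_mult_integrable[OF L2w]
    have L2T: "L2_on UNIV (\<lambda>x. \<phi> (T s x))" if "s > 0" for s
      unfolding T_def using that C1c_mono[OF \<phi> subset_UNIV, THEN L2_C1c(1)] by (intro L2_homothety) auto
    have "m t - m 1 = (\<integral>x. w x * \<phi> (T t x) - w x * \<phi> (T 1 x) \<partial>lebesgue)"
      using t *(2)[OF L2T[of t]] *(2)[OF L2T[of 1]] by (simp add: m_def *(1))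
    also have "\<dots> = W"
      unfolding W_def by (rule Bochner_Integration.integral_cong) (auto simp: w_def T_def power2_eq_square algebra_simps)
    finally show ?thesis .
  qed
  \<comment> \<open>One factor \<open>sqrt W\<close> is cancelled next; if it is 0, the bound is
    trivial.\<close>
  ultimately have "W \<le> sqrt W * (sqrt M * \<bar>t - 1\<bar>)"
    using W0 by (simp add: mult.assoc)
  moreover have "W = sqrt W * sqrt W"
    using W0 by simp
  ultimately have "sqrt W \<le> sqrt M * \<bar>t - 1\<bar> \<or> sqrt W = 0"
    using W0 by (metis mult_le_cancel_left_pos order_le_less real_sqrt_ge_zero)
  then have "sqrt W \<le> sqrt M * \<bar>t - 1\<bar>"
    using M0 by auto
  then have "(sqrt W)\<^sup>2 \<le> (sqrt M * \<bar>t - 1\<bar>)\<^sup>2"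
    using W0 by (intro power_mono) auto
  then show ?thesis
    using W0 M0 by (simp add: power_mult_distrib W_def M_def w_def T_def mult.commute)
qed

section \<open>One-sided Pohozaev inequalities\<close>

text \<open>\<open>U\<close> and \<open>G\<close> stand for the extensions by zero of a function in
  \<open>H1_0\<close> and of its weak gradient. Their relation is recorded only through the common
  approximating sequence, which is the form that survives rescaling.\<close>

locale H1_0_limit =
  fixes \<Omega> :: "'a::euclidean_space set" and a :: 'a and R :: real
    and U :: "'a \<Rightarrow> real" and G :: "'a \<Rightarrow> 'a" and \<phi> :: "nat \<Rightarrow> 'a \<Rightarrow> real"
  assumes L2U: "L2_on UNIV U" and L2G: "L2_on UNIV G"
    and U0: "\<And>x. x \<notin> \<Omega> \<Longrightarrow> U x = 0" and subR: "\<Omega> \<subseteq> cball a R"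
    and \<phi>: "\<And>n. \<phi> n \<in> C1c \<Omega>"
    and limU: "(\<lambda>n. \<integral>x. (norm (U x - \<phi> n x))\<^sup>2 \<partial>lebesgue) \<longlonglongrightarrow> 0"
    and limG: "(\<lambda>n. \<integral>x. (norm (G x - grad (\<phi> n) x))\<^sup>2 \<partial>lebesgue) \<longlonglongrightarrow> 0"
begin

abbreviation T :: "real \<Rightarrow> 'a \<Rightarrow> 'a" where
  "T t x \<equiv> a + t *\<^sub>R (x - a)"

lemma L2\<phi>: "L2_on UNIV (\<phi> n)" "L2_on UNIV (grad (\<phi> n))"
  using L2_C1c[OF C1c_mono[OF \<phi> subset_UNIV]] by auto

lemma bounded_domain: "bounded \<Omega>"
  using subR bounded_subset[OF bounded_cball] by blast

text \<open>The bound for test functions passes to the limit because their gradients stay bounded in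
  L2. The factor 6 is 3, from splitting the difference at \<phi> n into three parts, times 2, from
  comparing grad (\<phi> n) with \<open>G\<close>.\<close>

lemma homothety_diff_L2:
  obtains K where "0 \<le> K"
    and "\<And>t. t \<in> {1/2..2} \<Longrightarrow> (\<integral>x. (U (T t x) - U x)\<^sup>2 \<partial>lebesgue) \<le> K * (t - 1)\<^sup>2"
proof
  define M where "M = (2 * R)\<^sup>2 * 2 ^ DIM('a)"
  define A where "A = (\<integral>x. (norm (G x))\<^sup>2 \<partial>lebesgue)"
  define g where "g n = (\<integral>x. (norm (G x - grad (\<phi> n) x))\<^sup>2 \<partial>lebesgue)" for n
  define c where "c n = (\<integral>x. (norm (U x - \<phi> n x))\<^sup>2 \<partial>lebesgue)" for n
  have grad_le: "(\<integral>x. (norm (grad (\<phi> n) x))\<^sup>2 \<partial>lebesgue) \<le> 2 * A + 2 * g n" for n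
  proof -
    have "(norm (grad (\<phi> n) x))\<^sup>2 \<le> 2 * (norm (G x))\<^sup>2 + 2 * (norm (G x - grad (\<phi> n) x))\<^sup>2" for x
    proof -
      have "norm (grad (\<phi> n) x) \<le> norm (G x) + norm (G x - grad (\<phi> n) x)"
        by (metis norm_minus_commute norm_triangle_sub)
      then have "(norm (grad (\<phi> n) x))\<^sup>2 \<le> (norm (G x) + norm (G x - grad (\<phi> n) x))\<^sup>2"
        by (intro power_mono) auto
      also have "\<dots> \<le> 2 * (norm (G x))\<^sup>2 + 2 * (norm (G x - grad (\<phi> n) x))\<^sup>2"
        using sum_squares_bound[of "norm (G x)" "norm (G x - grad (\<phi> n) x)"] by (simp add: power2_sum)
      finally show ?thesis .
    qed
    then have "(\<integral>x. (norm (grad (\<phi> n) x))\<^sup>2 \<partial>lebesgue)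
        \<le> (\<integral>x. 2 * (norm (G x))\<^sup>2 + 2 * (norm (G x - grad (\<phi> n) x))\<^sup>2 \<partial>lebesgue)"
      using L2_on_UNIV_D(2)[OF L2\<phi>(2)] L2_on_UNIV_D(2)[OF L2G] L2_on_UNIV_D(2)[OF L2_diff[OF L2G L2\<phi>(2)]]
      by (intro integral_mono) auto
    also have "\<dots> = 2 * A + 2 * g n"
      using L2_on_UNIV_D(2)[OF L2G] L2_on_UNIV_D(2)[OF L2_diff[OF L2G L2\<phi>(2)]] by (simp add: A_def g_def)
    finally show ?thesis .
  qed
  have M0: "0 \<le> M" and A0: "0 \<le> A"
    by (auto simp: M_def A_def)
  show "0 \<le> 6 * M * A"
    using M0 A0 by simp
  fix t :: real assume t: "t \<in> {1/2..2}"
  then have t0: "t > 0" by simp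
  have "(\<integral>x. (U (T t x) - U x)\<^sup>2 \<partial>lebesgue)
      \<le> 3 * (c n / t ^ DIM('a)) + 3 * ((t - 1)\<^sup>2 * (M * (2 * A + 2 * g n))) + 3 * c n" for n
  proof -
    have pw: "(U (T t x) - U x)\<^sup>2 \<le> 3 * (norm (U (T t x) - \<phi> n (T t x)))\<^sup>2
        + 3 * (norm (\<phi> n (T t x) - \<phi> n x))\<^sup>2 + 3 * (norm (U x - \<phi> n x))\<^sup>2" for x
    proof -
      have sq: "(p + q + r)\<^sup>2 \<le> 3 * p\<^sup>2 + 3 * q\<^sup>2 + 3 * r\<^sup>2" for p q r :: real
        using zero_le_power2[of "p - q"] zero_le_power2[of "p - r"] zero_le_power2[of "q - r"]
        by (simp add: power2_eq_square algebra_simps)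
      show ?thesis
        using sq[of "U (T t x) - \<phi> n (T t x)" "\<phi> n (T t x) - \<phi> n x" "\<phi> n x - U x"]
        by (simp add: power2_commute)
    qed
    note L = L2_diff[OF L2U L2\<phi>(1)] L2_homothety[OF t0 L2U] L2_homothety[OF t0 L2\<phi>(1)]
    note i = L2_on_UNIV_D(2)[OF L2_diff[OF L(2) L(3)]] L2_on_UNIV_D(2)[OF L2_diff[OF L(3) L2\<phi>(1)]]
      L2_on_UNIV_D(2)[OF L(1)] L2_on_UNIV_D(2)[OF L2_diff[OF L(2) L2U]]
    have "(\<integral>x. (U (T t x) - U x)\<^sup>2 \<partial>lebesgue) \<le> (\<integral>x. 3 * (norm (U (T t x) - \<phi> n (T t x)))\<^sup>2
        + 3 * (norm (\<phi> n (T t x) - \<phi> n x))\<^sup>2 + 3 * (norm (U x - \<phi> n x))\<^sup>2 \<partial>lebesgue)"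
      using i(4)[of a] pw
      by (intro integral_mono Bochner_Integration.integrable_add integrable_mult_right i) auto
    also have "\<dots> = 3 * (\<integral>x. (norm (U (T t x) - \<phi> n (T t x)))\<^sup>2 \<partial>lebesgue)
        + 3 * (\<integral>x. (norm (\<phi> n (T t x) - \<phi> n x))\<^sup>2 \<partial>lebesgue) + 3 * c n"
      using i(1)[of a n a] i(2)[of n a n] i(3)[of n] by (simp add: c_def)
    also have "(\<integral>x. (norm (U (T t x) - \<phi> n (T t x)))\<^sup>2 \<partial>lebesgue) = c n / t ^ DIM('a)"
      unfolding c_def by (rule L2_norm_homothety[OF t0 L(1)])
    also have "(\<integral>x. (norm (\<phi> n (T t x) - \<phi> n x))\<^sup>2 \<partial>lebesgue)
        \<le> (t - 1)\<^sup>2 * (M * (2 * A + 2 * g n))"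
    proof -
      have "(\<integral>x. (norm (\<phi> n (T t x) - \<phi> n x))\<^sup>2 \<partial>lebesgue)
          \<le> (t - 1)\<^sup>2 * (M * (\<integral>x. (norm (grad (\<phi> n) x))\<^sup>2 \<partial>lebesgue))"
        using C1c_homothety_diff[OF \<phi> subR t] by (simp add: M_def)
      also have "\<dots> \<le> (t - 1)\<^sup>2 * (M * (2 * A + 2 * g n))"
        by (intro mult_left_mono grad_le M0) auto
      finally show ?thesis .
    qed
    finally show ?thesis
      by simp
  qed
  moreover have "(\<lambda>n. 3 * (c n / t ^ DIM('a)) + 3 * ((t - 1)\<^sup>2 * (M * (2 * A + 2 * g n))) + 3 * c n)
      \<longlonglongrightarrow> 3 * (0 / t ^ DIM('a)) + 3 * ((t - 1)\<^sup>2 * (M * (2 * A + 2 * 0))) + 3 * 0"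
    using limU limG t0 unfolding c_def[symmetric] g_def[symmetric] by (intro tendsto_intros) auto
  ultimately have "(\<integral>x. (U (T t x) - U x)\<^sup>2 \<partial>lebesgue)
      \<le> 3 * (0 / t ^ DIM('a)) + 3 * ((t - 1)\<^sup>2 * (M * (2 * A + 2 * 0))) + 3 * 0"
    by (intro LIMSEQ_le_const) auto
  then show "(\<integral>x. (U (T t x) - U x)\<^sup>2 \<partial>lebesgue) \<le> 6 * M * A * (t - 1)\<^sup>2"
    by (simp add: algebra_simps)
qed

lemma homothety_support:
  assumes "t \<in> {1/2..2}" and "x \<notin> cball a (2 * R)"
  shows "T t x \<notin> \<Omega>"
proof
  assume "T t x \<in> \<Omega>"
  then have "dist a (T t x) \<le> R"
    using subR by auto
  then have "t * norm (x - a) \<le> R"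
    using assms(1) by (simp add: dist_norm)
  moreover have "1/2 * norm (x - a) \<le> t * norm (x - a)"
    using assms(1) by (intro mult_right_mono) auto
  ultimately show False
    using assms(2) by (simp add: dist_norm norm_minus_commute)
qed

lemma homothety_diff_integrable_powr:
  assumes "t \<in> {1/2..2}" and "0 < p" and "p \<le> 2"
  shows "integrable lebesgue (\<lambda>x. \<bar>U (T t x) - U x\<bar> powr p)"
proof (rule integrable_powr[OF _ bounded_cball])
  show "L2_on UNIV (\<lambda>x. U (T t x) - U x)"
    using assms(1) by (intro L2_diff L2_homothety L2U) auto
  show "U (T t x) - U x = 0" if "x \<notin> cball a (2 * R)" for x
    using homothety_support[OF assms(1) that] homothety_support[OF _ that, of 1] by (simp add: U0)
qed (use assms in auto)

text \<open>With h = |t - 1|, the bound |D/h|^p \<le> 1 + |D/h|^2 on a fixed ball reduces the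
  exponent p to the exponent 2. The constant is the volume of the ball plus the L2 constant.\<close>

lemma homothety_diff_powr:
  assumes p: "0 < p" "p \<le> 2"
  obtains K where "0 \<le> K"
    and "\<And>t. t \<in> {1/2..2} \<Longrightarrow> (\<integral>x. \<bar>U (T t x) - U x\<bar> powr p \<partial>lebesgue) \<le> K * \<bar>t - 1\<bar> powr p"
proof -
  obtain K where K: "0 \<le> K"
    "\<And>t. t \<in> {1/2..2} \<Longrightarrow> (\<integral>x. (U (T t x) - U x)\<^sup>2 \<partial>lebesgue) \<le> K * (t - 1)\<^sup>2"
    using homothety_diff_L2 by metis
  let ?v = "measure lebesgue (cball a (2 * R))"
  show ?thesis
  proof (rule that[of "?v + K"])
    show "0 \<le> ?v + K"
      using K(1) by simp
    fix t :: real assume t: "t \<in> {1/2..2}"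
    define D where "D x = U (T t x) - U x" for x
    have i: "integrable lebesgue (\<lambda>x. \<bar>D x\<bar> powr p)"
      unfolding D_def by (rule homothety_diff_integrable_powr[OF t p])
    have D0: "D x = 0" if "x \<notin> cball a (2 * R)" for x
      using homothety_support[OF t that] homothety_support[OF _ that, of 1] by (simp add: U0 D_def)
    show "(\<integral>x. \<bar>U (T t x) - U x\<bar> powr p \<partial>lebesgue) \<le> (?v + K) * \<bar>t - 1\<bar> powr p"
    proof (cases "t = 1")
      case False
      define h where "h = \<bar>t - 1\<bar>"
      have h: "h > 0"
        using False by (simp add: h_def)
      have pw: "\<bar>D x\<bar> powr p \<le> h powr p * (indicator (cball a (2 * R)) x + (norm (D x))\<^sup>2 / h\<^sup>2)" for x
      proof (cases "x \<in> cball a (2 * R)")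
        case True
        have "(\<bar>D x\<bar> / h) powr p \<le> 1 + (\<bar>D x\<bar> / h)\<^sup>2"
        proof (cases "\<bar>D x\<bar> / h \<le> 1")
          case True
          then have "(\<bar>D x\<bar> / h) powr p \<le> 1"
            using powr_mono2[of p "\<bar>D x\<bar> / h" 1] p h by simp
          then show ?thesis
            using zero_le_power2[of "\<bar>D x\<bar> / h"] by linarith
        next
          case False
          then have "(\<bar>D x\<bar> / h) powr p \<le> (\<bar>D x\<bar> / h) powr 2"
            using p by (intro powr_mono) auto
          also have "\<dots> = (\<bar>D x\<bar> / h)\<^sup>2"
            using False h by (subst powr_numeral) auto
          finally show ?thesis
            by simp
        qed
        then have "h powr p * (\<bar>D x\<bar> / h) powr p \<le> h powr p * (1 + (\<bar>D x\<bar> / h)\<^sup>2)"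
          by (rule mult_left_mono) simp
        moreover have "h powr p * (\<bar>D x\<bar> / h) powr p = \<bar>D x\<bar> powr p"
          using h by (simp add: powr_divide)
        ultimately show ?thesis
          using True by (simp add: power_divide)
      qed (simp add: D0)
      have iD: "integrable lebesgue (\<lambda>x. (norm (D x))\<^sup>2)"
        unfolding D_def using t L2_on_UNIV_D(2)[OF L2_diff[OF L2_homothety[OF _ L2U] L2U]] by auto
      have ii: "integrable lebesgue (indicator (cball a (2 * R)) :: 'a \<Rightarrow> real)"
        using emeasure_bounded_finite[OF bounded_cball] by (intro integrable_real_indicator) auto
      have "(\<integral>x. \<bar>D x\<bar> powr p \<partial>lebesgue)
          \<le> (\<integral>x. h powr p * (indicator (cball a (2 * R)) x + (norm (D x))\<^sup>2 / h\<^sup>2) \<partial>lebesgue)"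
        using iD ii by (intro integral_mono i pw) auto
      also have "\<dots> = h powr p * (?v + (\<integral>x. (norm (D x))\<^sup>2 \<partial>lebesgue) / h\<^sup>2)"
        using iD ii by simp
      also have "\<dots> \<le> h powr p * (?v + K)"
      proof (intro mult_left_mono add_left_mono)
        show "(\<integral>x. (norm (D x))\<^sup>2 \<partial>lebesgue) / h\<^sup>2 \<le> K"
          using K(2)[OF t] h by (simp add: D_def h_def field_simps)
      qed simp
      finally show ?thesis
        by (simp add: D_def h_def mult.commute)
    qed simp
  qed
qed

text \<open>Each \<phi> n composed with T is differentiated classically, which produces the factor
  t. In the limit the pair of U o T and t G o T replaces a test function and its gradient.\<close>

lemma homothety_weak_form:
  assumes t: "0 < t" and f: "L2_on UNIV f"
    and eq: "\<And>n. (\<integral>x. G x \<bullet> grad (\<lambda>x. \<phi> n (T t x)) x \<partial>lebesgue) + (\<integral>x. f x * \<phi> n (T t x) \<partial>lebesgue) = 0"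
  shows "(\<integral>x. G x \<bullet> (t *\<^sub>R G (T t x)) \<partial>lebesgue) + (\<integral>x. f x * U (T t x) \<partial>lebesgue) = 0"
proof -
  have "(\<lambda>n. (\<integral>x. G x \<bullet> (t *\<^sub>R grad (\<phi> n) (T t x)) \<partial>lebesgue) + (\<integral>x. f x \<bullet> \<phi> n (T t x) \<partial>lebesgue))
      \<longlonglongrightarrow> (\<integral>x. G x \<bullet> (t *\<^sub>R G (T t x)) \<partial>lebesgue) + (\<integral>x. f x \<bullet> U (T t x) \<partial>lebesgue)"
  proof (intro tendsto_add L2_tendsto_inner L2_scaleR L2_homothety[OF t] L2G f L2U L2\<phi>)
    have "(\<lambda>n. (\<integral>x. (norm (U x - \<phi> n x))\<^sup>2 \<partial>lebesgue) / t ^ DIM('a)) \<longlonglongrightarrow> 0"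
      using tendsto_divide[OF limU tendsto_const[of "t ^ DIM('a)"]] t by simp
    then show "(\<lambda>n. \<integral>x. (norm (U (T t x) - \<phi> n (T t x)))\<^sup>2 \<partial>lebesgue) \<longlonglongrightarrow> 0"
      by (simp only: L2_norm_homothety[OF t L2_diff[OF L2U L2\<phi>(1)]])
    have "(\<lambda>n. t\<^sup>2 * ((\<integral>x. (norm (G x - grad (\<phi> n) x))\<^sup>2 \<partial>lebesgue) / t ^ DIM('a))) \<longlonglongrightarrow> 0"
      using tendsto_mult[OF tendsto_const[of "t\<^sup>2"] tendsto_divide[OF limG tendsto_const[of "t ^ DIM('a)"]]] t by simp
    moreover have "(\<integral>x. (norm (t *\<^sub>R G (T t x) - t *\<^sub>R grad (\<phi> n) (T t x)))\<^sup>2 \<partial>lebesgue)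
        = t\<^sup>2 * ((\<integral>x. (norm (G x - grad (\<phi> n) x))\<^sup>2 \<partial>lebesgue) / t ^ DIM('a))" for n
    proof -
      have "(\<integral>x. (norm (t *\<^sub>R G (T t x) - t *\<^sub>R grad (\<phi> n) (T t x)))\<^sup>2 \<partial>lebesgue)
          = t\<^sup>2 * (\<integral>x. (norm (G (T t x) - grad (\<phi> n) (T t x)))\<^sup>2 \<partial>lebesgue)"
        by (simp add: power_mult_distrib flip: scaleR_diff_right)
      then show ?thesis
        by (simp only: L2_norm_homothety[OF t L2_diff[OF L2G L2\<phi>(2)]])
    qed
    ultimately show "(\<lambda>n. \<integral>x. (norm (t *\<^sub>R G (T t x) - t *\<^sub>R grad (\<phi> n) (T t x)))\<^sup>2 \<partial>lebesgue) \<longlonglongrightarrow> 0"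
      by simp
  qed
  moreover have "(\<integral>x. G x \<bullet> (t *\<^sub>R grad (\<phi> n) (T t x)) \<partial>lebesgue) + (\<integral>x. f x \<bullet> \<phi> n (T t x) \<partial>lebesgue) = 0" for n
    using eq[of n] by (simp add: grad_affine[OF C1c_imp_C1[OF \<phi>]])
  ultimately show ?thesis
    by (simp add: LIMSEQ_const_iff)
qed

text \<open>Convexity replaces differentiation of the Dirichlet term, so \<open>U\<close> needs no second derivatives;
  only the term with the wrong sign uses the regularity of \<open>U\<close>.\<close>

lemma homothety_inequality:
  assumes t: "t \<in> {1/2..2}" and \<alpha>: "0 < \<alpha>" "\<alpha> \<le> 1" and \<beta>: "0 < \<beta>" "\<beta> \<le> 1" and "0 \<le> lam"
    and eq: "\<And>n. (\<integral>x. G x \<bullet> grad (\<lambda>x. \<phi> n (T t x)) x \<partial>lebesgue)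
      + (\<integral>x. (\<bar>U x\<bar> powr (\<alpha> - 1) * U x) * \<phi> n (T t x) \<partial>lebesgue)
      = lam * (\<integral>x. (\<bar>U x\<bar> powr (\<beta> - 1) * U x) * \<phi> n (T t x) \<partial>lebesgue)"
  defines "A \<equiv> \<integral>x. (norm (G x))\<^sup>2 \<partial>lebesgue"
    and "B \<equiv> \<integral>x. \<bar>U x\<bar> powr (\<alpha> + 1) \<partial>lebesgue"
    and "C \<equiv> lam * (\<integral>x. \<bar>U x\<bar> powr (\<beta> + 1) \<partial>lebesgue)"
  assumes nehari: "A + B = C"
  shows "0 \<le> (t\<^sup>2 / t ^ DIM('a) - 1) / 2 * A + (1 / t ^ DIM('a) - 1) * (B / (\<alpha> + 1) - C / (\<beta> + 1))
    + 2 * lam * (\<integral>x. \<bar>U (T t x) - U x\<bar> powr (\<beta> + 1) \<partial>lebesgue)"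
proof -
  have t0: "t > 0"
    using t by simp
  \<comment> \<open>The factor t^(-N) that the homothety puts on integrals; the rescaled Dirichlet
    integral has t^2 \<tau>.\<close>
  define \<tau> where "\<tau> = 1 / t ^ DIM('a)"
  define f where "f p x = \<bar>U x\<bar> powr (p - 1) * U x" for p x
  have L2f: "L2_on UNIV (f p)" if "0 < p" "p \<le> 1" for p
    unfolding f_def by (rule L2_powr_mult[OF L2U bounded_domain U0 that])
  note LT = L2_homothety[OF t0 L2U, of a] L2_homothety[OF t0 L2G, of a]
  have iU: "integrable lebesgue (\<lambda>x. \<bar>U x\<bar> powr (p + 1))" if "0 < p" "p \<le> 1" for p
    using that by (intro integrable_powr[OF L2U bounded_domain U0]) auto
  have iUT: "integrable lebesgue (\<lambda>x. \<bar>U (T t x)\<bar> powr (p + 1))"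
    and IUT: "(\<integral>x. \<bar>U (T t x)\<bar> powr (p + 1) \<partial>lebesgue) = \<tau> * (\<integral>x. \<bar>U x\<bar> powr (p + 1) \<partial>lebesgue)"
    if "0 < p" "p \<le> 1" for p
    using integrable_homothety_iff[OF t0 borel_measurable_integrable[OF iU[OF that]], of a]
      integral_homothety[OF t0 borel_measurable_integrable[OF iU[OF that]], of a] iU[OF that]
    by (auto simp: \<tau>_def divide_inverse)
  have iD: "integrable lebesgue (\<lambda>x. \<bar>U (T t x) - U x\<bar> powr (\<beta> + 1))"
    using \<beta> by (intro homothety_diff_integrable_powr t) auto
  have weak: "(\<integral>x. G x \<bullet> (t *\<^sub>R G (T t x)) \<partial>lebesgue) + (\<integral>x. (f \<alpha> x - lam * f \<beta> x) * U (T t x) \<partial>lebesgue) = 0"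
  proof (rule homothety_weak_form[OF t0])
    show "L2_on UNIV (\<lambda>x. f \<alpha> x - lam * f \<beta> x)"
      using L2_diff[OF L2f[OF \<alpha>] L2_scaleR[OF L2f[OF \<beta>], of lam]] by simp
    fix n
    note i = L2_mult_integrable[OF L2f L2_homothety[OF t0 L2\<phi>(1)]]
    show "(\<integral>x. G x \<bullet> grad (\<lambda>x. \<phi> n (T t x)) x \<partial>lebesgue)
        + (\<integral>x. (f \<alpha> x - lam * f \<beta> x) * \<phi> n (T t x) \<partial>lebesgue) = 0"
      using eq[of n] i[OF \<alpha>, of n a] i[OF \<beta>, of n a]
      by (simp add: left_diff_distrib mult.assoc flip: f_def)
  qed
  have split: "(\<integral>x. (f \<alpha> x - lam * f \<beta> x) * U (T t x) \<partial>lebesgue)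
      = (\<integral>x. f \<alpha> x * U (T t x) \<partial>lebesgue) - lam * (\<integral>x. f \<beta> x * U (T t x) \<partial>lebesgue)"
    using L2_mult_integrable[OF L2f[OF \<alpha>] LT(1)] L2_mult_integrable[OF L2f[OF \<beta>] LT(1)]
    by (simp add: left_diff_distrib mult.assoc)
  have 1: "(\<integral>x. G x \<bullet> (t *\<^sub>R G (T t x)) \<partial>lebesgue) \<le> A / 2 + t\<^sup>2 * \<tau> * A / 2"
  proof -
    have "(\<integral>x. G x \<bullet> (t *\<^sub>R G (T t x)) \<partial>lebesgue)
        \<le> (\<integral>x. (norm (G x))\<^sup>2 / 2 + t\<^sup>2 * (norm (G (T t x)))\<^sup>2 / 2 \<partial>lebesgue)"
    proof (rule integral_mono)
      show "integrable lebesgue (\<lambda>x. G x \<bullet> (t *\<^sub>R G (T t x)))"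
        by (intro L2_inner_integrable L2_scaleR L2G LT)
      show "integrable lebesgue (\<lambda>x. (norm (G x))\<^sup>2 / 2 + t\<^sup>2 * (norm (G (T t x)))\<^sup>2 / 2)"
        using L2_on_UNIV_D(2)[OF L2G] L2_on_UNIV_D(2)[OF LT(2)] by auto
      show "G x \<bullet> (t *\<^sub>R G (T t x)) \<le> (norm (G x))\<^sup>2 / 2 + t\<^sup>2 * (norm (G (T t x)))\<^sup>2 / 2" for x
      proof -
        have "G x \<bullet> (t *\<^sub>R G (T t x)) \<le> norm (G x) * norm (t *\<^sub>R G (T t x))"
          by (rule norm_cauchy_schwarz)
        also have "\<dots> \<le> ((norm (G x))\<^sup>2 + (norm (t *\<^sub>R G (T t x)))\<^sup>2) / 2"
        proof -
          have "p * q \<le> (p\<^sup>2 + q\<^sup>2) / 2" for p q :: real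
            using sum_squares_bound[of p q] by simp
          then show ?thesis .
        qed
        finally show ?thesis
          by (simp add: power_mult_distrib add_divide_distrib)
      qed
    qed
    also have "\<dots> = A / 2 + t\<^sup>2 * \<tau> * A / 2"
      using L2_on_UNIV_D(2)[OF L2G] L2_on_UNIV_D(2)[OF LT(2)] L2_norm_homothety[OF t0 L2G, of a]
      by (simp add: A_def \<tau>_def)
    finally show ?thesis .
  qed
  have 2: "(\<integral>x. f \<alpha> x * U (T t x) \<partial>lebesgue) \<le> \<alpha> / (\<alpha> + 1) * B + 1 / (\<alpha> + 1) * (\<tau> * B)"
  proof -
    have "(\<integral>x. f \<alpha> x * U (T t x) \<partial>lebesgue)
        \<le> (\<integral>x. \<alpha> / (\<alpha> + 1) * \<bar>U x\<bar> powr (\<alpha> + 1) + 1 / (\<alpha> + 1) * \<bar>U (T t x)\<bar> powr (\<alpha> + 1) \<partial>lebesgue)"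
      unfolding f_def using L2_mult_integrable[OF L2f[OF \<alpha>] LT(1)] iU[OF \<alpha>] iUT[OF \<alpha>]
      by (intro integral_mono powr_young \<alpha> Bochner_Integration.integrable_add integrable_mult_right)
        (auto simp: f_def)
    also have "\<dots> = \<alpha> / (\<alpha> + 1) * B + 1 / (\<alpha> + 1) * (\<tau> * B)"
      unfolding B_def IUT[OF \<alpha>, symmetric] using iU[OF \<alpha>] iUT[OF \<alpha>]
      by (subst Bochner_Integration.integral_add) auto
    finally show ?thesis .
  qed
  let ?C = "\<integral>x. \<bar>U x\<bar> powr (\<beta> + 1) \<partial>lebesgue"
  let ?D = "\<integral>x. \<bar>U (T t x) - U x\<bar> powr (\<beta> + 1) \<partial>lebesgue"
  have 3: "?C + 1 / (\<beta> + 1) * (\<tau> * ?C - ?C) - 2 * ?D \<le> (\<integral>x. f \<beta> x * U (T t x) \<partial>lebesgue)"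
  proof -
    have "?C + 1 / (\<beta> + 1) * (\<tau> * ?C - ?C) - 2 * ?D
        = (\<integral>x. \<bar>U x\<bar> powr (\<beta> + 1) + 1 / (\<beta> + 1) * (\<bar>U (T t x)\<bar> powr (\<beta> + 1) - \<bar>U x\<bar> powr (\<beta> + 1))
          - 2 * \<bar>U (T t x) - U x\<bar> powr (\<beta> + 1) \<partial>lebesgue)"
      unfolding IUT[OF \<beta>, symmetric] using iU[OF \<beta>] iUT[OF \<beta>] iD
      by (simp add: Bochner_Integration.integral_diff Bochner_Integration.integral_add)
    also have "\<dots> \<le> (\<integral>x. f \<beta> x * U (T t x) \<partial>lebesgue)"
      unfolding f_def using L2_mult_integrable[OF L2f[OF \<beta>] LT(1)] iU[OF \<beta>] iUT[OF \<beta>] iD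
      by (intro integral_mono powr_convexity_gap \<beta> Bochner_Integration.integrable_add
          Bochner_Integration.integrable_diff integrable_mult_right) (auto simp: f_def)
    finally show ?thesis .
  qed
  from mult_left_mono[OF 3 \<open>0 \<le> lam\<close>]
  have 3: "C + 1 / (\<beta> + 1) * (\<tau> * C - C) - 2 * lam * ?D \<le> lam * (\<integral>x. f \<beta> x * U (T t x) \<partial>lebesgue)"
    by (simp add: C_def algebra_simps)
  have "0 \<le> A / 2 + t\<^sup>2 * \<tau> * A / 2 + (\<alpha> / (\<alpha> + 1) * B + 1 / (\<alpha> + 1) * (\<tau> * B))
      - (C + 1 / (\<beta> + 1) * (\<tau> * C - C) - 2 * lam * ?D)"
    using weak split 1 2 3 by linarith
  \<comment> \<open>A + B - C collects what remains at t = 1 and is zero; every other term vanishes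
    there.\<close>
  also have "\<dots> = (t\<^sup>2 * \<tau> - 1) / 2 * A + (\<tau> - 1) * (B / (\<alpha> + 1) - C / (\<beta> + 1)) + 2 * lam * ?D + (A + B - C)"
  proof -
    have \<alpha>1: "\<alpha> / (\<alpha> + 1) = 1 - 1 / (\<alpha> + 1)"
      using \<alpha> by (simp add: field_simps)
    \<comment> \<open>With c, d, E in place of the fractions and the error integral this is a
      polynomial identity.\<close>
    have "A / 2 + t\<^sup>2 * \<tau> * A / 2 + ((1 - c) * B + c * (\<tau> * B)) - (C + d * (\<tau> * C - C) - E)
        = (t\<^sup>2 * \<tau> - 1) / 2 * A + (\<tau> - 1) * (c * B - d * C) + E + (A + B - C)" for c d E :: real
      by (simp add: field_simps)
    from this[of "1 / (\<alpha> + 1)" "1 / (\<beta> + 1)" "2 * lam * ?D"] show ?thesis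
      unfolding \<alpha>1 by simp
  qed
  finally show ?thesis
    using nehari by (simp add: \<tau>_def)
qed

end

text \<open>Divided by h, the error K h^(p+1) tends to 0, so the difference quotient from one side
  has a nonnegative limit. \<sigma> selects the side.\<close>

lemma DERIV_nonneg_if_above_powr:
  fixes F :: "real \<Rightarrow> real"
  assumes F: "DERIV F x :> L" "F x = 0" and p: "0 < p"
    and le: "\<And>h. 0 < h \<Longrightarrow> h \<le> 1/2 \<Longrightarrow> 0 \<le> F (x + \<sigma> * h) + K * h powr (p + 1)"
  shows "0 \<le> \<sigma> * L"
proof -
  have "DERIV (\<lambda>h. F (x + \<sigma> * h)) 0 :> L * \<sigma>"
    by (rule DERIV_chain2[where f = F]) (use F(1) in \<open>auto intro!: derivative_eq_intros\<close>)
  then have "((\<lambda>h. F (x + \<sigma> * h) / h) \<longlongrightarrow> L * \<sigma>) (at 0)"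
    using F(2) by (simp add: DERIV_def)
  then have "((\<lambda>h. F (x + \<sigma> * h) / h) \<longlongrightarrow> L * \<sigma>) (at_right 0)"
    by (rule filterlim_mono) (auto simp: at_le)
  moreover have "((\<lambda>h. h powr p) \<longlongrightarrow> 0 powr p) (at_right 0)"
    using p by (intro tendsto_powr2) (auto intro!: tendsto_eq_intros eventually_at_rightI[of 0 1])
  ultimately have "((\<lambda>h. F (x + \<sigma> * h) / h + K * h powr p) \<longlongrightarrow> L * \<sigma> + K * 0 powr p) (at_right 0)"
    by (intro tendsto_add tendsto_mult tendsto_const)
  moreover have "\<forall>\<^sub>F h in at_right 0. 0 \<le> F (x + \<sigma> * h) / h + K * h powr p"
  proof (rule eventually_at_rightI[of 0 "1/2"])
    fix h :: real assume h: "h \<in> {0<..<1/2}"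
    then have "0 \<le> (F (x + \<sigma> * h) + K * h powr (p + 1)) / h"
      using le[of h] by simp
    also have "\<dots> = F (x + \<sigma> * h) / h + K * h powr p"
      using h by (simp add: powr_add field_simps)
    finally show "0 \<le> F (x + \<sigma> * h) / h + K * h powr p" .
  qed simp
  ultimately have "0 \<le> L * \<sigma> + K * 0 powr p"
    by (intro tendsto_lowerbound[OF _ _ trivial_limit_at_right_real]) auto
  then show ?thesis
    by (simp add: mult.commute)
qed

context H1_0_limit
begin

text \<open>The homothety inequality reads 0 \<le> F(t) + O(|t - 1|^(\<beta>+1)) with F(1) = 0, and
  the bracket is F'(1). For \<sigma> = 1 the rescaled functions contract towards a, for \<sigma> =
  -1 they spread out.\<close>

lemma pohozaev_inequality:
  assumes \<sigma>: "\<sigma> = 1 \<or> \<sigma> = - 1" and \<alpha>: "0 < \<alpha>" "\<alpha> \<le> 1" and \<beta>: "0 < \<beta>" "\<beta> \<le> 1" and "0 \<le> lam"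
    and eq: "\<And>h n. 0 < h \<Longrightarrow> h \<le> 1/2 \<Longrightarrow>
      (\<integral>x. G x \<bullet> grad (\<lambda>x. \<phi> n (T (1 + \<sigma> * h) x)) x \<partial>lebesgue)
      + (\<integral>x. (\<bar>U x\<bar> powr (\<alpha> - 1) * U x) * \<phi> n (T (1 + \<sigma> * h) x) \<partial>lebesgue)
      = lam * (\<integral>x. (\<bar>U x\<bar> powr (\<beta> - 1) * U x) * \<phi> n (T (1 + \<sigma> * h) x) \<partial>lebesgue)"
  defines "A \<equiv> \<integral>x. (norm (G x))\<^sup>2 \<partial>lebesgue"
    and "B \<equiv> \<integral>x. \<bar>U x\<bar> powr (\<alpha> + 1) \<partial>lebesgue"
    and "C \<equiv> lam * (\<integral>x. \<bar>U x\<bar> powr (\<beta> + 1) \<partial>lebesgue)"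
  assumes nehari: "A + B = C"
  shows "0 \<le> \<sigma> * ((2 - real DIM('a)) / 2 * A - real DIM('a) * (B / (\<alpha> + 1) - C / (\<beta> + 1)))"
proof -
  let ?Q = "B / (\<alpha> + 1) - C / (\<beta> + 1)"
  define F where "F t = (t\<^sup>2 / t ^ DIM('a) - 1) / 2 * A + (1 / t ^ DIM('a) - 1) * ?Q" for t :: real
  obtain K where "0 \<le> K" and
    K: "\<And>t. t \<in> {1/2..2} \<Longrightarrow> (\<integral>x. \<bar>U (T t x) - U x\<bar> powr (\<beta> + 1) \<partial>lebesgue) \<le> K * \<bar>t - 1\<bar> powr (\<beta> + 1)"
    using homothety_diff_powr[of "\<beta> + 1"] \<beta> by auto
  show ?thesis
  proof (rule DERIV_nonneg_if_above_powr[where F = F and x = 1 and p = \<beta> and K = "2 * lam * K"])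
    \<comment> \<open>t^(2-N) and t^(-N) contribute 2 - N and -N. The quotient term is generalised
      to a variable so that the derivative rules do not take it apart.\<close>
    have "DERIV (\<lambda>t. (t\<^sup>2 / t ^ DIM('a) - 1) / 2 * A + (1 / t ^ DIM('a) - 1) * Q) 1 :>
        (2 - real DIM('a)) / 2 * A - real DIM('a) * Q" for Q
      by (auto intro!: derivative_eq_intros simp: power2_eq_square algebra_simps diff_divide_distrib)
    then show "DERIV F 1 :> (2 - real DIM('a)) / 2 * A - real DIM('a) * ?Q"
      unfolding F_def .
    show "F 1 = 0"
      by (simp add: F_def)
    fix h :: real assume h: "0 < h" "h \<le> 1/2"
    let ?t = "1 + \<sigma> * h"
    have t: "?t \<in> {1/2..2}" and th: "\<bar>?t - 1\<bar> = h"
      using \<sigma> h by auto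
    have "0 \<le> F ?t + 2 * lam * (\<integral>x. \<bar>U (T ?t x) - U x\<bar> powr (\<beta> + 1) \<partial>lebesgue)"
      using homothety_inequality[OF t \<alpha> \<beta> \<open>0 \<le> lam\<close> eq[OF h]] nehari
      by (simp add: F_def A_def B_def C_def)
    also have "\<dots> \<le> F ?t + 2 * lam * (K * h powr (\<beta> + 1))"
      using K[OF t] \<open>0 \<le> lam\<close> unfolding th by (intro add_left_mono mult_left_mono) auto
    finally show "0 \<le> F (1 + \<sigma> * h) + 2 * lam * K * h powr (\<beta> + 1)"
      by (simp add: mult.assoc)
  qed (rule \<beta>)
qed

end

section \<open>Weak solutions as extensions by zero\<close>

lemma set_integral_eq_integral_extension:
  fixes f :: "'a \<Rightarrow> 'b::real_vector" and g :: "'b \<Rightarrow> 'c::{banach, second_countable_topology}"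
  assumes "g 0 = 0"
  shows "(LINT x:\<Omega>|M. g (f x)) = (\<integral>x. g (indicator \<Omega> x *\<^sub>R f x) \<partial>M)"
  unfolding set_lebesgue_integral_def
  by (rule Bochner_Integration.integral_cong) (auto simp: indicator_def assms)

lemma H1_0_limitE:
  fixes u :: "'a::euclidean_space \<Rightarrow> real"
  assumes u: "u \<in> H1_0 \<Omega>" and "\<Omega> \<subseteq> cball a R"
  obtains \<phi> where "H1_0_limit \<Omega> a R (\<lambda>x. indicator \<Omega> x *\<^sub>R u x) (\<lambda>x. indicator \<Omega> x *\<^sub>R wgrad \<Omega> u x) \<phi>"
proof -
  have H1: "u \<in> H1 \<Omega>"
    using u by (simp add: H1_0_def)
  obtain \<phi> where \<phi>: "\<And>n. \<phi> n \<in> C1c \<Omega>"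
    and lim: "(\<lambda>n. (LINT x:\<Omega>|lebesgue. (u x - \<phi> n x)\<^sup>2)
        + (LINT x:\<Omega>|lebesgue. (norm (wgrad \<Omega> u x - grad (\<phi> n) x))\<^sup>2)) \<longlonglongrightarrow> 0"
    using u by (auto simp: H1_0_def)
  have ext: "indicator \<Omega> x *\<^sub>R (u x - \<phi> n x) = indicator \<Omega> x *\<^sub>R u x - \<phi> n x"
    "indicator \<Omega> x *\<^sub>R (wgrad \<Omega> u x - grad (\<phi> n) x) = indicator \<Omega> x *\<^sub>R wgrad \<Omega> u x - grad (\<phi> n) x" for n x
    using C1c_indicator[OF \<phi>[of n], of x] by (simp_all add: scaleR_diff_right right_diff_distrib)
  have eq: "(LINT x:\<Omega>|lebesgue. (u x - \<phi> n x)\<^sup>2) = (\<integral>x. (norm (indicator \<Omega> x *\<^sub>R u x - \<phi> n x))\<^sup>2 \<partial>lebesgue)"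
    "(LINT x:\<Omega>|lebesgue. (norm (wgrad \<Omega> u x - grad (\<phi> n) x))\<^sup>2)
      = (\<integral>x. (norm (indicator \<Omega> x *\<^sub>R wgrad \<Omega> u x - grad (\<phi> n) x))\<^sup>2 \<partial>lebesgue)" for n
    using set_integral_eq_integral_extension[where g = "\<lambda>y. (norm y)\<^sup>2" and \<Omega> = \<Omega> and M = lebesgue and f = "\<lambda>x. u x - \<phi> n x"]
      set_integral_eq_integral_extension[where g = "\<lambda>y. (norm y)\<^sup>2" and \<Omega> = \<Omega> and M = lebesgue and f = "\<lambda>x. wgrad \<Omega> u x - grad (\<phi> n) x"]
    unfolding ext by simp_all
  note lim = lim[unfolded eq]
  show ?thesis
  proof (rule that, unfold_locales)
    show "L2_on UNIV (\<lambda>x. indicator \<Omega> x *\<^sub>R u x)" "L2_on UNIV (\<lambda>x. indicator \<Omega> x *\<^sub>R wgrad \<Omega> u x)"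
      using H1 H1_wgrad(1)[OF H1] by (simp_all only: L2_on_iff_extension[of \<Omega>, symmetric]) (simp add: H1_def)
    \<comment> \<open>Both summands in \<open>lim\<close> are nonnegative, so each is squeezed
      between 0 and their sum.\<close>
    show "(\<lambda>n. \<integral>x. (norm (indicator \<Omega> x *\<^sub>R u x - \<phi> n x))\<^sup>2 \<partial>lebesgue) \<longlonglongrightarrow> 0"
      by (rule tendsto_sandwich[OF _ _ tendsto_const lim]) (auto intro!: always_eventually)
    show "(\<lambda>n. \<integral>x. (norm (indicator \<Omega> x *\<^sub>R wgrad \<Omega> u x - grad (\<phi> n) x))\<^sup>2 \<partial>lebesgue) \<longlonglongrightarrow> 0"
      by (rule tendsto_sandwich[OF _ _ tendsto_const lim]) (auto intro!: always_eventually)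
  qed (use assms(2) \<phi> in auto)
qed

text \<open>The support moves by the inverse homothety, of factor 1/t. For t > 1 star-shapedness
  allows \<Omega>' = \<Omega>; for t < 1 the choice is \<Omega>' = UNIV.\<close>

lemma C1c_homothety:
  fixes \<phi> :: "'a::euclidean_space \<Rightarrow> real"
  assumes "\<phi> \<in> C1c \<Omega>" and t: "0 < t" and "\<And>x. x \<in> \<Omega> \<Longrightarrow> a + (1 / t) *\<^sub>R (x - a) \<in> \<Omega>'"
  shows "(\<lambda>x. \<phi> (a + t *\<^sub>R (x - a))) \<in> C1c \<Omega>'"
proof -
  obtain K where C1: "C1_on UNIV \<phi>" and K: "compact K" "K \<subseteq> \<Omega>" "\<And>x. x \<notin> K \<Longrightarrow> \<phi> x = 0"
    using C1c_E[OF assms(1)] by metis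
  let ?S = "\<lambda>x. a + (1 / t) *\<^sub>R (x - a)"
  show ?thesis
  proof (rule C1c_I[OF C1_on_affine[OF C1]])
    show "compact (?S ` K)"
      by (intro compact_continuous_image K continuous_intros)
    show "?S ` K \<subseteq> \<Omega>'"
      using K(2) assms(3) by auto
    show "\<phi> (a + t *\<^sub>R (x - a)) = 0" if "x \<notin> ?S ` K" for x
    proof (rule K(3), rule notI)
      assume "a + t *\<^sub>R (x - a) \<in> K"
      moreover have "x = ?S (a + t *\<^sub>R (x - a))"
        using t by simp
      ultimately show False
        using that by blast
    qed
  qed
qed

text \<open>Replaces the chosen \<open>wgrad\<close> of the test function by its classical gradient
  and integrals over \<Omega> by integrals over the space, the form used in the homothety
  argument.\<close>

lemma weak_solution_test:
  assumes "open \<Omega>" and u: "weak_solution \<Omega> \<alpha> \<beta> lam u" and \<psi>: "\<psi> \<in> C1c \<Omega>"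
  defines "U \<equiv> \<lambda>x. indicator \<Omega> x *\<^sub>R u x"
  shows "(\<integral>x. (indicator \<Omega> x *\<^sub>R wgrad \<Omega> u x) \<bullet> grad \<psi> x \<partial>lebesgue)
      + (\<integral>x. (\<bar>U x\<bar> powr (\<alpha> - 1) * U x) * \<psi> x \<partial>lebesgue)
    = lam * (\<integral>x. (\<bar>U x\<bar> powr (\<beta> - 1) * U x) * \<psi> x \<partial>lebesgue)"
proof -
  have H: "u \<in> H1 \<Omega>" "\<psi> \<in> H1 \<Omega>"
    using u C1c_subset_H1_0[OF assms(1) \<psi>] by (auto simp: weak_solution_def H1_0_def)
  note ext = H1_wgrad(1)[OF H(1), unfolded L2_on_iff_extension[of \<Omega>]]
    H1_wgrad(1)[OF H(2), unfolded L2_on_iff_extension[of \<Omega>]]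
  have "(LINT x:\<Omega>|lebesgue. wgrad \<Omega> u x \<bullet> wgrad \<Omega> \<psi> x)
      = (\<integral>x. (indicator \<Omega> x *\<^sub>R wgrad \<Omega> u x) \<bullet> (indicator \<Omega> x *\<^sub>R wgrad \<Omega> \<psi> x) \<partial>lebesgue)"
    unfolding set_lebesgue_integral_def by (rule Bochner_Integration.integral_cong) (auto simp: indicator_def)
  also have "\<dots> = (\<integral>x. (indicator \<Omega> x *\<^sub>R wgrad \<Omega> u x) \<bullet> grad \<psi> x \<partial>lebesgue)"
  proof (rule integral_cong_AE)
    show "AE x in lebesgue. (indicator \<Omega> x *\<^sub>R wgrad \<Omega> u x) \<bullet> (indicator \<Omega> x *\<^sub>R wgrad \<Omega> \<psi> x)
        = (indicator \<Omega> x *\<^sub>R wgrad \<Omega> u x) \<bullet> grad \<psi> x"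
      using wgrad_C1c[OF assms(1) \<psi>] by eventually_elim (auto simp: indicator_def)
  qed (intro borel_measurable_integrable L2_inner_integrable ext L2_C1c(2) C1c_mono[OF \<psi>] subset_UNIV)+
  finally have 1: "(LINT x:\<Omega>|lebesgue. wgrad \<Omega> u x \<bullet> wgrad \<Omega> \<psi> x)
      = (\<integral>x. (indicator \<Omega> x *\<^sub>R wgrad \<Omega> u x) \<bullet> grad \<psi> x \<partial>lebesgue)" .
  have 2: "(LINT x:\<Omega>|lebesgue. (\<bar>u x\<bar> powr (p - 1) * u x) * \<psi> x)
      = (\<integral>x. (\<bar>U x\<bar> powr (p - 1) * U x) * \<psi> x \<partial>lebesgue)" for p
    unfolding set_lebesgue_integral_def U_def
    by (rule Bochner_Integration.integral_cong) (auto simp: indicator_def)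
  show ?thesis
    using u C1c_subset_H1_0[OF assms(1) \<psi>] unfolding weak_solution_def 1[symmetric] 2[symmetric] by blast
qed

lemma set_integral_extension_powr_norm:
  shows "(LINT x:\<Omega>|lebesgue. (norm (G x))\<^sup>2) = (\<integral>x. (norm (indicator \<Omega> x *\<^sub>R G x))\<^sup>2 \<partial>lebesgue)"
    and "(LINT x:\<Omega>|lebesgue. \<bar>u x\<bar> powr p :: real) = (\<integral>x. \<bar>indicator \<Omega> x *\<^sub>R u x\<bar> powr p \<partial>lebesgue)"
  using set_integral_eq_integral_extension[where g = "\<lambda>y. (norm y)\<^sup>2" and f = G and M = lebesgue and \<Omega> = \<Omega>]
    set_integral_eq_integral_extension[where g = "\<lambda>y. \<bar>y\<bar> powr p :: real" and f = u and M = lebesgue and \<Omega> = \<Omega>]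
  by auto

text \<open>The solution is tested with itself.\<close>

lemma weak_solution_nehari:
  assumes "weak_solution \<Omega> \<alpha> \<beta> lam u"
  shows "(LINT x:\<Omega>|lebesgue. (norm (wgrad \<Omega> u x))\<^sup>2) + (LINT x:\<Omega>|lebesgue. \<bar>u x\<bar> powr (\<alpha> + 1))
    = lam * (LINT x:\<Omega>|lebesgue. \<bar>u x\<bar> powr (\<beta> + 1))"
  using assms unfolding weak_solution_def
  by (auto simp: powr_mult_self power2_norm_eq_inner)

text \<open>The equation for rescaled test functions is kept as a hypothesis: star-shapedness
  supplies it for \<sigma> = 1, flatness for \<sigma> = -1.\<close>

lemma weak_solution_pohozaev:
  fixes \<Omega> :: "'a::euclidean_space set"
  assumes "open \<Omega>" and "bounded \<Omega>" and u: "weak_solution \<Omega> \<alpha> \<beta> lam u"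
    and \<alpha>: "0 < \<alpha>" "\<alpha> \<le> 1" and \<beta>: "0 < \<beta>" "\<beta> \<le> 1" and "0 \<le> lam" and \<sigma>: "\<sigma> = 1 \<or> \<sigma> = - 1"
  defines "U \<equiv> \<lambda>x. indicator \<Omega> x *\<^sub>R u x"
  assumes test: "\<And>\<phi> h. \<phi> \<in> C1c \<Omega> \<Longrightarrow> 0 < h \<Longrightarrow> h \<le> 1/2 \<Longrightarrow>
      (\<integral>x. (indicator \<Omega> x *\<^sub>R wgrad \<Omega> u x) \<bullet> grad (\<lambda>x. \<phi> (a + (1 + \<sigma> * h) *\<^sub>R (x - a))) x \<partial>lebesgue)
      + (\<integral>x. (\<bar>U x\<bar> powr (\<alpha> - 1) * U x) * \<phi> (a + (1 + \<sigma> * h) *\<^sub>R (x - a)) \<partial>lebesgue)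
      = lam * (\<integral>x. (\<bar>U x\<bar> powr (\<beta> - 1) * U x) * \<phi> (a + (1 + \<sigma> * h) *\<^sub>R (x - a)) \<partial>lebesgue)"
  shows "0 \<le> \<sigma> * ((2 - real DIM('a)) / 2 * (LINT x:\<Omega>|lebesgue. (norm (wgrad \<Omega> u x))\<^sup>2)
    - real DIM('a) * ((LINT x:\<Omega>|lebesgue. \<bar>u x\<bar> powr (\<alpha> + 1)) / (\<alpha> + 1)
      - lam * (LINT x:\<Omega>|lebesgue. \<bar>u x\<bar> powr (\<beta> + 1)) / (\<beta> + 1)))"
proof -
  obtain R where R: "\<Omega> \<subseteq> cball a R"
    using bounded_subset_ballD[OF assms(2), of a] ball_subset_cball by blast
  have "u \<in> H1_0 \<Omega>"
    using u by (simp add: weak_solution_def)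
  then obtain \<phi> where "H1_0_limit \<Omega> a R U (\<lambda>x. indicator \<Omega> x *\<^sub>R wgrad \<Omega> u x) \<phi>"
    using H1_0_limitE[OF _ R] unfolding U_def by auto
  then interpret H1_0_limit \<Omega> a R U "\<lambda>x. indicator \<Omega> x *\<^sub>R wgrad \<Omega> u x" \<phi> .
  have "(\<integral>x. (norm (indicator \<Omega> x *\<^sub>R wgrad \<Omega> u x))\<^sup>2 \<partial>lebesgue) + (\<integral>x. \<bar>U x\<bar> powr (\<alpha> + 1) \<partial>lebesgue)
      = lam * (\<integral>x. \<bar>U x\<bar> powr (\<beta> + 1) \<partial>lebesgue)"
    using weak_solution_nehari[OF u] unfolding set_integral_extension_powr_norm U_def .
  from pohozaev_inequality[OF \<sigma> \<alpha> \<beta> \<open>0 \<le> lam\<close> test[OF \<phi>] this] show ?thesis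
    unfolding set_integral_extension_powr_norm U_def .
qed

section \<open>The fibering map and its second derivative\<close>

lemma fibering_eq:
  assumes "open \<Omega>" and "u \<in> H1 \<Omega>" and "0 < r"
  shows "fibering \<Omega> \<alpha> \<beta> lam u r = r\<^sup>2 / 2 * (LINT x:\<Omega>|lebesgue. (norm (wgrad \<Omega> u x))\<^sup>2)
    + r powr (\<alpha> + 1) / (\<alpha> + 1) * (LINT x:\<Omega>|lebesgue. \<bar>u x\<bar> powr (\<alpha> + 1))
    - r powr (\<beta> + 1) / (\<beta> + 1) * (lam * (LINT x:\<Omega>|lebesgue. \<bar>u x\<bar> powr (\<beta> + 1)))"
proof -
  have m: "(\<lambda>x. indicator \<Omega> x *\<^sub>R wgrad \<Omega> v x) \<in> borel_measurable lebesgue" if "v \<in> H1 \<Omega>" for v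
    using L2_on_UNIV_D(1) H1_wgrad(1)[OF that] L2_on_iff_extension by blast
  have "(LINT x:\<Omega>|lebesgue. (norm (wgrad \<Omega> (\<lambda>x. r * u x) x))\<^sup>2)
      = (\<integral>x. r\<^sup>2 * (norm (indicator \<Omega> x *\<^sub>R wgrad \<Omega> u x))\<^sup>2 \<partial>lebesgue)"
    unfolding set_integral_extension_powr_norm
  proof (rule integral_cong_AE)
    show "AE x in lebesgue. (norm (indicator \<Omega> x *\<^sub>R wgrad \<Omega> (\<lambda>x. r * u x) x))\<^sup>2
        = r\<^sup>2 * (norm (indicator \<Omega> x *\<^sub>R wgrad \<Omega> u x))\<^sup>2"
      using wgrad_scale[OF assms(1,2), of r] by eventually_elim (auto simp: indicator_def power_mult_distrib)
    show "(\<lambda>x. (norm (indicator \<Omega> x *\<^sub>R wgrad \<Omega> (\<lambda>x. r * u x) x))\<^sup>2) \<in> borel_measurable lebesgue"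
      by (rule borel_measurable_power[OF measurable_compose[OF m[OF H1_scale[OF assms(2)]] borel_measurable_norm]])
    show "(\<lambda>x. r\<^sup>2 * (norm (indicator \<Omega> x *\<^sub>R wgrad \<Omega> u x))\<^sup>2) \<in> borel_measurable lebesgue"
      by (rule borel_measurable_times[OF borel_measurable_const
            borel_measurable_power[OF measurable_compose[OF m[OF assms(2)] borel_measurable_norm]]])
  qed
  also have "\<dots> = r\<^sup>2 * (LINT x:\<Omega>|lebesgue. (norm (wgrad \<Omega> u x))\<^sup>2)"
    unfolding set_integral_extension_powr_norm by simp
  finally have 1: "(LINT x:\<Omega>|lebesgue. (norm (wgrad \<Omega> (\<lambda>x. r * u x) x))\<^sup>2)
      = r\<^sup>2 * (LINT x:\<Omega>|lebesgue. (norm (wgrad \<Omega> u x))\<^sup>2)" .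
  have 2: "(LINT x:\<Omega>|lebesgue. \<bar>r * u x\<bar> powr p) = r powr p * (LINT x:\<Omega>|lebesgue. \<bar>u x\<bar> powr p)" for p
    using assms(3) by (simp add: abs_mult powr_mult)
  show ?thesis
    by (simp add: fibering_def energy_def 1 2)
qed

text \<open>The explicit formula holds on the open half line r > 0, so the first derivative is known
  in a neighbourhood of 1 and can be differentiated again.\<close>

lemma deriv_deriv_fibering:
  assumes "open \<Omega>" and "u \<in> H1 \<Omega>" and "0 < \<alpha>" and "0 < \<beta>"
  shows "deriv (deriv (fibering \<Omega> \<alpha> \<beta> lam u)) 1 = (LINT x:\<Omega>|lebesgue. (norm (wgrad \<Omega> u x))\<^sup>2)
    + \<alpha> * (LINT x:\<Omega>|lebesgue. \<bar>u x\<bar> powr (\<alpha> + 1))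
    - \<beta> * (lam * (LINT x:\<Omega>|lebesgue. \<bar>u x\<bar> powr (\<beta> + 1)))"
proof -
  let ?A = "LINT x:\<Omega>|lebesgue. (norm (wgrad \<Omega> u x))\<^sup>2"
    and ?B = "LINT x:\<Omega>|lebesgue. \<bar>u x\<bar> powr (\<alpha> + 1)"
    and ?C = "lam * (LINT x:\<Omega>|lebesgue. \<bar>u x\<bar> powr (\<beta> + 1))"
  have "deriv (fibering \<Omega> \<alpha> \<beta> lam u) r = r * ?A + r powr \<alpha> * ?B - r powr \<beta> * ?C" if r: "r \<in> {0<..}" for r
  proof (rule DERIV_imp_deriv, rule has_field_derivative_transform_within_open[OF _ open_greaterThan r])
    have 2: "DERIV (\<lambda>r. r powr (p + 1) / (p + 1) * B) r :> r powr p * B" if "0 < p" for p B :: real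
      using r that by (auto intro!: derivative_eq_intros)
    have 1: "DERIV (\<lambda>r. r\<^sup>2 / 2 * A) r :> r * A" for A :: real
      by (auto intro!: derivative_eq_intros)
    show "DERIV (\<lambda>r. r\<^sup>2 / 2 * ?A + r powr (\<alpha> + 1) / (\<alpha> + 1) * ?B - r powr (\<beta> + 1) / (\<beta> + 1) * ?C) r
        :> r * ?A + r powr \<alpha> * ?B - r powr \<beta> * ?C"
      by (intro DERIV_add DERIV_diff 1 2 assms)
  qed (simp add: fibering_eq[OF assms(1,2)])
  note * = this
  show ?thesis
  proof (rule DERIV_imp_deriv, rule has_field_derivative_transform_within_open[OF _ open_greaterThan])
    have 2: "DERIV (\<lambda>r. r powr p * B) 1 :> p * B" for p B :: real
      by (auto intro!: derivative_eq_intros)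
    have 1: "DERIV (\<lambda>r. r * A) 1 :> A" for A :: real
      by (auto intro!: derivative_eq_intros)
    show "DERIV (\<lambda>r. r * ?A + r powr \<alpha> * ?B - r powr \<beta> * ?C) 1 :> ?A + \<alpha> * ?B - \<beta> * ?C"
      by (intro DERIV_add DERIV_diff 1 2)
    show "r * ?A + r powr \<alpha> * ?B - r powr \<beta> * ?C = deriv (fibering \<Omega> \<alpha> \<beta> lam u) r" if "r \<in> {0<..}" for r
      using *[OF that] by simp
  qed simp
qed

text \<open>This is the origin of \<open>discr\<close>: it is the coefficient left at A when B and C
  are eliminated by the Nehari and Pohozaev relations. Writing B = (\<alpha> + 1) b and C = (\<beta>
  + 1) c clears the denominators.\<close>

lemma second_fibering_derivative_discr:
  fixes A B C \<alpha> \<beta> :: real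
  assumes "0 < \<alpha>" "0 < \<beta>" and "A + B = C"
  shows "2 * real N * (A + \<alpha> * B - \<beta> * C)
    = 2 * (1 + \<alpha>) * (1 + \<beta>) * ((2 - real N) / 2 * A - real N * (B / (\<alpha> + 1) - C / (\<beta> + 1))) - A * discr N \<alpha> \<beta>"
proof -
  define b c where "b = B / (\<alpha> + 1)" and "c = C / (\<beta> + 1)"
  have B: "B = (\<alpha> + 1) * b" and C: "C = (\<beta> + 1) * c"
    using assms(1,2) by (simp_all add: b_def c_def)
  have A: "A = (\<beta> + 1) * c - (\<alpha> + 1) * b"
    using assms(3) B C by simp
  show ?thesis
    unfolding b_def[symmetric] c_def[symmetric] unfolding A B C by (simp add: discr_def field_simps)
qed

lemma gradient_pos_if_pohozaev:
  fixes \<Omega> :: "'a::euclidean_space set"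
  assumes "bounded \<Omega>" and u: "weak_solution \<Omega> \<alpha> \<beta> lam u" and "nonzero_on \<Omega> u"
    and \<alpha>: "0 < \<alpha>" "\<alpha> < \<beta>" "\<beta> \<le> 1"
  defines "A \<equiv> LINT x:\<Omega>|lebesgue. (norm (wgrad \<Omega> u x))\<^sup>2"
    and "B \<equiv> LINT x:\<Omega>|lebesgue. \<bar>u x\<bar> powr (\<alpha> + 1)"
    and "C \<equiv> lam * (LINT x:\<Omega>|lebesgue. \<bar>u x\<bar> powr (\<beta> + 1))"
  assumes P: "0 \<le> (2 - real DIM('a)) / 2 * A - real DIM('a) * (B / (\<alpha> + 1) - C / (\<beta> + 1))"
  shows "0 < A"
proof (rule ccontr)
  assume "\<not> 0 < A"
  moreover have "0 \<le> A" and "0 \<le> B"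
    unfolding A_def B_def set_integral_extension_powr_norm by auto
  ultimately have "A = 0" and "C = B"
    using weak_solution_nehari[OF u] by (auto simp: A_def B_def C_def)
  \<comment> \<open>With A = 0 and B = C this is the coefficient of B in the Pohozaev relation; it
    is positive since \<alpha> < \<beta>.\<close>
  have "0 < 1 / (\<alpha> + 1) - 1 / (\<beta> + 1)"
    using \<alpha> frac_less2[of 1 1 "\<alpha> + 1" "\<beta> + 1"] by simp
  moreover have "real DIM('a) * (B * (1 / (\<alpha> + 1) - 1 / (\<beta> + 1))) \<le> 0"
    using P \<open>A = 0\<close> \<open>C = B\<close> by (simp add: right_diff_distrib)
  ultimately have "B = 0"
    using \<open>0 \<le> B\<close> by (auto simp: mult_le_0_iff)
  let ?U = "\<lambda>x. indicator \<Omega> x *\<^sub>R u x"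
  have "L2_on \<Omega> u"
    using u by (simp add: weak_solution_def H1_0_def H1_def)
  then have "L2_on UNIV ?U"
    by (simp only: L2_on_iff_extension[of \<Omega> u])
  then have "integrable lebesgue (\<lambda>x. \<bar>?U x\<bar> powr (\<alpha> + 1))"
    using \<alpha> by (intro integrable_powr[OF _ assms(1)]) (auto simp: indicator_def)
  then have "AE x in lebesgue. \<bar>?U x\<bar> powr (\<alpha> + 1) = 0"
    using \<open>B = 0\<close> unfolding B_def set_integral_extension_powr_norm
    by (subst (asm) integral_nonneg_eq_0_iff_AE) auto
  then have "AE x in lebesgue. x \<in> \<Omega> \<longrightarrow> u x = 0"
    by eventually_elim (auto simp: indicator_def)
  then show False
    using assms(3) by (simp add: nonzero_on_def)
qed

section \<open>Flat solutions solve the equation across the boundary\<close>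

text \<open>V is bounded, being continuous on the compact closure, and integration by parts against
  test functions supported inside \<Omega> makes it a weak gradient. This identifies
  \<open>wgrad\<close> with V almost everywhere.\<close>

lemma C1_closure_rep_weak_gradient:
  fixes u :: "'a::euclidean_space \<Rightarrow> real"
  assumes "open \<Omega>" and "bounded \<Omega>" and L2u: "L2_on \<Omega> u" and rep: "C1_closure_rep \<Omega> u v V"
  shows "L2_on \<Omega> V" and "is_weak_gradient \<Omega> u V"
proof -
  have ae: "AE x in lebesgue. x \<in> \<Omega> \<longrightarrow> u x = v x" and cV: "continuous_on (closure \<Omega>) V" and der: "\<And>x. x \<in> \<Omega> \<Longrightarrow> GDERIV v x :> V x"
    using rep by (auto simp: C1_closure_rep_def)
  have cV\<Omega>: "continuous_on \<Omega> V"
    using cV closure_subset continuous_on_subset by blast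
  have "compact (V ` closure \<Omega>)"
    using assms(2) by (intro compact_continuous_image cV) auto
  then obtain B where "\<And>x. x \<in> closure \<Omega> \<Longrightarrow> norm (V x) \<le> B"
    using compact_imp_bounded by (fastforce simp: bounded_iff)
  then have B: "norm (indicator \<Omega> x *\<^sub>R V x) \<le> max 0 B" for x
    using closure_subset[of \<Omega>] by (auto simp: indicator_def le_max_iff_disj)
  show "L2_on \<Omega> V"
    unfolding L2_on_iff_extension[of \<Omega>]
  proof (rule L2_bounded_support[OF _ assms(2) _ B])
    show "(\<lambda>x. indicator \<Omega> x *\<^sub>R V x) \<in> borel_measurable lebesgue"
      using borel_measurable_continuous_on_indicator[OF _ cV\<Omega>] assms(1)
      by (intro measurable_completion) simp
  qed auto
  show "is_weak_gradient \<Omega> u V"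
    unfolding is_weak_gradient_def
  proof
    fix \<phi> assume \<phi>: "\<phi> \<in> C1c \<Omega>"
    have C1v: "C1_on \<Omega> v"
      by (rule C1_onI[OF der cV\<Omega>])
    have "(LINT x:\<Omega>|lebesgue. u x *\<^sub>R grad \<phi> x) = (LINT x:\<Omega>|lebesgue. v x *\<^sub>R grad \<phi> x)"
      unfolding set_lebesgue_integral_def
    proof (rule integral_cong_AE)
      show "AE x in lebesgue. indicator \<Omega> x *\<^sub>R u x *\<^sub>R grad \<phi> x = indicator \<Omega> x *\<^sub>R v x *\<^sub>R grad \<phi> x"
        using ae by eventually_elim (auto simp: indicator_def)
      show "(\<lambda>x. indicator \<Omega> x *\<^sub>R u x *\<^sub>R grad \<phi> x) \<in> borel_measurable lebesgue"
        using borel_measurable_scaleR[OF L2_on_UNIV_D(1) L2_on_UNIV_D(1)[OF L2_C1c(2)[OF C1c_mono[OF \<phi> subset_UNIV]]]]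
          L2u[unfolded L2_on_iff_extension[of \<Omega>]] by simp
    qed (rule borel_measurable_integrable[OF integral_grad_by_parts(2)[OF assms(1) \<phi> C1v]])
    also have "\<dots> = - (LINT x:\<Omega>|lebesgue. \<phi> x *\<^sub>R grad v x)"
      using integral_grad_by_parts(3)[OF assms(1) \<phi> C1v] by simp
    also have "(LINT x:\<Omega>|lebesgue. \<phi> x *\<^sub>R grad v x) = (LINT x:\<Omega>|lebesgue. \<phi> x *\<^sub>R V x)"
      unfolding set_lebesgue_integral_def using grad_eqI[OF der]
      by (intro Bochner_Integration.integral_cong) (auto simp: indicator_def)
    finally show "(LINT x:\<Omega>|lebesgue. u x *\<^sub>R grad \<phi> x) = - (LINT x:\<Omega>|lebesgue. \<phi> x *\<^sub>R V x)" .
  qed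
qed

text \<open>The equation in linear form, with u inserted into the nonlinear terms: \<open>F\<close>
  is their sum and \<open>G\<close> the gradient, both extended by zero.\<close>

locale weak_equation =
  fixes \<Omega> :: "'a::euclidean_space set" and G :: "'a \<Rightarrow> 'a" and F :: "'a \<Rightarrow> real"
  assumes open_domain: "open \<Omega>" and bounded_domain: "bounded \<Omega>"
    and L2G: "L2_on UNIV G" and L2F: "L2_on UNIV F"
    and G0: "\<And>x. x \<notin> \<Omega> \<Longrightarrow> G x = 0" and F0: "\<And>x. x \<notin> \<Omega> \<Longrightarrow> F x = 0"
    and weak: "\<And>\<phi>. \<phi> \<in> C1c \<Omega> \<Longrightarrow> (\<integral>x. G x \<bullet> grad \<phi> x + F x * \<phi> x \<partial>lebesgue) = 0"
begin

lemma weak_integrable: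
  assumes "\<phi> \<in> C1c UNIV"
  shows "integrable lebesgue (\<lambda>x. G x \<bullet> grad \<phi> x + F x * \<phi> x)"
  by (intro Bochner_Integration.integrable_add L2_inner_integrable L2_mult_integrable L2G L2F L2_C1c assms)

text \<open>\<phi> is multiplied by a cut-off vanishing near the boundary, which is then removed in
  the limit. The gradient of the cut-off is parallel to grad \<rho>, so it meets only the component
  of V that vanishes at the boundary.\<close>

lemma weak_equation_near_boundary:
  assumes p: "p \<in> frontier \<Omega>" and \<rho>: "local_defining_function \<Omega> p W \<rho>"
    and V: "continuous_on (closure \<Omega>) V" and GV: "AE x in lebesgue. x \<in> \<Omega> \<longrightarrow> G x = V x"
    and V\<nu>: "\<And>x \<nu>. outward_unit_normal \<Omega> x \<nu> \<Longrightarrow> V x \<bullet> \<nu> = 0"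
  obtains r where "0 < r" and "\<And>\<phi>. \<phi> \<in> C1c UNIV \<Longrightarrow> (\<And>x. x \<notin> cball p r \<Longrightarrow> \<phi> x = 0) \<Longrightarrow>
    (\<integral>x. G x \<bullet> grad \<phi> x + F x * \<phi> x \<partial>lebesgue) = 0"
proof -
  have W: "open W" "p \<in> W" and C1\<rho>: "C1_on W \<rho>" and ne: "\<And>y. y \<in> W \<Longrightarrow> grad \<rho> y \<noteq> 0"
    and \<Omega>W: "\<Omega> \<inter> W = {y \<in> W. \<rho> y < 0}"
    using \<rho> by (auto simp: local_defining_function_def)
  have c\<rho>: "continuous_on W \<rho>" and cg\<rho>: "continuous_on W (grad \<rho>)"
    using C1_on_imp_continuous_on[OF C1\<rho>] C1\<rho> by (auto simp: C1_on_def)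
  define e where "e = grad \<rho> p"
  \<comment> \<open>Half the value of grad \<rho> . e at p. By continuity grad \<rho> . e > c
    persists near p, so \<rho> grows at a definite rate in the direction e.\<close>
  define c where "c = (e \<bullet> e) / 2"
  have c0: "0 < c" and c_less: "c < grad \<rho> p \<bullet> e"
    using ne[OF W(2)] by (auto simp: c_def e_def)
  have "open {x \<in> W. c < grad \<rho> x \<bullet> e}"
    using continuous_open_preimage[OF continuous_on_inner[OF cg\<rho> continuous_on_const] W(1) open_greaterThan, of e c]
    by (simp add: vimage_def Int_def)
  then obtain r' where r': "0 < r'" "cball p r' \<subseteq> {x \<in> W. c < grad \<rho> x \<bullet> e}"
    using open_contains_cball c_less W(2) by (metis (mono_tags, lifting) mem_Collect_eq)
  \<comment> \<open>Two radii: \<phi> lives in the ball of radius r, its C1 majorant \<psi> in the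
    ball of radius r'.\<close>
  define r where "r = r' / 2"
  have r: "0 < r" "r < r'"
    using r'(1) by (auto simp: r_def)
  have rW: "cball p r \<subseteq> W" and r'W: "cball p r' \<subseteq> W" and cpos: "\<And>x. x \<in> cball p r' \<Longrightarrow> c < grad \<rho> x \<bullet> e"
    using r'(2) r by (auto simp: subset_iff)
  \<comment> \<open>The part of the ball where |V . grad \<rho>| \<ge> \<delta> is compact and
    \<rho> is negative on it, hence bounded away from 0.\<close>
  have layer: "\<exists>m>0. \<forall>x \<in> \<Omega> \<inter> cball p r. - m < \<rho> x \<longrightarrow> \<bar>V x \<bullet> grad \<rho> x\<bar> < \<delta>" if \<delta>: "0 < \<delta>" for \<delta>
  proof -
    let ?S = "{x \<in> closure \<Omega> \<inter> cball p r. \<delta> \<le> \<bar>V x \<bullet> grad \<rho> x\<bar>}"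
    have cl: "closed (closure \<Omega> \<inter> cball p r)"
      by auto
    have "continuous_on (closure \<Omega> \<inter> cball p r) (\<lambda>x. \<bar>V x \<bullet> grad \<rho> x\<bar>)"
      using rW by (intro continuous_intros continuous_on_subset[OF V] continuous_on_subset[OF cg\<rho>]) auto
    from continuous_closed_preimage[OF this cl closed_atLeast, of \<delta>]
    have "closed ?S"
      by (simp add: vimage_def Int_def)
    moreover have "bounded ?S"
      by (rule bounded_subset[OF bounded_cball[of p r]]) auto
    ultimately have "compact ?S"
      by (simp only: compact_eq_bounded_closed)
    moreover have "continuous_on ?S \<rho>"
      using rW by (intro continuous_on_subset[OF c\<rho>]) auto
    \<comment> \<open>If \<rho> \<ge> 0, the point lies on the boundary. \<open>W\<close> and \<rho>
      form a local defining function there too, so the normal is a multiple of grad \<rho> and V .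
      grad \<rho> = 0 < \<delta>.\<close>
    moreover have neg: "\<rho> x < 0" if x: "x \<in> ?S" for x
    proof (rule ccontr)
      assume "\<not> \<rho> x < 0"
      have xW: "x \<in> W"
        using x rW by auto
      then have "x \<notin> \<Omega>"
        using \<Omega>W \<open>\<not> \<rho> x < 0\<close> by auto
      then have "x \<in> frontier \<Omega>"
        using x open_domain by (auto simp: frontier_def interior_open)
      moreover have "local_defining_function \<Omega> x W \<rho>"
        using \<rho> xW by (simp add: local_defining_function_def)
      ultimately have "V x \<bullet> (grad \<rho> x /\<^sub>R norm (grad \<rho> x)) = 0"
        by (intro V\<nu>) (auto simp: outward_unit_normal_def)
      then have "V x \<bullet> grad \<rho> x = 0"
        using ne[OF xW] by simp
      then show False
        using x \<delta> by auto
    qed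
    ultimately have "\<exists>m>0. \<forall>x\<in>?S. \<rho> x \<le> - m"
    proof (cases "?S = {}")
      case False
      then obtain y where y: "y \<in> ?S" "\<forall>x\<in>?S. \<rho> x \<le> \<rho> y"
        using continuous_attains_sup[OF \<open>compact ?S\<close> False \<open>continuous_on ?S \<rho>\<close>] by blast
      then show ?thesis
        using neg[OF y(1)] by (intro exI[of _ "- \<rho> y"]) auto
    qed (auto intro: exI[of _ 1])
    then show ?thesis
      using closure_subset[of \<Omega>] by (fastforce simp: not_le)
  qed
  show ?thesis
  proof (rule that[OF r(1)])
    fix \<phi> :: "'a \<Rightarrow> real" assume \<phi>: "\<phi> \<in> C1c UNIV" and \<phi>0: "\<And>x. x \<notin> cball p r \<Longrightarrow> \<phi> x = 0"
    have C1\<phi>: "C1_on UNIV \<phi>"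
      by (rule C1c_imp_C1[OF \<phi>])
    obtain B where B0: "0 \<le> B" and B: "\<And>x. norm (\<phi> x) \<le> B"
      using continuous_bounded_support[OF C1_on_imp_continuous_on[OF C1\<phi>] bounded_cball \<phi>0] by metis
    \<comment> \<open>The factor makes \<psi> \<ge> B on the smaller ball. A majorant is used
      because |\<phi>| need not be C1 and \<psi> is to be integrated by parts.\<close>
    define \<psi> where "\<psi> x = B / (r'\<^sup>2 - r\<^sup>2)\<^sup>2 * pos_sq (r'\<^sup>2 - (norm (x - p))\<^sup>2)" for x
    have \<psi>: "\<psi> \<in> C1c W"
    proof -
      have "(\<lambda>x. pos_sq (r'\<^sup>2 - (norm (x - p))\<^sup>2) * (B / (r'\<^sup>2 - r\<^sup>2)\<^sup>2)) \<in> C1c W"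
        by (intro C1c_mult C1c_ball_bump r'(1) r'W C1_on_const)
      then show ?thesis
        by (simp add: \<psi>_def[abs_def] mult.commute)
    qed
    have rr: "0 < r'\<^sup>2 - r\<^sup>2"
      using r by (simp add: power_strict_mono)
    have \<phi>\<psi>: "\<bar>\<phi> x\<bar> \<le> \<psi> x" for x
    proof (cases "x \<in> cball p r")
      case True
      then have "(norm (x - p))\<^sup>2 \<le> r\<^sup>2"
        by (intro power_mono) (auto simp: dist_norm norm_minus_commute)
      then have "(r'\<^sup>2 - r\<^sup>2)\<^sup>2 \<le> pos_sq (r'\<^sup>2 - (norm (x - p))\<^sup>2)"
        using rr unfolding pos_sq_def by (intro power_mono) auto
      then have "B / (r'\<^sup>2 - r\<^sup>2)\<^sup>2 * (r'\<^sup>2 - r\<^sup>2)\<^sup>2 \<le> \<psi> x"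
        unfolding \<psi>_def by (intro mult_left_mono) (auto simp: B0)
      then show ?thesis
        using B[of x] rr by simp
    next
      case False
      then show ?thesis
        using \<phi>0[OF False] B0 by (simp add: \<psi>_def pos_sq_nonneg)
    qed
    have \<psi>0: "\<psi> x = 0" if "x \<notin> cball p r'" for x
    proof -
      have "r'\<^sup>2 \<le> (norm (x - p))\<^sup>2"
        using that r'(1) by (intro power_mono) (auto simp: dist_norm norm_minus_commute)
      then show ?thesis
        by (simp add: \<psi>_def pos_sq_def)
    qed
    \<comment> \<open>The error made by the cut-off \<open>\<eta> \<epsilon>\<close> is small because \<open>V \<bullet> grad \<rho>\<close> is small where \<open>grad (\<eta> \<epsilon>)\<close> lives,
      while an integration by parts in the direction \<open>e\<close> bounds the integral of \<open>\<psi> \<bar>grad (\<eta> \<epsilon>)\<bar>\<close>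
      uniformly in \<open>\<epsilon>\<close>, since \<open>\<rho>\<close> increases in that direction.\<close>
    define \<eta> where "\<eta> \<epsilon> x = step (- \<rho> x / \<epsilon> - 1)" for \<epsilon> x
    have grad\<eta>: "GDERIV (\<eta> \<epsilon>) x :> - (step_deriv (- \<rho> x / \<epsilon> - 1) / \<epsilon>) *\<^sub>R grad \<rho> x" if "x \<in> W" for \<epsilon> x
    proof -
      have "GDERIV (\<lambda>x. step (\<rho> x * (- 1 / \<epsilon>) - 1)) x :>
          step_deriv (\<rho> x * (- 1 / \<epsilon>) - 1) *\<^sub>R (\<rho> x *\<^sub>R 0 + (- 1 / \<epsilon>) *\<^sub>R grad \<rho> x - 0)"
        by (rule GDERIV_DERIV_compose[where f = "\<lambda>x. \<rho> x * (- 1 / \<epsilon>) - 1" and g = step,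
              OF GDERIV_diff[OF GDERIV_mult[OF C1_onD[OF C1\<rho> that] GDERIV_const] GDERIV_const] DERIV_step])
      then show ?thesis
        by (simp add: \<eta>_def[abs_def])
    qed
    have C1\<eta>: "C1_on W (\<eta> \<epsilon>)" for \<epsilon>
    proof -
      have "C1_on W (\<lambda>x. step (\<rho> x * (- 1 / \<epsilon>) - 1))"
        by (intro C1_on_step C1_on_diff C1_on_mult C1_on_const C1\<rho>)
      then show ?thesis
        by (simp add: \<eta>_def[abs_def])
    qed
    have \<eta>_le: "0 \<le> \<eta> \<epsilon> x" "\<eta> \<epsilon> x \<le> 1" for \<epsilon> x
      by (auto simp: \<eta>_def step_nonneg step_le_1)
    define \<zeta> where "\<zeta> \<epsilon> x = (if x \<in> W then \<phi> x * \<eta> \<epsilon> x else 0)" for \<epsilon> x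
    note ext = C1_on_extend_by_0[OF W(1) C1_on_mult[OF C1_on_subset[OF C1\<phi> subset_UNIV] C1\<eta>] compact_cball rW]
    have C1\<zeta>: "C1_on UNIV (\<zeta> \<epsilon>)" for \<epsilon>
      unfolding \<zeta>_def[abs_def] using \<phi>0 by (intro ext(1)) auto
    have grad\<zeta>: "grad (\<zeta> \<epsilon>) x = \<phi> x *\<^sub>R grad (\<eta> \<epsilon>) x + \<eta> \<epsilon> x *\<^sub>R grad \<phi> x" if "x \<in> W" for \<epsilon> x
    proof -
      have "grad (\<zeta> \<epsilon>) x = grad (\<lambda>x. \<phi> x * \<eta> \<epsilon> x) x"
        unfolding \<zeta>_def[abs_def] using \<phi>0 that by (intro ext(2)) auto
      then show ?thesis
        by (simp add: grad_mult[OF C1_on_subset[OF C1\<phi> subset_UNIV] C1\<eta> that])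
    qed
    \<comment> \<open>Owing to the shift by -1 the cut-off vanishes where \<rho> \<ge> -\<epsilon>,
      so the support stays at a distance from the boundary.\<close>
    have \<zeta>: "\<zeta> \<epsilon> \<in> C1c \<Omega>" if \<epsilon>: "0 < \<epsilon>" for \<epsilon>
    proof (rule C1c_I[OF C1\<zeta>])
      have "closed (cball p r \<inter> \<rho> -` {..- \<epsilon>})"
        by (intro continuous_closed_preimage continuous_on_subset[OF c\<rho> rW]) auto
      then show "compact (cball p r \<inter> \<rho> -` {..- \<epsilon>})"
        using compact_Int_closed[OF compact_cball, of "cball p r \<inter> \<rho> -` {..- \<epsilon>}" p r] by (simp add: Int_assoc[symmetric])
      show "cball p r \<inter> \<rho> -` {..- \<epsilon>} \<subseteq> \<Omega>"
        using rW \<Omega>W \<epsilon> by auto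
      show "\<zeta> \<epsilon> x = 0" if "x \<notin> cball p r \<inter> \<rho> -` {..- \<epsilon>}" for x
      proof (cases "x \<in> cball p r")
        case True
        then have "- \<rho> x / \<epsilon> - 1 \<le> 0"
          using that \<epsilon> by (auto simp: field_simps)
        then show ?thesis
          by (simp add: \<zeta>_def \<eta>_def step_eq_0)
      qed (simp add: \<zeta>_def \<phi>0)
    qed
    define f where "f x = G x \<bullet> grad \<phi> x + F x * \<phi> x" for x
    have if_: "integrable lebesgue f"
      unfolding f_def by (rule weak_integrable[OF \<phi>])
    have f0: "f x = 0" if "x \<notin> \<Omega> \<inter> W" for x
    proof (cases "x \<in> \<Omega>")
      case True
      have "closure {x. \<phi> x \<noteq> 0} \<subseteq> cball p r"
        using \<phi>0 by (intro closure_minimal closed_cball) blast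
      moreover have x: "x \<notin> cball p r"
        using that True rW by blast
      ultimately have "grad \<phi> x = 0"
        by (intro grad_eq_0_off_support) blast
      moreover have "\<phi> x = 0"
        by (rule \<phi>0[OF x])
      ultimately show ?thesis
        by (simp add: f_def)
    qed (simp add: f_def G0 F0)
    \<comment> \<open>The product rule term: the difference between the integrand for the cut-off
      test function and the cut-off times the integrand for \<phi>.\<close>
    define g where "g \<epsilon> x = indicator W x * (\<phi> x * (G x \<bullet> grad (\<eta> \<epsilon>) x))" for \<epsilon> x
    have split: "G x \<bullet> grad (\<zeta> \<epsilon>) x + F x * \<zeta> \<epsilon> x = indicator W x * \<eta> \<epsilon> x * f x + g \<epsilon> x" if "0 < \<epsilon>" for \<epsilon> x
    proof (cases "x \<in> W")
      case True
      then show ?thesis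
        by (simp add: grad\<zeta> f_def g_def inner_add_right algebra_simps) (simp add: \<zeta>_def)
    next
      case False
      have "closure {x. \<zeta> \<epsilon> x \<noteq> 0} \<subseteq> cball p r"
        using \<phi>0 by (intro closure_minimal closed_cball) (auto simp: \<zeta>_def simp del: mem_cball)
      then have "grad (\<zeta> \<epsilon>) x = 0"
        using False rW by (auto intro!: grad_eq_0_off_support)
      then show ?thesis
        using False by (simp add: g_def \<zeta>_def)
    qed
    have im: "integrable lebesgue (\<lambda>x. indicator W x * \<eta> \<epsilon> x * f x)" for \<epsilon>
    proof -
      have "(\<lambda>x. indicator W x *\<^sub>R \<eta> \<epsilon> x) \<in> borel_measurable lebesgue"
        using borel_measurable_continuous_on_indicator[OF _ C1_on_imp_continuous_on[OF C1\<eta>]] W(1)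
        by (intro measurable_completion) simp
      then have "(\<lambda>x. indicator W x * \<eta> \<epsilon> x * f x) \<in> borel_measurable lebesgue"
        using borel_measurable_times[OF _ borel_measurable_integrable[OF if_]] by simp
      then show ?thesis
        using \<eta>_le[of \<epsilon>]
        by (intro Bochner_Integration.integrable_bound[OF if_] AE_I2)
          (auto simp: indicator_def abs_mult intro!: mult_left_le_one_le)
    qed
    have ig: "integrable lebesgue (g \<epsilon>)" if "0 < \<epsilon>" for \<epsilon>
    proof -
      have "integrable lebesgue (\<lambda>x. (G x \<bullet> grad (\<zeta> \<epsilon>) x + F x * \<zeta> \<epsilon> x) - indicator W x * \<eta> \<epsilon> x * f x)"
        by (intro Bochner_Integration.integrable_diff im weak_integrable C1c_mono[OF \<zeta>[OF that]] subset_UNIV)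
      then show ?thesis
        by (simp add: split[OF that])
    qed
    have eq: "(\<integral>x. indicator W x * \<eta> \<epsilon> x * f x \<partial>lebesgue) = - (\<integral>x. g \<epsilon> x \<partial>lebesgue)" if "0 < \<epsilon>" for \<epsilon>
      using weak[OF \<zeta>[OF that]] im[of \<epsilon>] ig[OF that] by (simp add: split[OF that])
    define h where "h n = inverse (real (Suc n))" for n
    have h0: "0 < h n" for n
      by (simp add: h_def)
    have hlim: "h \<longlonglongrightarrow> 0"
      unfolding h_def by (rule LIMSEQ_inverse_real_of_nat)
    have lim: "(\<lambda>n. \<integral>x. indicator W x * \<eta> (h n) x * f x \<partial>lebesgue) \<longlonglongrightarrow> (\<integral>x. f x \<partial>lebesgue)"
    proof (rule integral_dominated_convergence[where w = "\<lambda>x. \<bar>f x\<bar>"])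
      show "AE x in lebesgue. (\<lambda>n. indicator W x * \<eta> (h n) x * f x) \<longlonglongrightarrow> f x"
      proof (rule AE_I2)
        fix x
        show "(\<lambda>n. indicator W x * \<eta> (h n) x * f x) \<longlonglongrightarrow> f x"
        proof (cases "x \<in> \<Omega> \<inter> W")
          case True
          then have "0 < - \<rho> x / 2"
            using \<Omega>W by auto
          then have "\<forall>\<^sub>F n in sequentially. h n < - \<rho> x / 2"
            using hlim by (rule order_tendstoD(2)[rotated])
          then have "\<forall>\<^sub>F n in sequentially. indicator W x * \<eta> (h n) x * f x = f x"
          proof eventually_elim
            case (elim n)
            then have "1 \<le> - \<rho> x / h n - 1"
              using h0[of n] by (simp add: field_simps)
            then show ?case
              using True by (simp add: \<eta>_def step_eq_1)
          qed
          then show ?thesis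
            by (rule tendsto_eventually)
        qed (simp add: f0)
      qed
      show "AE x in lebesgue. norm (indicator W x * \<eta> (h n) x * f x) \<le> \<bar>f x\<bar>" for n
        using \<eta>_le[of "h n"] by (intro AE_I2) (auto simp: indicator_def abs_mult intro!: mult_left_le_one_le)
    qed (use if_ im borel_measurable_integrable in auto)
    \<comment> \<open>Since 0 \<le> \<eta> \<le> 1, this bounds the integral of \<eta> (grad \<psi>
      . e) independently of \<epsilon>.\<close>
    define D where "D = (\<integral>x. \<bar>grad \<psi> x \<bullet> e\<bar> \<partial>lebesgue)"
    have iD: "integrable lebesgue (\<lambda>x. \<bar>grad \<psi> x \<bullet> e\<bar>)"
    proof -
      have "integrable lebesgue (grad \<psi>)"
        using C1c_E[OF \<psi>] integrable_lebesgue_continuous_bounded_support compact_imp_bounded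
        by (metis C1_on_def)
      then show ?thesis
        by (intro integrable_abs integrable_inner_left)
    qed
    have D0: "0 \<le> D"
      by (simp add: D_def)
    have g_small: "\<bar>\<integral>x. g \<epsilon> x \<partial>lebesgue\<bar> \<le> \<delta> / c * D"
      if \<epsilon>: "0 < \<epsilon>" and \<delta>: "0 < \<delta>" and m: "2 * \<epsilon> < m"
        "\<And>x. x \<in> \<Omega> \<inter> cball p r \<Longrightarrow> - m < \<rho> x \<Longrightarrow> \<bar>V x \<bullet> grad \<rho> x\<bar> < \<delta>" for \<epsilon> \<delta> m
    proof -
      note parts = integral_grad_by_parts[OF W(1) \<psi> C1\<eta>[of \<epsilon>]]
      let ?k = "\<lambda>x. (indicator W x *\<^sub>R \<psi> x *\<^sub>R grad (\<eta> \<epsilon>) x) \<bullet> e"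
      have ik: "integrable lebesgue ?k"
        by (rule integrable_inner_left[OF parts(1)])
      have ae: "AE x in lebesgue. \<bar>g \<epsilon> x\<bar> \<le> - (\<delta> / c) * ?k x"
        using GV
      proof eventually_elim
        case (elim x)
        show ?case
        proof (cases "x \<in> cball p r'")
          case True
          then have xW: "x \<in> W"
            using r'W by auto
          define s where "s = step_deriv (- \<rho> x / \<epsilon> - 1) / \<epsilon>"
          have s0: "0 \<le> s"
            using \<epsilon> by (simp add: s_def step_deriv_nonneg)
          have gr: "grad (\<eta> \<epsilon>) x = - s *\<^sub>R grad \<rho> x"
            unfolding s_def by (rule grad_eqI[OF grad\<eta>[OF xW]])
          \<comment> \<open>As grad \<eta> = -s grad \<rho> and grad \<rho> . e > c, the integrand
            \<open>?k\<close> is at most -c \<psi> s.\<close>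
          have k: "\<delta> * \<psi> x * s \<le> - (\<delta> / c) * ?k x"
          proof -
            have "\<delta> / c * (\<psi> x * s) * c \<le> \<delta> / c * (\<psi> x * s) * (grad \<rho> x \<bullet> e)"
              using cpos[OF True] c0 \<delta> s0 \<phi>\<psi>[of x] by (intro mult_left_mono mult_nonneg_nonneg) auto
            then show ?thesis
              using c0 xW by (simp add: gr algebra_simps)
          qed
          have "\<bar>g \<epsilon> x\<bar> = \<bar>\<phi> x\<bar> * s * \<bar>G x \<bullet> grad \<rho> x\<bar>"
            using xW s0 by (simp add: g_def gr abs_mult)
          also have "\<dots> \<le> \<bar>\<phi> x\<bar> * s * \<delta>"
          proof (cases "s = 0 \<or> \<phi> x = 0 \<or> x \<notin> \<Omega>")
            case True
            then show ?thesis
              using s0 \<delta> G0[of x] by auto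
          next
            case False
            \<comment> \<open>\<open>step_deriv\<close> vanishes outside (0, 1), so s \<noteq> 0
              forces -2 \<epsilon> < \<rho> < -\<epsilon>.\<close>
            then have "\<not> (- \<rho> x / \<epsilon> - 1 \<le> 0 \<or> 1 \<le> - \<rho> x / \<epsilon> - 1)"
              using step_deriv_eq_0 by (auto simp: s_def)
            then have "- m < \<rho> x"
              using \<epsilon> m(1) by (simp add: field_simps)
            moreover have "x \<in> \<Omega> \<inter> cball p r"
              using False \<phi>0 by blast
            ultimately have "\<bar>G x \<bullet> grad \<rho> x\<bar> \<le> \<delta>"
              using m(2)[of x] elim by auto
            then show ?thesis
              using s0 by (intro mult_left_mono) auto
          qed
          also have "\<dots> \<le> \<psi> x * s * \<delta>"
            using s0 \<delta> \<phi>\<psi> by (intro mult_right_mono) auto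
          finally show ?thesis
            using k by (simp add: mult_ac)
        next
          case False
          then show ?thesis
            using \<psi>0[OF False] \<phi>0[of x] r by (auto simp: g_def)
        qed
      qed
      have "\<bar>\<integral>x. g \<epsilon> x \<partial>lebesgue\<bar> \<le> (\<integral>x. \<bar>g \<epsilon> x\<bar> \<partial>lebesgue)"
        by (rule integral_abs_bound)
      also have "\<dots> \<le> (\<integral>x. - (\<delta> / c) * ?k x \<partial>lebesgue)"
        using ig[OF \<epsilon>] by (intro integral_mono_AE[OF _ _ ae] integrable_mult_right ik) auto
      also have "\<dots> = - (\<delta> / c) * (\<integral>x. ?k x \<partial>lebesgue)"
        by (rule integral_mult_right_zero)
      also have "(\<integral>x. ?k x \<partial>lebesgue) = (LINT x:W|lebesgue. \<psi> x *\<^sub>R grad (\<eta> \<epsilon>) x) \<bullet> e"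
        unfolding set_lebesgue_integral_def by (rule integral_inner_left[OF parts(1)])
      also have "\<dots> = - (\<integral>x. (indicator W x *\<^sub>R \<eta> \<epsilon> x *\<^sub>R grad \<psi> x) \<bullet> e \<partial>lebesgue)"
        unfolding parts(3) unfolding set_lebesgue_integral_def
        by (simp only: inner_minus_left integral_inner_left[OF parts(2)])
      also have "- (\<delta> / c) * \<dots> = \<delta> / c * (\<integral>x. (indicator W x *\<^sub>R \<eta> \<epsilon> x *\<^sub>R grad \<psi> x) \<bullet> e \<partial>lebesgue)"
        by simp
      also have "\<dots> \<le> \<delta> / c * D"
      proof -
        have "(indicator W x *\<^sub>R \<eta> \<epsilon> x *\<^sub>R grad \<psi> x) \<bullet> e \<le> \<bar>grad \<psi> x \<bullet> e\<bar>" for x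
        proof -
          have "\<bar>\<eta> \<epsilon> x * (grad \<psi> x \<bullet> e)\<bar> \<le> \<bar>grad \<psi> x \<bullet> e\<bar>"
            using \<eta>_le[of \<epsilon> x] by (auto simp: abs_mult intro!: mult_left_le_one_le)
          then show ?thesis
            by (auto simp: indicator_def)
        qed
        then have "(\<integral>x. (indicator W x *\<^sub>R \<eta> \<epsilon> x *\<^sub>R grad \<psi> x) \<bullet> e \<partial>lebesgue) \<le> D"
          unfolding D_def by (intro integral_mono integrable_inner_left parts(2) iD)
        then show ?thesis
          using \<delta> c0 by (intro mult_left_mono) auto
      qed
      finally show ?thesis .
    qed
    have "(\<lambda>n. \<integral>x. g (h n) x \<partial>lebesgue) \<longlonglongrightarrow> 0"
    proof (rule LIMSEQ_I)
      fix E :: real assume E: "0 < E"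
      \<comment> \<open>D + 1 in place of D covers D = 0 and keeps the final estimate
        strict.\<close>
      define \<delta> where "\<delta> = c * E / (D + 1)"
      have \<delta>: "0 < \<delta>"
        using c0 E D0 by (simp add: \<delta>_def)
      obtain m where m: "0 < m" "\<forall>x \<in> \<Omega> \<inter> cball p r. - m < \<rho> x \<longrightarrow> \<bar>V x \<bullet> grad \<rho> x\<bar> < \<delta>"
        using layer[OF \<delta>] by blast
      have "\<forall>\<^sub>F n in sequentially. h n < m / 2"
        using hlim m(1) by (intro order_tendstoD(2)) auto
      then obtain M where M: "\<And>n. M \<le> n \<Longrightarrow> h n < m / 2"
        by (auto simp: eventually_sequentially)
      have "\<delta> / c * D < E"
        using c0 E D0 by (simp add: \<delta>_def divide_less_eq) 
      then show "\<exists>M. \<forall>n\<ge>M. norm ((\<integral>x. g (h n) x \<partial>lebesgue) - 0) < E"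
        using g_small[OF h0 \<delta>, of _ m] M m(2) by (intro exI[of _ M]) (fastforce simp: mult.commute)
    qed
    from tendsto_minus[OF this] have "(\<lambda>n. \<integral>x. indicator W x * \<eta> (h n) x * f x \<partial>lebesgue) \<longlonglongrightarrow> 0"
      by (simp add: eq[OF h0])
    from LIMSEQ_unique[OF lim this] show "(\<integral>x. G x \<bullet> grad \<phi> x + F x * \<phi> x \<partial>lebesgue) = 0"
      by (simp add: f_def)
  qed
qed

end

context weak_equation
begin

text \<open>Finitely many boundary balls are removed from \<phi> one after the other by factors 1 -
  \<theta> p. Each removed piece lives in a ball where the local statement applies, and what remains
  vanishes on \<Omega> near the boundary.\<close>

lemma weak_equation_global:
  assumes bd: "C1_boundary \<Omega>"
    and V: "continuous_on (closure \<Omega>) V" and GV: "AE x in lebesgue. x \<in> \<Omega> \<longrightarrow> G x = V x"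
    and V\<nu>: "\<And>x \<nu>. outward_unit_normal \<Omega> x \<nu> \<Longrightarrow> V x \<bullet> \<nu> = 0"
    and \<phi>: "\<phi> \<in> C1c UNIV"
  shows "(\<integral>x. G x \<bullet> grad \<phi> x + F x * \<phi> x \<partial>lebesgue) = 0"
proof -
  define L where "L \<phi> = (\<integral>x. G x \<bullet> grad \<phi> x + F x * \<phi> x \<partial>lebesgue)" for \<phi>
  have "\<exists>s. 0 < s \<and> (\<forall>\<phi> \<in> C1c UNIV. (\<forall>x. x \<notin> cball p s \<longrightarrow> \<phi> x = 0) \<longrightarrow> L \<phi> = 0)"
    if p: "p \<in> frontier \<Omega>" for p
  proof -
    obtain W \<rho> where \<rho>: "local_defining_function \<Omega> p W \<rho>"
      using bd p by (auto simp: C1_boundary_def)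
    obtain s where "0 < s" "\<And>\<phi>. \<phi> \<in> C1c UNIV \<Longrightarrow> (\<And>x. x \<notin> cball p s \<Longrightarrow> \<phi> x = 0) \<Longrightarrow> L \<phi> = 0"
      using weak_equation_near_boundary[OF p \<rho> V GV V\<nu>] unfolding L_def by blast
    then show ?thesis
      by blast
  qed
  then have "\<forall>p \<in> frontier \<Omega>. \<exists>s. 0 < s \<and>
      (\<forall>\<phi> \<in> C1c UNIV. (\<forall>x. x \<notin> cball p s \<longrightarrow> \<phi> x = 0) \<longrightarrow> L \<phi> = 0)"
    by (rule ballI)
  from bchoice[OF this] obtain r where r_L0: "\<forall>p \<in> frontier \<Omega>. 0 < r p \<and>
      (\<forall>\<phi> \<in> C1c UNIV. (\<forall>x. x \<notin> cball p (r p) \<longrightarrow> \<phi> x = 0) \<longrightarrow> L \<phi> = 0)"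
    by (rule exE)
  then have r: "0 < r p" if "p \<in> frontier \<Omega>" for p
    using that by blast
  have L0: "L \<phi> = 0" if "p \<in> frontier \<Omega>" "\<phi> \<in> C1c UNIV" "\<And>x. x \<notin> cball p (r p) \<Longrightarrow> \<phi> x = 0" for p \<phi>
    using bspec[OF r_L0 that(1)] that(2,3) by blast
  \<comment> \<open>At |x - p| = r/2 the first factor is 3/4 r^2, so 4/(3 r^2) makes the argument of
    \<open>step\<close> reach 1 there.\<close>
  define \<theta> where "\<theta> p x = step (((r p)\<^sup>2 - (norm (x - p))\<^sup>2) * (4 / (3 * (r p)\<^sup>2)))" for p x
  have C1\<theta>: "C1_on UNIV (\<theta> p)" for p
    unfolding \<theta>_def[abs_def] by (intro C1_on_step C1_on_mult C1_on_diff C1_on_const C1_on_norm_sq)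
  have \<theta>0: "\<theta> p x = 0" if "p \<in> frontier \<Omega>" "x \<notin> cball p (r p)" for p x
  proof -
    have "(r p)\<^sup>2 \<le> (norm (x - p))\<^sup>2"
      using that r[of p] by (intro power_mono) (auto simp: dist_norm norm_minus_commute)
    then show ?thesis
      unfolding \<theta>_def by (intro step_eq_0 mult_nonpos_nonneg) auto
  qed
  have \<theta>1: "\<theta> p x = 1" if "p \<in> frontier \<Omega>" "x \<in> ball p (r p / 2)" for p x
  proof -
    have "(norm (x - p))\<^sup>2 \<le> (r p / 2)\<^sup>2"
      using that by (intro power_mono) (auto simp: dist_norm norm_minus_commute)
    then have "3 / 4 * (r p)\<^sup>2 * (4 / (3 * (r p)\<^sup>2)) \<le> ((r p)\<^sup>2 - (norm (x - p))\<^sup>2) * (4 / (3 * (r p)\<^sup>2))"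
      by (intro mult_right_mono) (auto simp: power_divide)
    then show ?thesis
      unfolding \<theta>_def using r[OF that(1)] by (intro step_eq_1) simp
  qed
  have compact: "compact (frontier \<Omega>)"
    using bounded_domain by (simp add: compact_frontier_bounded)
  have cover: "frontier \<Omega> \<subseteq> (\<Union>p\<in>frontier \<Omega>. ball p (r p / 2))"
    using r by (auto intro!: bexI centre_in_ball[THEN iffD2])
  obtain P where P: "P \<subseteq> frontier \<Omega>" "finite P" "frontier \<Omega> \<subseteq> (\<Union>p\<in>P. ball p (r p / 2))"
    by (rule compactE_image[OF compact open_ball cover])
  have *: "(\<lambda>x. \<phi> x * (\<Prod>p\<in>Q. 1 - \<theta> p x)) \<in> C1c UNIV \<and> L (\<lambda>x. \<phi> x * (\<Prod>p\<in>Q. 1 - \<theta> p x)) = L \<phi>"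
    if "finite Q" "Q \<subseteq> P" for Q
    using that
  proof (induction Q)
    case empty
    then show ?case
      using \<phi> by simp
  next
    case (insert q Q)
    let ?\<psi> = "\<lambda>x. \<phi> x * (\<Prod>p\<in>Q. 1 - \<theta> p x)"
    have \<psi>: "?\<psi> \<in> C1c UNIV" and L\<psi>: "L ?\<psi> = L \<phi>"
      using insert by auto
    have q: "q \<in> frontier \<Omega>"
      using insert P(1) by auto
    have eq: "(\<lambda>x. \<phi> x * (\<Prod>p\<in>insert q Q. 1 - \<theta> p x)) = (\<lambda>x. ?\<psi> x - ?\<psi> x * \<theta> q x)"
      using insert by (auto simp: algebra_simps)
    have 1: "(\<lambda>x. ?\<psi> x * \<theta> q x) \<in> C1c UNIV"
      by (rule C1c_mult[OF \<psi> C1\<theta>])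
    have "(\<lambda>x. ?\<psi> x * (1 - \<theta> q x)) \<in> C1c UNIV"
      by (intro C1c_mult[OF \<psi>] C1_on_diff C1_on_const C1\<theta>)
    then have 2: "(\<lambda>x. ?\<psi> x - ?\<psi> x * \<theta> q x) \<in> C1c UNIV"
      by (simp only: right_diff_distrib mult_1_right)
    have "grad (\<lambda>x. ?\<psi> x - ?\<psi> x * \<theta> q x) x = grad ?\<psi> x - grad (\<lambda>x. ?\<psi> x * \<theta> q x) x" for x
      by (rule grad_eqI[OF GDERIV_diff[OF C1_onD[OF C1c_imp_C1[OF \<psi>]] C1_onD[OF C1c_imp_C1[OF 1]]]]) simp_all
    then have "L (\<lambda>x. ?\<psi> x - ?\<psi> x * \<theta> q x) = (\<integral>x. (G x \<bullet> grad ?\<psi> x + F x * ?\<psi> x)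
        - (G x \<bullet> grad (\<lambda>x. ?\<psi> x * \<theta> q x) x + F x * (?\<psi> x * \<theta> q x)) \<partial>lebesgue)"
      unfolding L_def by (intro Bochner_Integration.integral_cong) (simp_all add: inner_diff_right right_diff_distrib)
    also have "\<dots> = L ?\<psi> - L (\<lambda>x. ?\<psi> x * \<theta> q x)"
      unfolding L_def by (intro Bochner_Integration.integral_diff weak_integrable \<psi> 1)
    also have "L (\<lambda>x. ?\<psi> x * \<theta> q x) = 0"
      using \<theta>0[OF q] by (intro L0[OF q 1]) simp
    finally show ?case
      unfolding eq using 2 L\<psi> by simp
  qed
  define \<psi> where "\<psi> x = \<phi> x * (\<Prod>p\<in>P. 1 - \<theta> p x)" for x
  have \<psi>: "\<psi> \<in> C1c UNIV" and L\<psi>: "L \<psi> = L \<phi>"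
    using *[OF P(2) order_refl] by (auto simp: \<psi>_def[abs_def])
  \<comment> \<open>Compact, and inside \<Omega> because the smaller balls cover the frontier; on
    \<Omega> outside K some factor 1 - \<theta> p is zero.\<close>
  define K where "K = closure \<Omega> - (\<Union>p\<in>P. ball p (r p / 2))"
  have K: "compact K" "K \<subseteq> \<Omega>"
  proof -
    show "compact K"
      unfolding K_def using bounded_domain by (intro compact_diff) auto
    have "closure \<Omega> = \<Omega> \<union> frontier \<Omega>"
      using open_domain closure_subset by (auto simp: frontier_def interior_open)
    then show "K \<subseteq> \<Omega>"
      unfolding K_def using P(3) by auto
  qed
  have \<psi>0: "\<psi> x = 0" if x: "x \<in> \<Omega> - K" for x
  proof -
    obtain p where "p \<in> P" "x \<in> ball p (r p / 2)"
      using x closure_subset[of \<Omega>] by (auto simp: K_def)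
    then have "(\<Prod>p\<in>P. 1 - \<theta> p x) = 0"
      using P(1,2) \<theta>1[of p x] by (intro prod_zero) auto
    then show ?thesis
      by (simp add: \<psi>_def)
  qed
  note ext = C1_on_extend_by_0[OF open_domain C1_on_subset[OF C1c_imp_C1[OF \<psi>] subset_UNIV] K \<psi>0]
  let ?\<psi> = "\<lambda>x. if x \<in> \<Omega> then \<psi> x else 0"
  have "?\<psi> \<in> C1c \<Omega>"
    using \<psi>0 K by (intro C1c_I[OF ext(1) K]) auto
  then have "L ?\<psi> = 0"
    using weak by (simp add: L_def)
  \<comment> \<open>The two functions may differ off \<Omega>, but \<open>G\<close> and
    \<open>F\<close> vanish there.\<close>
  moreover have "L \<psi> = L ?\<psi>"
    unfolding L_def
  proof (rule Bochner_Integration.integral_cong[OF refl])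
    show "G x \<bullet> grad \<psi> x + F x * \<psi> x = G x \<bullet> grad ?\<psi> x + F x * ?\<psi> x" for x
      using ext(2)[of x] G0[of x] F0[of x] by (cases "x \<in> \<Omega>") simp_all
  qed
  ultimately show ?thesis
    using L\<psi> by (simp add: L_def)
qed

end

text \<open>The counterpart of \<open>weak_solution_test\<close> for test functions whose support
  may cross the boundary; flatness and the C1 boundary enter here.\<close>

lemma flat_solution_test:
  fixes \<Omega> :: "'a::euclidean_space set"
  assumes "open \<Omega>" and "bounded \<Omega>" and "C1_boundary \<Omega>" and flat: "flat_solution \<Omega> \<alpha> \<beta> lam u"
    and \<alpha>: "0 < \<alpha>" "\<alpha> \<le> 1" and \<beta>: "0 < \<beta>" "\<beta> \<le> 1" and \<phi>: "\<phi> \<in> C1c UNIV"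
  defines "U \<equiv> \<lambda>x. indicator \<Omega> x *\<^sub>R u x"
  shows "(\<integral>x. (indicator \<Omega> x *\<^sub>R wgrad \<Omega> u x) \<bullet> grad \<phi> x \<partial>lebesgue)
      + (\<integral>x. (\<bar>U x\<bar> powr (\<alpha> - 1) * U x) * \<phi> x \<partial>lebesgue)
    = lam * (\<integral>x. (\<bar>U x\<bar> powr (\<beta> - 1) * U x) * \<phi> x \<partial>lebesgue)"
proof -
  have u: "weak_solution \<Omega> \<alpha> \<beta> lam u"
    using flat by (simp add: flat_solution_def)
  have H1: "u \<in> H1 \<Omega>" and L2u: "L2_on \<Omega> u"
    using u by (auto simp: weak_solution_def H1_0_def H1_def)
  obtain v V where rep: "C1_closure_rep \<Omega> u v V"
    and V\<nu>: "\<And>x \<nu>. x \<in> frontier \<Omega> \<Longrightarrow> outward_unit_normal \<Omega> x \<nu> \<Longrightarrow> V x \<bullet> \<nu> = 0"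
    using flat by (auto simp: flat_solution_def normal_derivative_zero_def)
  have V: "continuous_on (closure \<Omega>) V"
    using rep by (simp add: C1_closure_rep_def)
  define G where "G x = indicator \<Omega> x *\<^sub>R wgrad \<Omega> u x" for x
  define f where "f p x = \<bar>U x\<bar> powr (p - 1) * U x" for p x
  have L2U: "L2_on UNIV U"
    using L2u unfolding U_def by (simp only: L2_on_iff_extension[of \<Omega> u])
  have L2f: "L2_on UNIV (f p)" if "0 < p" "p \<le> 1" for p
    unfolding f_def by (rule L2_powr_mult[OF L2U assms(2) _ that]) (simp add: U_def)
  have L2G: "L2_on UNIV G"
    using H1_wgrad(1)[OF H1] unfolding G_def by (simp only: L2_on_iff_extension[of \<Omega> "wgrad \<Omega> u"])
  have eq: "(\<integral>x. G x \<bullet> grad \<psi> x + (f \<alpha> x - lam * f \<beta> x) * \<psi> x \<partial>lebesgue)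
      = (\<integral>x. G x \<bullet> grad \<psi> x \<partial>lebesgue) + (\<integral>x. f \<alpha> x * \<psi> x \<partial>lebesgue) - lam * (\<integral>x. f \<beta> x * \<psi> x \<partial>lebesgue)"
    if \<psi>: "\<psi> \<in> C1c UNIV" for \<psi>
    using L2_inner_integrable[OF L2G L2_C1c(2)[OF \<psi>]] L2_mult_integrable[OF L2f[OF \<alpha>] L2_C1c(1)[OF \<psi>]]
      L2_mult_integrable[OF L2f[OF \<beta>] L2_C1c(1)[OF \<psi>]]
    by (simp add: left_diff_distrib mult.assoc)
  interpret weak_equation \<Omega> G "\<lambda>x. f \<alpha> x - lam * f \<beta> x"
  proof
    show "L2_on UNIV (\<lambda>x. f \<alpha> x - lam * f \<beta> x)"
      using L2_diff[OF L2f[OF \<alpha>] L2_scaleR[OF L2f[OF \<beta>], of lam]] by simp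
    show "(\<integral>x. G x \<bullet> grad \<psi> x + (f \<alpha> x - lam * f \<beta> x) * \<psi> x \<partial>lebesgue) = 0" if \<psi>: "\<psi> \<in> C1c \<Omega>" for \<psi>
      using weak_solution_test[OF assms(1) u \<psi>] eq[OF C1c_mono[OF \<psi> subset_UNIV]]
      by (simp add: G_def f_def U_def)
  qed (use assms(1,2) L2G in \<open>auto simp: G_def f_def U_def\<close>)
  have "AE x in lebesgue. x \<in> \<Omega> \<longrightarrow> G x = V x"
    using wgrad_AE_eq[OF assms(1) C1_closure_rep_weak_gradient[OF assms(1,2) L2u rep]]
    by eventually_elim (simp add: G_def)
  from weak_equation_global[OF assms(3) V this _ \<phi>] V\<nu>
  have "(\<integral>x. G x \<bullet> grad \<phi> x + (f \<alpha> x - lam * f \<beta> x) * \<phi> x \<partial>lebesgue) = 0"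
    by (simp add: outward_unit_normal_def)
  then show ?thesis
    using eq[OF \<phi>] by (simp add: G_def f_def)
qed

section \<open>The sign of the second fibering derivative\<close>

theorem lemma1:
  fixes \<Omega> :: "'a::euclidean_space set" and \<alpha> \<beta> lam :: real
  assumes "open \<Omega>" and "connected \<Omega>" and "bounded \<Omega>" and "starlike \<Omega>" and "C1_boundary \<Omega>"
    and "lam > 0"
  shows "((\<alpha>, \<beta>) \<in> exps_crit DIM('a) \<longrightarrow>
            (\<forall>u. flat_ground_state \<Omega> \<alpha> \<beta> lam u \<longrightarrow> deriv (deriv (fibering \<Omega> \<alpha> \<beta> lam u)) 1 = 0))
       \<and> ((\<alpha>, \<beta>) \<in> exps_unstable DIM('a) \<longrightarrow>
            (\<forall>u. flat_ground_state \<Omega> \<alpha> \<beta> lam u \<longrightarrow> deriv (deriv (fibering \<Omega> \<alpha> \<beta> lam u)) 1 < 0))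
       \<and> ((\<alpha>, \<beta>) \<in> exps_stable DIM('a) \<longrightarrow>
            (\<forall>u. ground_state \<Omega> \<alpha> \<beta> lam u \<longrightarrow> deriv (deriv (fibering \<Omega> \<alpha> \<beta> lam u)) 1 > 0))"
proof -
  obtain a where "a \<in> \<Omega>" and a: "\<And>x. x \<in> \<Omega> \<Longrightarrow> closed_segment a x \<subseteq> \<Omega>"
    using \<open>starlike \<Omega>\<close> by (auto simp: starlike_def)
  define A where "A u = (LINT x:\<Omega>|lebesgue. (norm (wgrad \<Omega> u x))\<^sup>2)" for u
  \<comment> \<open>This is -N times the P of the overview, so the Pohozaev inequality reads
    \<open>0 \<le> P u\<close>.\<close>
  define P where "P u = (2 - real DIM('a)) / 2 * A u
    - real DIM('a) * ((LINT x:\<Omega>|lebesgue. \<bar>u x\<bar> powr (\<alpha> + 1)) / (\<alpha> + 1)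
      - lam * (LINT x:\<Omega>|lebesgue. \<bar>u x\<bar> powr (\<beta> + 1)) / (\<beta> + 1))" for u
  have main: "0 < A u \<and> 0 \<le> P u \<and> 2 * real DIM('a) * deriv (deriv (fibering \<Omega> \<alpha> \<beta> lam u)) 1
      = 2 * (1 + \<alpha>) * (1 + \<beta>) * P u - A u * discr DIM('a) \<alpha> \<beta>"
    if exps: "(\<alpha>, \<beta>) \<in> exps" and gs: "ground_state \<Omega> \<alpha> \<beta> lam u" for u
  proof -
    have e: "0 < \<alpha>" "\<alpha> < \<beta>" "\<beta> \<le> 1" "0 < \<beta>" "\<alpha> \<le> 1" "0 \<le> lam"
      using exps \<open>lam > 0\<close> by (auto simp: exps_def)
    have u: "weak_solution \<Omega> \<alpha> \<beta> lam u" and ne: "nonzero_on \<Omega> u"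
      using gs by (auto simp: ground_state_def)
    have H1: "u \<in> H1 \<Omega>"
      using u by (simp add: weak_solution_def H1_0_def)
    \<comment> \<open>The factor 1 is \<sigma>, written out so that the rule unifies; - 1 plays this
      part for flat solutions.\<close>
    have "0 \<le> 1 * P u"
      unfolding P_def A_def
    proof (rule weak_solution_pohozaev[OF \<open>open \<Omega>\<close> \<open>bounded \<Omega>\<close> u e(1,5,4,3,6)])
      fix \<phi> and h :: real assume \<phi>: "\<phi> \<in> C1c \<Omega>" and h: "0 < h"
      have "(\<lambda>x. \<phi> (a + (1 + 1 * h) *\<^sub>R (x - a))) \<in> C1c \<Omega>"
      proof (rule C1c_homothety[OF \<phi>])
        \<comment> \<open>The inverse homothety contracts towards the star centre, so x stays on its
          segment.\<close>
        show "a + (1 / (1 + 1 * h)) *\<^sub>R (x - a) \<in> \<Omega>" if "x \<in> \<Omega>" for x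
        proof -
          have "a + (1 / (1 + 1 * h)) *\<^sub>R (x - a) = (1 - 1 / (1 + 1 * h)) *\<^sub>R a + (1 / (1 + 1 * h)) *\<^sub>R x"
            by (simp add: algebra_simps)
          then have "a + (1 / (1 + 1 * h)) *\<^sub>R (x - a) \<in> closed_segment a x"
            unfolding closed_segment_def using h by force
          then show ?thesis
            using a[OF that] by blast
        qed
      qed (use h in simp)
      from weak_solution_test[OF \<open>open \<Omega>\<close> u this]
      show "(\<integral>x. (indicator \<Omega> x *\<^sub>R wgrad \<Omega> u x) \<bullet> grad (\<lambda>x. \<phi> (a + (1 + 1 * h) *\<^sub>R (x - a))) x \<partial>lebesgue)
          + (\<integral>x. (\<bar>indicator \<Omega> x *\<^sub>R u x\<bar> powr (\<alpha> - 1) * (indicator \<Omega> x *\<^sub>R u x)) * \<phi> (a + (1 + 1 * h) *\<^sub>R (x - a)) \<partial>lebesgue)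
          = lam * (\<integral>x. (\<bar>indicator \<Omega> x *\<^sub>R u x\<bar> powr (\<beta> - 1) * (indicator \<Omega> x *\<^sub>R u x)) * \<phi> (a + (1 + 1 * h) *\<^sub>R (x - a)) \<partial>lebesgue)" .
    qed simp
    then have "0 \<le> P u"
      by simp
    moreover from this have "0 < A u"
      unfolding A_def P_def by (rule gradient_pos_if_pohozaev[OF \<open>bounded \<Omega>\<close> u ne e(1-3)])
    ultimately show ?thesis
      unfolding P_def A_def deriv_deriv_fibering[OF \<open>open \<Omega>\<close> H1 e(1,4)]
      by (intro conjI second_fibering_derivative_discr[OF e(1,4) weak_solution_nehari[OF u]])
  qed
  have flat: "P u \<le> 0" if exps: "(\<alpha>, \<beta>) \<in> exps" and fs: "flat_ground_state \<Omega> \<alpha> \<beta> lam u" for u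
  proof -
    have e: "0 < \<alpha>" "\<alpha> \<le> 1" "0 < \<beta>" "\<beta> \<le> 1" "0 \<le> lam"
      using exps \<open>lam > 0\<close> by (auto simp: exps_def)
    have fl: "flat_solution \<Omega> \<alpha> \<beta> lam u"
      using fs by (simp add: flat_ground_state_def)
    then have u: "weak_solution \<Omega> \<alpha> \<beta> lam u"
      by (simp add: flat_solution_def)
    have "0 \<le> - 1 * P u"
      unfolding P_def A_def
    proof (rule weak_solution_pohozaev[OF \<open>open \<Omega>\<close> \<open>bounded \<Omega>\<close> u e])
      fix \<phi> and h :: real assume \<phi>: "\<phi> \<in> C1c \<Omega>" and h: "h \<le> 1/2"
      \<comment> \<open>The factor 1 - h < 1 enlarges the support, possibly beyond \<Omega>; h \<le>
        1/2 keeps it positive.\<close>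
      have "(\<lambda>x. \<phi> (a + (1 + - 1 * h) *\<^sub>R (x - a))) \<in> C1c UNIV"
        using h by (intro C1c_homothety[OF \<phi>]) auto
      from flat_solution_test[OF \<open>open \<Omega>\<close> \<open>bounded \<Omega>\<close> \<open>C1_boundary \<Omega>\<close> fl e(1-4) this]
      show "(\<integral>x. (indicator \<Omega> x *\<^sub>R wgrad \<Omega> u x) \<bullet> grad (\<lambda>x. \<phi> (a + (1 + - 1 * h) *\<^sub>R (x - a))) x \<partial>lebesgue)
          + (\<integral>x. (\<bar>indicator \<Omega> x *\<^sub>R u x\<bar> powr (\<alpha> - 1) * (indicator \<Omega> x *\<^sub>R u x)) * \<phi> (a + (1 + - 1 * h) *\<^sub>R (x - a)) \<partial>lebesgue)
          = lam * (\<integral>x. (\<bar>indicator \<Omega> x *\<^sub>R u x\<bar> powr (\<beta> - 1) * (indicator \<Omega> x *\<^sub>R u x)) * \<phi> (a + (1 + - 1 * h) *\<^sub>R (x - a)) \<partial>lebesgue)" .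
    qed simp
    then show ?thesis
      by simp
  qed
  have fgs: "ground_state \<Omega> \<alpha> \<beta> lam u" if "flat_ground_state \<Omega> \<alpha> \<beta> lam u" for u
    using that by (simp add: flat_ground_state_def)
  have N: "0 < real DIM('a)"
    by simp
  show ?thesis
  proof (intro conjI impI allI)
    fix u assume "(\<alpha>, \<beta>) \<in> exps_crit DIM('a)" and u: "flat_ground_state \<Omega> \<alpha> \<beta> lam u"
    then have "(\<alpha>, \<beta>) \<in> exps" "discr DIM('a) \<alpha> \<beta> = 0"
      by (auto simp: exps_crit_def)
    \<comment> \<open>Flatness gives P u = 0, so both terms of the identity vanish.\<close>
    with main[OF _ fgs[OF u]] flat[OF _ u] show "deriv (deriv (fibering \<Omega> \<alpha> \<beta> lam u)) 1 = 0"
      by auto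
  next
    fix u assume "(\<alpha>, \<beta>) \<in> exps_unstable DIM('a)" and u: "flat_ground_state \<Omega> \<alpha> \<beta> lam u"
    then have "(\<alpha>, \<beta>) \<in> exps" "0 < discr DIM('a) \<alpha> \<beta>"
      by (auto simp: exps_unstable_def)
    with main[OF _ fgs[OF u]] flat[OF _ u]
    have "2 * real DIM('a) * deriv (deriv (fibering \<Omega> \<alpha> \<beta> lam u)) 1 = - (A u * discr DIM('a) \<alpha> \<beta>)"
      and "0 < A u * discr DIM('a) \<alpha> \<beta>"
      by auto
    then show "deriv (deriv (fibering \<Omega> \<alpha> \<beta> lam u)) 1 < 0"
      using N by (metis mult_less_0_iff neg_less_0_iff_less not_less_iff_gr_or_eq zero_less_mult_pos zero_less_numeral)
  next
    fix u assume "(\<alpha>, \<beta>) \<in> exps_stable DIM('a)" and u: "ground_state \<Omega> \<alpha> \<beta> lam u"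
    then have exps: "(\<alpha>, \<beta>) \<in> exps" and D: "discr DIM('a) \<alpha> \<beta> < 0"
      by (auto simp: exps_stable_def)
    \<comment> \<open>For a negative discriminant the two terms of the identity have the same sign,
      so the one-sided inequality suffices.\<close>
    have "0 \<le> 2 * (1 + \<alpha>) * (1 + \<beta>) * P u"
      using main[OF exps u] exps by (auto simp: exps_def)
    moreover have "A u * discr DIM('a) \<alpha> \<beta> < 0"
      using main[OF exps u] D by (simp add: mult_pos_neg)
    ultimately have "0 < 2 * real DIM('a) * deriv (deriv (fibering \<Omega> \<alpha> \<beta> lam u)) 1"
      using main[OF exps u] by linarith
    then show "0 < deriv (deriv (fibering \<Omega> \<alpha> \<beta> lam u)) 1"
      using N by (simp add: zero_less_mult_iff)
  qed
qed

end
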